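(* Let $K_0$ be a field and let $K/K_0$ be a proper (i.e. $K\neq K_0$) separable algebraic extension that is a PAC extension. Then the Galois closure of $K/K_0$ is the separable closure of $K_0$. In particular, if $K/K_0$ is a Galois PAC extension, then either $K=K_0$ or $K=K_s$, where $K_s$ is the separable closure of $K$.
   Context: A field extension $K/K_0$ is called a PAC extension (or: $K/K_0$ is PAC) if for every absolutely irreducible variety $V$ of dimension $r\geq 1$ defined over $K$ and every separable dominating rational map $\nu\colon V\to\mathbb{A}^r$ defined over $K$ there exists $a\in V(K)$ for which $\nu(a)\in K_0^r$. Galois extensions may be infinite. *)

theory Defs
  imports
    "HOL-Library.Poly_Mapping"
    "HOL-Computational_Algebra.Polynomial"
    "HOL-Computational_Algebra.Fraction_Field"
    "HOL-Algebra.Algebraic_Closure_Type"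
begin

section \<open>Subfields of an algebraically closed field\<close>

text \<open>All fields are subsets of an ambient algebraically closed field, given by a type. Every field
  has such an overfield, for example its algebraic closure.\<close>

definition is_subfield :: "'a::field set \<Rightarrow> bool" where
  "is_subfield F \<longleftrightarrow> 0 \<in> F \<and> 1 \<in> F \<and>
     (\<forall>x\<in>F. \<forall>y\<in>F. x + y \<in> F \<and> x * y \<in> F) \<and> (\<forall>x\<in>F. - x \<in> F \<and> inverse x \<in> F)"

definition field_extension :: "'a::field set \<Rightarrow> 'a set \<Rightarrow> bool" where
  "field_extension F L \<longleftrightarrow> is_subfield F \<and> is_subfield L \<and> F \<subseteq> L"

definition generated_field :: "'a::field set \<Rightarrow> 'a set" where
  "generated_field S = \<Inter> {F. is_subfield F \<and> S \<subseteq> F}"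

definition algebraic_element :: "'a::field set \<Rightarrow> 'a \<Rightarrow> bool" where
  "algebraic_element F x \<longleftrightarrow> (\<exists>p. p \<noteq> 0 \<and> set (coeffs p) \<subseteq> F \<and> poly p x = 0)"

definition algebraic_extension :: "'a::field set \<Rightarrow> 'a set \<Rightarrow> bool" where
  "algebraic_extension F L \<longleftrightarrow> field_extension F L \<and> (\<forall>x\<in>L. algebraic_element F x)"

definition is_min_poly :: "'a::field set \<Rightarrow> 'a \<Rightarrow> 'a poly \<Rightarrow> bool" where
  "is_min_poly F x p \<longleftrightarrow> lead_coeff p = 1 \<and> set (coeffs p) \<subseteq> F \<and> poly p x = 0 \<and>
     (\<forall>q. q \<noteq> 0 \<and> set (coeffs q) \<subseteq> F \<and> poly q x = 0 \<longrightarrow> degree p \<le> degree q)"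

text \<open>As the ambient field is algebraically closed, \<^const>\<open>rsquarefree\<close> says that the minimal
  polynomial has no multiple root in an algebraic closure of \<open>F\<close>.\<close>

definition separable_element :: "'a::alg_closed_field set \<Rightarrow> 'a \<Rightarrow> bool" where
  "separable_element F x \<longleftrightarrow> (\<exists>p. is_min_poly F x p \<and> rsquarefree p)"

definition separable_algebraic_extension :: "'a::alg_closed_field set \<Rightarrow> 'a set \<Rightarrow> bool" where
  "separable_algebraic_extension F L \<longleftrightarrow>
     algebraic_extension F L \<and> (\<forall>x\<in>L. separable_element F x)"

definition normal_extension :: "'a::alg_closed_field set \<Rightarrow> 'a set \<Rightarrow> bool" where
  "normal_extension F L \<longleftrightarrow> algebraic_extension F L \<and>
     (\<forall>x\<in>L. \<forall>p. is_min_poly F x p \<longrightarrow> (\<forall>y. poly p y = 0 \<longrightarrow> y \<in> L))"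

definition galois_extension :: "'a::alg_closed_field set \<Rightarrow> 'a set \<Rightarrow> bool" where
  "galois_extension F L \<longleftrightarrow> separable_algebraic_extension F L \<and> normal_extension F L"

definition galois_closure :: "'a::alg_closed_field set \<Rightarrow> 'a set \<Rightarrow> 'a set" where
  "galois_closure F L = \<Inter> {N. galois_extension F N \<and> L \<subseteq> N}"

definition separable_closure :: "'a::alg_closed_field set \<Rightarrow> 'a set" where
  "separable_closure F = {x. separable_element F x}"


section \<open>Affine algebraic sets\<close>

text \<open>Polynomials in the variables \<open>X\<^sub>0, X\<^sub>1, \<dots>\<close>: a monomial maps each variable to its exponent.\<close>

type_synonym 'a mpoly = "(nat \<Rightarrow>\<^sub>0 nat) \<Rightarrow>\<^sub>0 'a"

definition mpolys :: "nat \<Rightarrow> 'a::zero set \<Rightarrow> 'a mpoly set" where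
  "mpolys n F = {p. (\<forall>m\<in>Poly_Mapping.keys p. Poly_Mapping.lookup p m \<in> F \<and>
                       Poly_Mapping.keys m \<subseteq> {..<n})}"

definition insertion :: "(nat \<Rightarrow> 'a) \<Rightarrow> 'a::comm_semiring_1 mpoly \<Rightarrow> 'a" where
  "insertion x p = (\<Sum>m\<in>Poly_Mapping.keys p.
     Poly_Mapping.lookup p m * (\<Prod>i\<in>Poly_Mapping.keys m. x i ^ Poly_Mapping.lookup m i))"

definition affine_space :: "nat \<Rightarrow> (nat \<Rightarrow> 'a::zero) set" where
  "affine_space n = {x. \<forall>i\<ge>n. x i = 0}"

definition zero_locus :: "nat \<Rightarrow> 'a::field mpoly set \<Rightarrow> (nat \<Rightarrow> 'a) set" where
  "zero_locus n S = {x \<in> affine_space n. \<forall>p\<in>S. insertion x p = 0}"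

definition algebraic_set :: "nat \<Rightarrow> (nat \<Rightarrow> 'a::field) set \<Rightarrow> bool" where
  "algebraic_set n V \<longleftrightarrow> (\<exists>S \<subseteq> mpolys n UNIV. V = zero_locus n S)"

definition irreducible_algebraic_set :: "nat \<Rightarrow> (nat \<Rightarrow> 'a::field) set \<Rightarrow> bool" where
  "irreducible_algebraic_set n V \<longleftrightarrow> algebraic_set n V \<and> V \<noteq> {} \<and>
     (\<forall>V1 V2. algebraic_set n V1 \<and> algebraic_set n V2 \<and> V = V1 \<union> V2 \<longrightarrow> V = V1 \<or> V = V2)"

definition vanishing_ideal :: "nat \<Rightarrow> (nat \<Rightarrow> 'a::field) set \<Rightarrow> 'a mpoly set" where
  "vanishing_ideal n V = {p \<in> mpolys n UNIV. \<forall>x\<in>V. insertion x p = 0}"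

definition generated_ideal :: "nat \<Rightarrow> 'a::field mpoly set \<Rightarrow> 'a mpoly set" where
  "generated_ideal n S =
     {\<Sum>s\<in>T. c s * s | T c. finite T \<and> T \<subseteq> S \<and> (\<forall>s\<in>T. c s \<in> mpolys n UNIV)}"

text \<open>\<open>V\<close> is an irreducible algebraic set over the algebraically closed ambient field, and it is
  defined over \<open>K\<close> in Weil's sense: its full vanishing ideal is generated by polynomials with
  coefficients in \<open>K\<close>. Over an imperfect \<open>K\<close> this is stronger than being the zero locus of
  polynomials with coefficients in \<open>K\<close>.\<close>

definition abs_irreducible_variety ::
    "'a::alg_closed_field set \<Rightarrow> nat \<Rightarrow> (nat \<Rightarrow> 'a) set \<Rightarrow> bool" where
  "abs_irreducible_variety K n V \<longleftrightarrow> irreducible_algebraic_set n V \<and>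
     (\<exists>S \<subseteq> mpolys n K. vanishing_ideal n V = generated_ideal n S)"


section \<open>Function fields\<close>

text \<open>The algebraic closure of the field of rational functions in infinitely many variables over the
  ambient field is a universal domain: every variety over the ambient field has a generic point
  with coordinates in it.\<close>

type_synonym 'a universal_domain = "'a mpoly fract alg_closure"

definition to_universal :: "'a::field \<Rightarrow> 'a universal_domain" where
  "to_universal c = to_ac (Fract (Poly_Mapping.single 0 c) 1)"

definition universal_insertion ::
    "(nat \<Rightarrow> 'a universal_domain) \<Rightarrow> 'a::field mpoly \<Rightarrow> 'a universal_domain" where
  "universal_insertion x p = insertion x (Poly_Mapping.map to_universal p)"

definition generic_point ::
    "nat \<Rightarrow> (nat \<Rightarrow> 'a::field) set \<Rightarrow> (nat \<Rightarrow> 'a universal_domain) \<Rightarrow> bool" where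
  "generic_point n V x \<longleftrightarrow>
     (\<forall>p\<in>mpolys n UNIV. universal_insertion x p = 0 \<longleftrightarrow> p \<in> vanishing_ideal n V)"

text \<open>For a generic point \<open>x\<close> of \<open>V\<close>, the field \<open>K(x)\<close> is the function field of \<open>V\<close> over \<open>K\<close>.\<close>

definition function_field ::
    "'a::field set \<Rightarrow> nat \<Rightarrow> (nat \<Rightarrow> 'a universal_domain) \<Rightarrow> 'a universal_domain set" where
  "function_field K n x = generated_field (to_universal ` K \<union> x ` {..<n})"

definition algebraically_independent :: "'a::field set \<Rightarrow> nat \<Rightarrow> (nat \<Rightarrow> 'a) \<Rightarrow> bool" where
  "algebraically_independent F r b \<longleftrightarrow> (\<forall>p\<in>mpolys r F. insertion b p = 0 \<longrightarrow> p = 0)"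

definition has_transcendence_degree :: "'a::field set \<Rightarrow> 'a set \<Rightarrow> nat \<Rightarrow> bool" where
  "has_transcendence_degree F L r \<longleftrightarrow> (\<exists>b. b ` {..<r} \<subseteq> L \<and> algebraically_independent F r b \<and>
     algebraic_extension (generated_field (F \<union> b ` {..<r})) L)"

definition has_dimension :: "'a::field set \<Rightarrow> nat \<Rightarrow> (nat \<Rightarrow> 'a) set \<Rightarrow> nat \<Rightarrow> bool" where
  "has_dimension K n V r \<longleftrightarrow> (\<exists>x. generic_point n V x \<and>
     has_transcendence_degree (to_universal ` K) (function_field K n x) r)"


section \<open>Rational maps to affine space\<close>

text \<open>A rational function is given by a numerator and a denominator. Its value at a point may be
  computed from any pair that represents the same element of the function field.\<close>

type_synonym 'a rational_map = "nat \<Rightarrow> 'a mpoly \<times> 'a mpoly"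

definition is_rational_map ::
    "'a::field set \<Rightarrow> nat \<Rightarrow> (nat \<Rightarrow> 'a) set \<Rightarrow> nat \<Rightarrow> 'a rational_map \<Rightarrow> bool" where
  "is_rational_map K n V r \<nu> \<longleftrightarrow>
     (\<forall>i<r. fst (\<nu> i) \<in> mpolys n K \<and> snd (\<nu> i) \<in> mpolys n K \<and>
            snd (\<nu> i) \<notin> vanishing_ideal n V)"

definition has_value_at ::
    "nat \<Rightarrow> (nat \<Rightarrow> 'a::field) set \<Rightarrow> 'a mpoly \<times> 'a mpoly \<Rightarrow> (nat \<Rightarrow> 'a) \<Rightarrow> 'a \<Rightarrow> bool" where
  "has_value_at n V \<phi> a c \<longleftrightarrow> (\<exists>g\<in>mpolys n UNIV. \<exists>h\<in>mpolys n UNIV.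
     fst \<phi> * h - g * snd \<phi> \<in> vanishing_ideal n V \<and>
     insertion a h \<noteq> 0 \<and> c = insertion a g / insertion a h)"

text \<open>\<open>\<nu>\<close> is defined at \<open>a\<close>, with image point \<open>b\<close> in affine \<open>r\<close>-space.\<close>

definition maps_to ::
    "nat \<Rightarrow> (nat \<Rightarrow> 'a::field) set \<Rightarrow> nat \<Rightarrow> 'a rational_map \<Rightarrow> (nat \<Rightarrow> 'a) \<Rightarrow> (nat \<Rightarrow> 'a) \<Rightarrow> bool" where
  "maps_to n V r \<nu> a b \<longleftrightarrow> b \<in> affine_space r \<and> (\<forall>i<r. has_value_at n V (\<nu> i) a (b i))"

definition dominating ::
    "nat \<Rightarrow> (nat \<Rightarrow> 'a::field) set \<Rightarrow> nat \<Rightarrow> 'a rational_map \<Rightarrow> bool" where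
  "dominating n V r \<nu> \<longleftrightarrow>
     (\<forall>W. algebraic_set r W \<and> {b. \<exists>a\<in>V. maps_to n V r \<nu> a b} \<subseteq> W \<longrightarrow> W = affine_space r)"

text \<open>For dominating \<open>\<nu>\<close> and \<open>V\<close> of dimension \<open>r\<close> the function field of \<open>V\<close> is algebraic over that of
  affine \<open>r\<close>-space, so that separability is that of an algebraic extension.\<close>

definition separable_map ::
    "'a::field set \<Rightarrow> nat \<Rightarrow> (nat \<Rightarrow> 'a) set \<Rightarrow> nat \<Rightarrow> 'a rational_map \<Rightarrow> bool" where
  "separable_map K n V r \<nu> \<longleftrightarrow> (\<exists>x. generic_point n V x \<and>
     separable_algebraic_extension
       (generated_field (to_universal ` K \<union>
          (\<lambda>i. universal_insertion x (fst (\<nu> i)) / universal_insertion x (snd (\<nu> i))) ` {..<r}))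
       (function_field K n x))"


section \<open>PAC extensions\<close>

text \<open>Affine varieties suffice: a rational map and the function field of an arbitrary variety can be
  restricted to a nonempty affine open subvariety.\<close>

definition PAC_extension :: "'a::alg_closed_field set \<Rightarrow> 'a set \<Rightarrow> bool" where
  "PAC_extension K0 K \<longleftrightarrow> field_extension K0 K \<and>
     (\<forall>n r V \<nu>. r \<ge> 1 \<and> abs_irreducible_variety K n V \<and> has_dimension K n V r \<and>
        is_rational_map K n V r \<nu> \<and> dominating n V r \<nu> \<and> separable_map K n V r \<nu> \<longrightarrow>
        (\<exists>a\<in>V. \<exists>b. (\<forall>i<n. a i \<in> K) \<and> maps_to n V r \<nu> a b \<and> (\<forall>i<r. b i \<in> K0)))"

end

theory Submission
  imports Defs "Jordan_Normal_Form.Char_Poly"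
begin

text \<open>Let \<open>c \<in> K\<close> lie outside \<open>K\<^sub>0\<close>, let \<open>p\<close> be a separable monic polynomial of degree \<open>n\<close> over
  \<open>K\<close>, and let \<open>N\<close> be a Galois extension of \<open>K\<^sub>0\<close> that contains \<open>K\<close>. It suffices to show that
  \<open>p\<close> splits in \<open>N\<close>.

  A monic polynomial \<open>U(T, X)\<close> of degree \<open>n\<close> in \<open>X\<close> whose other coefficients have degree less than
  \<open>[K\<^sub>0(c) : K\<^sub>0]\<close> in \<open>T\<close> is determined by its values at the conjugates of \<open>c\<close>. Require that
  \<open>U(c, X)\<close> be the product of the \<open>X - x\<^sub>k\<close> and that, at every other conjugate \<open>c'\<close>, \<open>U(c', X)\<close>
  be the characteristic polynomial of the element \<open>\<Sum> y\<^sub>i\<^sub>j c'\<^sup>j Z\<^sup>i\<close> of \<open>K(c')[Z]/(p)\<close>. The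
  coefficients of \<open>U\<close> are then polynomials over \<open>K\<close> in the \<open>x\<^sub>k\<close> and \<open>y\<^sub>i\<^sub>j\<close> and define a
  separable dominating map from affine space to affine space of the same dimension. One more
  coordinate \<open>w\<close>, which is mapped to \<open>w + 1/\<Delta>\<close> with \<open>\<Delta>\<close> the product of the differences of the
  \<open>x\<^sub>k\<close>, makes the map undefined where two of the \<open>x\<^sub>k\<close> coincide. Hence the PAC property yields
  values in \<open>K\<close> with distinct \<open>x\<^sub>k\<close> for which \<open>U\<close> has coefficients in \<open>K\<^sub>0\<close>. Conjugating \<open>c\<close> to
  \<open>c'\<close>, the roots of \<open>U(c', X)\<close> are distinct and lie in \<open>N\<close> since those of \<open>U(c, X)\<close> do; they
  generate the same field over \<open>K(c')\<close> as the roots of \<open>p\<close>.\<close>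

subsection \<open>Polynomials over subrings\<close>

text \<open>By construction \<open>U(c, X)\<close> splits over \<open>K\<close> and carries no trace
  of \<open>p\<close>; all information about \<open>p\<close> sits at the other conjugates of
  \<open>c\<close>, and only the rationality of the coefficients of \<open>U\<close> over the small
  field links the two sides. This is why \<open>c\<close> is taken outside that field: a second
  conjugate must exist. The characteristic polynomial is a norm, so it has coefficients over
  \<open>K(c')\<close> even where the roots of \<open>p\<close> lie outside, and this is what allows
  \<open>U\<close> to be interpolated over \<open>K\<close>. With \<open>e\<close> other conjugates,
  the \<open>n\<close> free coefficients of \<open>U\<close> have \<open>n (e + 1)\<close> entries,
  as many as the \<open>n\<close> parameters \<open>x\<close> and the \<open>n e\<close> parameters
  \<open>y\<close> together. Over an algebraic closure a linear change of coordinates turns the map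
  into \<open>e + 1\<close> copies of the map from \<open>n\<close> roots to \<open>n\<close>
  coefficients, which is the reason why it is dominating and separable. The PAC property gives no
  control over the position of its point; a pole of the map is the means to keep that point off a
  closed set. Conjugation is carried out without automorphisms: a suitable multiple of
  \<open>U(c, X)\<close> over the small field is also a multiple of \<open>U(c', X)\<close>.\<close>

definition is_subring :: "'a::comm_ring_1 set \<Rightarrow> bool" where
  "is_subring S \<longleftrightarrow> 0 \<in> S \<and> 1 \<in> S \<and> (\<forall>x\<in>S. \<forall>y\<in>S. x + y \<in> S \<and> x * y \<in> S) \<and> (\<forall>x\<in>S. - x \<in> S)"

text \<open>Relative to a set, so that it can be iterated:
  \<open>polys_over (polys_over (mpolys N K))\<close> serves as a polynomial ring in two further
  variables over \<open>K\<close>.\<close>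

definition polys_over :: "'a::comm_ring_1 set \<Rightarrow> 'a poly set" where
  "polys_over S = {p. \<forall>i. coeff p i \<in> S}"

lemma is_subfield_imp_subring: "is_subfield F \<Longrightarrow> is_subring F"
  by (auto simp: is_subfield_def is_subring_def)

context
  fixes S :: "'a::idom set"
  assumes S: "is_subring S"
begin

lemma subring_0: "0 \<in> S" and subring_1: "1 \<in> S"
  and subring_add: "x \<in> S \<Longrightarrow> y \<in> S \<Longrightarrow> x + y \<in> S"
  and subring_mult: "x \<in> S \<Longrightarrow> y \<in> S \<Longrightarrow> x * y \<in> S"
  and subring_uminus: "x \<in> S \<Longrightarrow> - x \<in> S"
  using S by (auto simp: is_subring_def)

lemma subring_diff: "x \<in> S \<Longrightarrow> y \<in> S \<Longrightarrow> x - y \<in> S"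
  using subring_add[of x "- y"] subring_uminus[of y] by simp

lemma subring_sum: "(\<And>i. i \<in> I \<Longrightarrow> f i \<in> S) \<Longrightarrow> sum f I \<in> S"
  by (induction I rule: infinite_finite_induct) (auto intro: subring_0 subring_add)

lemma subring_prod: "(\<And>i. i \<in> I \<Longrightarrow> f i \<in> S) \<Longrightarrow> prod f I \<in> S"
  by (induction I rule: infinite_finite_induct) (auto intro: subring_1 subring_mult)

lemma subring_power: "x \<in> S \<Longrightarrow> x ^ n \<in> S"
  by (induction n) (auto intro: subring_1 subring_mult)

lemma set_coeffs_subset_iff: "set (coeffs p) \<subseteq> S \<longleftrightarrow> p \<in> polys_over S"
proof -
  have "coeff p i \<in> insert 0 (set (coeffs p))" for i
    using range_coeff[of p] by blast
  moreover have "set (coeffs p) \<subseteq> range (coeff p)"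
    using range_coeff[of p] by blast
  ultimately show ?thesis
    using subring_0 unfolding polys_over_def by (auto simp: subset_iff) (metis insert_iff)
qed

lemma subring_polys_over: "is_subring (polys_over S)"
  unfolding is_subring_def polys_over_def
  by (auto simp: coeff_mult coeff_1 intro!: subring_0 subring_1 subring_add subring_mult subring_sum
      subring_uminus)

lemma poly_in_subring: "p \<in> polys_over S \<Longrightarrow> x \<in> S \<Longrightarrow> poly p x \<in> S"
  unfolding poly_altdef polys_over_def by (auto intro!: subring_sum subring_mult subring_power)

lemma pCons_in_polys_over: "a \<in> S \<Longrightarrow> p \<in> polys_over S \<Longrightarrow> pCons a p \<in> polys_over S"
  unfolding polys_over_def by (auto simp: coeff_pCons split: nat.split)

lemma const_in_polys_over: "a \<in> S \<Longrightarrow> [:a:] \<in> polys_over S"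
  by (intro pCons_in_polys_over) (auto simp: polys_over_def subring_0)

lemma linear_in_polys_over: "a \<in> S \<Longrightarrow> [:- a, 1:] \<in> polys_over S"
  by (intro pCons_in_polys_over const_in_polys_over subring_uminus subring_1)

lemma monom_in_polys_over: "a \<in> S \<Longrightarrow> Polynomial.monom a n \<in> polys_over S"
  unfolding polys_over_def by (auto simp: subring_0)

lemma pderiv_in_polys_over:
  assumes "p \<in> polys_over S"
  shows "pderiv p \<in> polys_over S"
proof -
  have "of_nat n \<in> S" for n
    by (induction n) (auto intro: subring_0 subring_1 subring_add)
  then show ?thesis
    using assms unfolding polys_over_def by (auto simp: coeff_pderiv simp del: of_nat_Suc intro!: subring_mult)
qed

end

text \<open>Division by a monic polynomial inverts no coefficient, so quotient and remainder stay
  over any subring. It is applied over fields and over polynomial rings alike.\<close>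

lemma monic_division:
  fixes S :: "'a::idom set"
  assumes S: "is_subring S" and g: "lead_coeff g = 1" "g \<in> polys_over S" and f: "f \<in> polys_over S"
  obtains h r where "h \<in> polys_over S" "r \<in> polys_over S" "f = h * g + r"
    "r = 0 \<or> degree r < degree g"
proof -
  note R = subring_polys_over[OF S]
  have "\<exists>h r. h \<in> polys_over S \<and> r \<in> polys_over S \<and> f = h * g + r \<and> (r = 0 \<or> degree r < degree g)"
    using f
  proof (induction "degree f" arbitrary: f rule: less_induct)
    case less
    show ?case
    proof (cases "f = 0 \<or> degree f < degree g")
      case True
      then show ?thesis
        using less.prems R by (intro exI[of _ 0] exI[of _ f]) (auto simp: is_subring_def)
    next
      case False
      define c where "c = Polynomial.monom (lead_coeff f) (degree f - degree g)"
      have c: "c \<in> polys_over S"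
        unfolding c_def using less.prems by (intro monom_in_polys_over[OF S]) (auto simp: polys_over_def)
      have cg: "coeff (c * g) (degree f) = lead_coeff f" "degree (c * g) \<le> degree f"
      proof -
        show "degree (c * g) \<le> degree f"
          using False degree_mult_le[of c g] degree_monom_le[of "lead_coeff f" "degree f - degree g"]
          unfolding c_def by linarith
        show "coeff (c * g) (degree f) = lead_coeff f"
          using False g(1) unfolding c_def coeff_monom_mult by simp
      qed
      define f1 where "f1 = f - c * g"
      have f1: "f1 \<in> polys_over S"
        using R less.prems c g(2) unfolding f1_def by (intro subring_diff[OF R] subring_mult[OF R])
      have f1z: "coeff f1 (degree f) = 0"
        using cg unfolding f1_def by simp
      have dle: "degree f1 \<le> degree f"
        unfolding f1_def using cg(2) by (simp add: degree_diff_le)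
      have "f1 = 0 \<or> degree f1 < degree f"
        using f1z dle by (metis le_neq_implies_less leading_coeff_0_iff)
      then show ?thesis
      proof
        assume "f1 = 0"
        then show ?thesis
          using c R unfolding f1_def by (intro exI[of _ c] exI[of _ 0]) (auto simp: is_subring_def)
      next
        assume "degree f1 < degree f"
        then obtain h r where "h \<in> polys_over S" "r \<in> polys_over S" "f1 = h * g + r"
          "r = 0 \<or> degree r < degree g"
          using less.hyps[OF _ f1] by blast
        moreover from this have "f = (h + c) * g + r"
          unfolding f1_def by (simp add: algebra_simps)
        ultimately show ?thesis
          using subring_add[OF R] c by blast
      qed
    qed
  qed
  then show thesis
    using that by blast
qed

lemma monic_degree_zero: "lead_coeff p = 1 \<Longrightarrow> degree p = 0 \<Longrightarrow> p = 1"
  by (elim degree_eq_zeroE) (auto simp: one_pCons)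

lemma polys_over_mono: "F \<subseteq> L \<Longrightarrow> p \<in> polys_over F \<Longrightarrow> p \<in> polys_over L"
  by (auto simp: polys_over_def)

subsection \<open>Minimal polynomials\<close>

lemma subfield_inverse: "is_subfield F \<Longrightarrow> x \<in> F \<Longrightarrow> inverse x \<in> F"
  by (simp add: is_subfield_def)

lemma subfield_divide: "is_subfield F \<Longrightarrow> x \<in> F \<Longrightarrow> y \<in> F \<Longrightarrow> x / y \<in> F"
  by (simp add: is_subfield_def divide_inverse)

lemma is_min_poly_iff:
  assumes "is_subfield F"
  shows "is_min_poly F x p \<longleftrightarrow> lead_coeff p = 1 \<and> p \<in> polys_over F \<and> poly p x = 0 \<and>
     (\<forall>q. q \<noteq> 0 \<and> q \<in> polys_over F \<and> poly q x = 0 \<longrightarrow> degree p \<le> degree q)"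
  using set_coeffs_subset_iff[OF is_subfield_imp_subring[OF assms]]
  unfolding is_min_poly_def by auto

lemma is_min_poly_degree_pos:
  assumes "is_subfield F" "is_min_poly F x p"
  shows "degree p > 0"
proof (rule ccontr)
  assume "\<not> degree p > 0"
  then have "p = 1"
    using assms monic_degree_zero unfolding is_min_poly_def by blast
  then show False
    using assms unfolding is_min_poly_def by simp
qed

lemma algebraic_element_iff:
  assumes "is_subfield F"
  shows "algebraic_element F x \<longleftrightarrow> (\<exists>p. p \<noteq> 0 \<and> p \<in> polys_over F \<and> poly p x = 0)"
  using set_coeffs_subset_iff[OF is_subfield_imp_subring[OF assms]]
  unfolding algebraic_element_def by auto

lemma min_poly_exists:
  assumes F: "is_subfield F" and "algebraic_element F x"
  obtains p where "is_min_poly F x p"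
proof -
  define P where "P = (\<lambda>p. p \<noteq> 0 \<and> p \<in> polys_over F \<and> poly p x = 0)"
  have "\<exists>p. P p"
    using assms by (simp add: algebraic_element_iff P_def)
  then obtain p where p: "P p" and min: "\<And>q. P q \<Longrightarrow> degree p \<le> degree q"
    using exists_least_iff[of "\<lambda>n. \<exists>p. P p \<and> degree p = n"] by (metis not_le)
  define p' where "p' = smult (inverse (lead_coeff p)) p"
  have "p' \<in> polys_over F"
    using p F unfolding p'_def P_def polys_over_def by (auto simp: is_subfield_def)
  moreover have "lead_coeff p' = 1" "poly p' x = 0" "degree p' = degree p"
    using p unfolding p'_def P_def by auto
  ultimately have "is_min_poly F x p'"
    using min unfolding is_min_poly_iff[OF F] P_def by auto
  then show thesis ..
qed

lemma min_poly_dvd: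
  assumes F: "is_subfield F" and m: "is_min_poly F x m" and f: "f \<in> polys_over F" "poly f x = 0"
  obtains h where "h \<in> polys_over F" "f = h * m"
proof -
  have m': "lead_coeff m = 1" "m \<in> polys_over F" "poly m x = 0"
    "\<And>q. q \<noteq> 0 \<Longrightarrow> q \<in> polys_over F \<Longrightarrow> poly q x = 0 \<Longrightarrow> degree m \<le> degree q"
    using m unfolding is_min_poly_iff[OF F] by auto
  obtain h r where hr: "h \<in> polys_over F" "r \<in> polys_over F" "f = h * m + r"
    "r = 0 \<or> degree r < degree m"
    using monic_division[OF is_subfield_imp_subring[OF F] m'(1,2) f(1)] by blast
  have "poly r x = 0"
    using f(2) m'(3) hr(3) by simp
  then have "r = 0"
    using m'(4)[of r] hr(2,4) by fastforce
  then show thesis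
    using that hr by simp
qed

text \<open>The minimal polynomial \<open>k\<close> of \<open>y\<close> divides \<open>m\<close>,
  and \<open>x\<close> is a root of \<open>k\<close> or of the cofactor. The cofactor has smaller
  degree than \<open>m\<close> and so cannot vanish at \<open>x\<close>; hence \<open>k\<close>
  does, its degree is that of \<open>m\<close>, and the cofactor is 1.\<close>

lemma min_poly_conjugate:
  assumes F: "is_subfield F" and m: "is_min_poly F x m" and y: "poly m y = 0"
  shows "is_min_poly F y m"
proof -
  have m': "lead_coeff m = 1" "m \<in> polys_over F" "poly m x = 0"
    "\<And>q. q \<noteq> 0 \<Longrightarrow> q \<in> polys_over F \<Longrightarrow> poly q x = 0 \<Longrightarrow> degree m \<le> degree q"
    using m unfolding is_min_poly_iff[OF F] by auto
  then have "algebraic_element F y"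
    using y unfolding algebraic_element_iff[OF F] by (metis leading_coeff_0_iff zero_neq_one)
  then obtain k where k: "is_min_poly F y k"
    using min_poly_exists[OF F] by blast
  have k': "lead_coeff k = 1" "k \<in> polys_over F"
    using k unfolding is_min_poly_iff[OF F] by auto
  obtain h where h: "h \<in> polys_over F" "m = h * k"
    using min_poly_dvd[OF F k m'(2) y] by blast
  have "h \<noteq> 0" "k \<noteq> 0"
    using h m'(1) by auto
  then have deg: "degree m = degree h + degree k"
    using h by (simp add: degree_mult_eq)
  have "lead_coeff h = 1"
    using h k' m'(1) by (simp add: lead_coeff_mult)
  have "poly h x = 0 \<or> poly k x = 0"
    using m'(3) h by simp
  moreover have "poly h x \<noteq> 0"
    using m'(4)[of h] \<open>h \<noteq> 0\<close> h deg is_min_poly_degree_pos[OF F k] by auto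
  ultimately have "degree h = 0"
    using m'(4)[of k] \<open>k \<noteq> 0\<close> k' deg by auto
  then have "h = 1"
    using \<open>lead_coeff h = 1\<close> monic_degree_zero by blast
  then show ?thesis
    using h k by simp
qed

lemma min_poly_unique:
  assumes F: "is_subfield F" and f: "is_min_poly F x f" and g: "is_min_poly F x g"
  shows "f = g"
proof -
  have f': "lead_coeff f = 1" "f \<in> polys_over F" "poly f x = 0"
    and g': "lead_coeff g = 1" "g \<in> polys_over F" "poly g x = 0"
    using f g unfolding is_min_poly_iff[OF F] by auto
  obtain h where h: "h \<in> polys_over F" "f = h * g"
    using min_poly_dvd[OF F g f'(2,3)] by blast
  have "degree f = degree g"
    using f g unfolding is_min_poly_def by (metis le_antisym leading_coeff_0_iff zero_neq_one)
  moreover have "h \<noteq> 0" "g \<noteq> 0"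
    using h f' by auto
  then have "degree f = degree h + degree g"
    unfolding h(2) by (rule degree_mult_eq)
  moreover have "lead_coeff f = lead_coeff h * lead_coeff g"
    unfolding h(2) by (rule lead_coeff_mult)
  ultimately have "degree h = 0" "lead_coeff h = 1"
    using f'(1) g'(1) by auto
  then have "h = 1"
    using monic_degree_zero by blast
  then show ?thesis
    using h by simp
qed

section \<open>Simple roots and separable elements\<close>

lemma rsquarefree_iff_pderiv:
  fixes p :: "'a::field poly"
  assumes "p \<noteq> 0"
  shows "rsquarefree p \<longleftrightarrow> (\<forall>a. poly p a = 0 \<longrightarrow> poly (pderiv p) a \<noteq> 0)"
proof -
  have "order a p = 0 \<or> order a p = 1 \<longleftrightarrow> (poly p a = 0 \<longrightarrow> poly (pderiv p) a \<noteq> 0)" for a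
  proof (cases "poly p a = 0")
    case True
    then obtain h where h: "p = [:- a, 1:] * h"
      using poly_eq_0_iff_dvd by blast
    then have "h \<noteq> 0"
      using assms by auto
    have "poly (pderiv p) a = poly h a"
      unfolding h pderiv_mult by (simp add: pderiv_pCons)
    moreover have "order a p = Suc (order a h)"
      using assms h order_mult[of "[:- a, 1:]" h a] order_power_n_n[of a 1] by simp
    ultimately show ?thesis
      using \<open>h \<noteq> 0\<close> True by (simp add: order_root)
  next
    case False
    then show ?thesis
      using order_root by auto
  qed
  then show ?thesis
    using assms unfolding rsquarefree_def by auto
qed

lemma rsquarefree_factor:
  fixes f g :: "'a::field poly"
  assumes "rsquarefree (f * g)"
  shows "rsquarefree g"
proof -
  have nz: "f * g \<noteq> 0" "g \<noteq> 0"
    using assms unfolding rsquarefree_def by auto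
  show ?thesis
    unfolding rsquarefree_iff_pderiv[OF nz(2)]
  proof (intro allI impI)
    fix a assume a: "poly g a = 0"
    then have "poly (pderiv (f * g)) a \<noteq> 0"
      using assms unfolding rsquarefree_iff_pderiv[OF nz(1)] by simp
    then show "poly (pderiv g) a \<noteq> 0"
      using a by (auto simp: pderiv_mult)
  qed
qed

text \<open>A simple root of \<open>f\<close> is a simple root of the minimal polynomial
  \<open>m\<close>, which divides \<open>f\<close>; thus \<open>pderiv m\<close> is not zero. Having
  smaller degree than \<open>m\<close>, it cannot vanish at any root of \<open>m\<close>, since
  \<open>m\<close> is the minimal polynomial of each of them.\<close>

lemma separable_element_iff:
  assumes F: "is_subfield F"
  shows "separable_element F x \<longleftrightarrow> (\<exists>f\<in>polys_over F. poly f x = 0 \<and> poly (pderiv f) x \<noteq> 0)"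
proof
  assume "separable_element F x"
  then obtain m where m: "is_min_poly F x m" "rsquarefree m"
    unfolding separable_element_def by blast
  then show "\<exists>f\<in>polys_over F. poly f x = 0 \<and> poly (pderiv f) x \<noteq> 0"
    using rsquarefree_iff_pderiv unfolding is_min_poly_iff[OF F] rsquarefree_def by metis
next
  assume "\<exists>f\<in>polys_over F. poly f x = 0 \<and> poly (pderiv f) x \<noteq> 0"
  then obtain f where f: "f \<in> polys_over F" "poly f x = 0" "poly (pderiv f) x \<noteq> 0"
    by blast
  then have "f \<noteq> 0"
    by auto
  then obtain m where m: "is_min_poly F x m"
    using f algebraic_element_iff[OF F] min_poly_exists[OF F] by blast
  then obtain h where h: "h \<in> polys_over F" "f = h * m"
    using min_poly_dvd[OF F m f(1,2)] by blast
  have mx: "poly m x = 0" "m \<in> polys_over F" "m \<noteq> 0"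
    using m unfolding is_min_poly_iff[OF F] by auto
  have "poly (pderiv m) x \<noteq> 0"
    using f(3) mx unfolding h(2) pderiv_mult by auto
  then have "pderiv m \<noteq> 0"
    by auto
  have "poly (pderiv m) a \<noteq> 0" if "poly m a = 0" for a
  proof
    assume "poly (pderiv m) a = 0"
    moreover have "pderiv m \<in> polys_over F"
      using mx is_subfield_imp_subring[OF F] pderiv_in_polys_over by blast
    ultimately have "degree m \<le> degree (pderiv m)"
      using min_poly_conjugate[OF F m that] \<open>pderiv m \<noteq> 0\<close> unfolding is_min_poly_iff[OF F] by blast
    moreover have "degree (pderiv m) < degree m"
      proof -
      have "degree (pderiv m) \<le> degree m - 1"
        by (rule degree_le) (auto simp: coeff_pderiv coeff_eq_0)
      then show ?thesis
        using is_min_poly_degree_pos[OF F m] by linarith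
    qed
    ultimately show False
      by simp
  qed
  then have "rsquarefree m"
    using rsquarefree_iff_pderiv mx by blast
  then show "separable_element F x"
    using m unfolding separable_element_def by blast
qed

lemma separable_min_poly_rsquarefree:
  assumes "is_subfield F" "separable_element F x" "is_min_poly F x m"
  shows "rsquarefree m"
  using assms min_poly_unique unfolding separable_element_def by blast

lemma separable_imp_algebraic: "separable_element F x \<Longrightarrow> algebraic_element F x"
  unfolding separable_element_def algebraic_element_def is_min_poly_def rsquarefree_def by blast

lemma separable_element_mono:
  assumes "is_subfield F" "is_subfield L" "F \<subseteq> L" "separable_element F x"
  shows "separable_element L x"
  using assms polys_over_mono separable_element_iff by metis

lemma separable_element_self:
  assumes "is_subfield F" "x \<in> F"
  shows "separable_element F x"
  unfolding separable_element_iff[OF assms(1)]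
  using assms by (intro bexI[of _ "[:- x, 1:]"] linear_in_polys_over is_subfield_imp_subring)
    (auto simp: pderiv_pCons)

subsection \<open>Finite extensions are algebraic\<close>

lemma det_in_subring:
  fixes S :: "'a::idom set"
  assumes S: "is_subring S" and A: "A \<in> carrier_mat n n"
    and elts: "\<And>i j. i < n \<Longrightarrow> j < n \<Longrightarrow> A $$ (i, j) \<in> S"
  shows "det A \<in> S"
proof -
  have sign: "signof p \<in> S" for p :: "nat \<Rightarrow> nat"
    using subring_1[OF S] subring_uminus[OF S subring_1[OF S]] by (auto simp: sign_def)
  show ?thesis
    unfolding det_def'[OF A]
    by (intro subring_sum[OF S] subring_mult[OF S] subring_prod[OF S] sign elts)
      (use permutes_in_image in fastforce)+
qed

text \<open>The characteristic polynomial of the matrix is monic with coefficients in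
  \<open>F\<close> and vanishes at the eigenvalue \<open>x\<close>.\<close>

lemma eigenvalue_algebraic:
  fixes v :: "nat \<Rightarrow> 'a::field"
  assumes F: "is_subfield F" and v: "\<exists>i<n. v i \<noteq> 0"
    and M: "\<And>i j. i < n \<Longrightarrow> j < n \<Longrightarrow> M i j \<in> F"
    and eq: "\<And>i. i < n \<Longrightarrow> (\<Sum>j<n. M i j * v j) = x * v i"
  shows "algebraic_element F x"
proof -
  define A where "A = mat n n (\<lambda>(i, j). M i j)"
  have A: "A \<in> carrier_mat n n"
    unfolding A_def by simp
  note R = subring_polys_over[OF is_subfield_imp_subring[OF F]]
  have "char_poly A \<in> polys_over F"
    unfolding char_poly_def
  proof (rule det_in_subring[OF R])
    show "char_poly_matrix A \<in> carrier_mat n n"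
      using A by simp
    show "char_poly_matrix A $$ (i, j) \<in> polys_over F" if "i < n" "j < n" for i j
    proof -
      have "char_poly_matrix A $$ (i, j) = (if i = j then [:0, 1:] else 0) + [:- M i j:]"
        using that unfolding char_poly_matrix_def A_def by auto
      moreover have "[:0, 1:] \<in> polys_over F" "[:- M i j:] \<in> polys_over F"
        using M[OF that] F is_subfield_imp_subring[OF F]
        by (auto intro!: pCons_in_polys_over simp: is_subfield_def subring_0[OF R])
      ultimately show ?thesis
        using subring_add[OF R] subring_0[OF R] by auto
    qed
  qed
  moreover have "char_poly A \<noteq> 0"
    using degree_monic_char_poly[OF A] by auto
  moreover have "eigenvector A (vec n v) x"
  proof -
    have "vec n v \<noteq> 0\<^sub>v n"
      using v by (metis index_vec index_zero_vec(1))
    moreover have "A *\<^sub>v vec n v = x \<cdot>\<^sub>v vec n v"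
      using eq unfolding A_def by (intro eq_vecI) (auto simp: scalar_prod_def lessThan_atLeast0)
    ultimately show ?thesis
      unfolding eigenvector_def A_def by simp
  qed
  then have "poly (char_poly A) x = 0"
    using eigenvalue_root_char_poly[OF A] unfolding eigenvalue_def by blast
  ultimately show ?thesis
    unfolding algebraic_element_iff[OF F] by blast
qed

definition linear_span :: "'a::field set \<Rightarrow> 'a set \<Rightarrow> 'a set" where
  "linear_span F B = {\<Sum>b\<in>B. c b * b | c. \<forall>b\<in>B. c b \<in> F}"

lemma linear_span_add:
  assumes "is_subring F" "x \<in> linear_span F B" "y \<in> linear_span F B"
  shows "x + y \<in> linear_span F B"
proof -
  obtain c d where "x = (\<Sum>b\<in>B. c b * b)" "y = (\<Sum>b\<in>B. d b * b)" "\<forall>b\<in>B. c b \<in> F" "\<forall>b\<in>B. d b \<in> F"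
    using assms unfolding linear_span_def by blast
  then show ?thesis
    unfolding linear_span_def using subring_add[OF assms(1)]
    by (intro CollectI exI[of _ "\<lambda>b. c b + d b"]) (auto simp: sum.distrib algebra_simps)
qed

lemma linear_span_scale:
  assumes "is_subring F" "a \<in> F" "x \<in> linear_span F B"
  shows "a * x \<in> linear_span F B"
proof -
  obtain c where "x = (\<Sum>b\<in>B. c b * b)" "\<forall>b\<in>B. c b \<in> F"
    using assms unfolding linear_span_def by blast
  then show ?thesis
    unfolding linear_span_def using subring_mult[OF assms(1)] assms(2)
    by (intro CollectI exI[of _ "\<lambda>b. a * c b"]) (auto simp: sum_distrib_left algebra_simps)
qed

lemma linear_span_base:
  assumes "is_subring F" "finite B" "b \<in> B"
  shows "b \<in> linear_span F B"
  unfolding linear_span_def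
  using assms subring_0[OF assms(1)] subring_1[OF assms(1)]
  by (intro CollectI exI[of _ "\<lambda>b'. if b' = b then 1 else 0"])
    (auto simp: sum.delta if_distrib[of "\<lambda>u. u * _"] cong: if_cong)

lemma linear_span_sum:
  assumes "is_subring F" "\<And>i. i \<in> I \<Longrightarrow> f i \<in> linear_span F B"
  shows "sum f I \<in> linear_span F B"
proof -
  have "0 \<in> linear_span F B"
    unfolding linear_span_def using subring_0[OF assms(1)]
    by (intro CollectI exI[of _ "\<lambda>_. 0"]) auto
  then show ?thesis
    using assms(2)
    by (induction I rule: infinite_finite_induct) (auto intro: linear_span_add[OF assms(1)])
qed

text \<open>Only a ring is asked for, because \<open>adjoin\<close> produces polynomial expressions;
  that \<open>A\<close> is a field is then a consequence,
  \<open>finite_over_subfield\<close>.\<close>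

definition finite_over :: "'a::field set \<Rightarrow> 'a set \<Rightarrow> bool" where
  "finite_over F A \<longleftrightarrow> is_subring A \<and> F \<subseteq> A \<and> (\<exists>B. finite B \<and> B \<subseteq> A \<and> A \<subseteq> linear_span F B)"

text \<open>Multiplication by \<open>x\<close> sends each element of \<open>B\<close> into the span
  of \<open>B\<close>, so the vector formed by \<open>B\<close> is an eigenvector for
  \<open>x\<close> of a matrix over \<open>F\<close>. It is nonzero because 1 lies in the
  span.\<close>

lemma finite_over_algebraic:
  assumes F: "is_subfield F" and A: "finite_over F A" and x: "x \<in> A"
  shows "algebraic_element F x"
proof -
  obtain B where B: "finite B" "B \<subseteq> A" "A \<subseteq> linear_span F B" and R: "is_subring A"
    using A unfolding finite_over_def by blast
  obtain v where v: "bij_betw v {..<card B} B"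
    using ex_bij_betw_nat_finite[OF B(1)] by (auto simp: lessThan_atLeast0)
  have "\<exists>i<card B. v i \<noteq> 0"
  proof (rule ccontr)
    assume "\<not> ?thesis"
    then have "\<forall>b\<in>B. b = 0"
      using v unfolding bij_betw_def by auto
    moreover obtain c where "1 = (\<Sum>b\<in>B. c b * b)"
      using B(3) subring_1[OF R] unfolding linear_span_def by blast
    moreover have "(\<Sum>b\<in>B. c b * b) = 0"
      using calculation(1) by (intro sum.neutral) auto
    ultimately show False
      by simp
  qed
  moreover have "\<forall>i<card B. \<exists>c. (\<forall>j<card B. c j \<in> F) \<and> (\<Sum>j<card B. c j * v j) = x * v i"
  proof (intro allI impI)
    fix i assume "i < card B"
    then have "v i \<in> A"
      using v B(2) unfolding bij_betw_def by auto
    then have "x * v i \<in> linear_span F B"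
      using B(3) subring_mult[OF R x] by blast
    then obtain c where c: "\<forall>b\<in>B. c b \<in> F" "x * v i = (\<Sum>b\<in>B. c b * b)"
      unfolding linear_span_def by blast
    have "(\<Sum>b\<in>B. c b * b) = (\<Sum>j<card B. c (v j) * v j)"
      using sum.reindex_bij_betw[OF v, of "\<lambda>b. c b * b"] by simp
    then show "\<exists>c. (\<forall>j<card B. c j \<in> F) \<and> (\<Sum>j<card B. c j * v j) = x * v i"
      using c v unfolding bij_betw_def by (intro exI[of _ "\<lambda>j. c (v j)"]) auto
  qed
  then obtain M where "\<forall>i<card B. (\<forall>j<card B. M i j \<in> F) \<and> (\<Sum>j<card B. M i j * v j) = x * v i"
    by metis
  ultimately show ?thesis
    by (intro eigenvalue_algebraic[OF F, of "card B" v M]) auto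
qed

text \<open>Write the minimal polynomial of \<open>y\<close> as \<open>a + X h\<close>. By
  minimality \<open>h\<close> does not vanish at \<open>y\<close>, so \<open>a\<close> is nonzero
  and \<open>- h(y) / a\<close> is the inverse of \<open>y\<close>.\<close>

lemma finite_over_subfield:
  assumes F: "is_subfield F" and A: "finite_over F A"
  shows "is_subfield A"
proof -
  have R: "is_subring A" and FA: "F \<subseteq> A"
    using A unfolding finite_over_def by auto
  have "inverse y \<in> A" if y: "y \<in> A" for y
  proof (cases "y = 0")
    case False
    obtain m where m: "is_min_poly F y m"
      using min_poly_exists[OF F finite_over_algebraic[OF F A y]] by blast
    obtain a h where mh: "m = pCons a h"
      by (cases m)
    have m': "m \<noteq> 0" "m \<in> polys_over F" "poly m y = 0"
      "\<And>q. q \<noteq> 0 \<Longrightarrow> q \<in> polys_over F \<Longrightarrow> poly q y = 0 \<Longrightarrow> degree m \<le> degree q"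
      using m unfolding is_min_poly_iff[OF F] by auto
    have ah: "a \<in> F" "h \<in> polys_over F"
    proof -
      have "coeff m 0 \<in> F" "\<forall>i. coeff m (Suc i) \<in> F"
        using m'(2) unfolding polys_over_def by auto
      then show "a \<in> F" "h \<in> polys_over F"
        unfolding mh polys_over_def by auto
    qed
    have hy: "a + y * poly h y = 0"
      using m'(3) mh by simp
    have "h \<noteq> 0"
      using is_min_poly_degree_pos[OF F m] mh by auto
    then have "degree m = Suc (degree h)"
      unfolding mh by simp
    then have "poly h y \<noteq> 0"
      using m'(4)[OF \<open>h \<noteq> 0\<close> ah(2)] by auto
    then have "a \<noteq> 0"
      using hy False by auto
    then have "inverse y = - poly h y * inverse a"
      using hy False by (simp add: field_simps eq_neg_iff_add_eq_0 add.commute)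
    moreover have "poly h y \<in> A" "inverse a \<in> A"
      using poly_in_subring[OF R polys_over_mono[OF FA ah(2)] y] ah(1) F FA
      by (auto simp: is_subfield_def)
    ultimately show ?thesis
      using subring_mult[OF R] subring_uminus[OF R] by metis
  qed (use subring_0[OF R] in simp)
  then show ?thesis
    using R unfolding is_subfield_def is_subring_def by auto
qed

text \<open>The ring \<open>L[s]\<close> of polynomial expressions; for algebraic \<open>s\<close>
  it is the field \<open>L(s)\<close>, see \<open>subfield_adjoin\<close>.\<close>

definition adjoin :: "'a::field set \<Rightarrow> 'a \<Rightarrow> 'a set" where
  "adjoin L s = (\<lambda>g. poly g s) ` polys_over L"

lemma subset_adjoin: "is_subring L \<Longrightarrow> L \<subseteq> adjoin L s"
  unfolding adjoin_def using const_in_polys_over by (force intro!: image_eqI[where x = "[:_:]"])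

lemma in_adjoin: "is_subring L \<Longrightarrow> s \<in> adjoin L s"
  unfolding adjoin_def
  by (intro image_eqI[where x = "[:0, 1:]"] pCons_in_polys_over const_in_polys_over subring_0 subring_1)
    auto

lemma subring_adjoin:
  assumes "is_subring L"
  shows "is_subring (adjoin L s)"
proof -
  note R = subring_polys_over[OF assms]
  have mem: "y \<in> adjoin L s" if "g \<in> polys_over L" "poly g s = y" for g y
    using that unfolding adjoin_def by blast
  show ?thesis
    unfolding is_subring_def
  proof (intro conjI ballI)
    show "0 \<in> adjoin L s" "1 \<in> adjoin L s"
      using mem[OF subring_0[OF R]] mem[OF subring_1[OF R]] by auto
    fix x assume "x \<in> adjoin L s"
    then obtain f where f: "f \<in> polys_over L" "x = poly f s"
      unfolding adjoin_def by blast
    show "- x \<in> adjoin L s"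
      using mem[OF subring_uminus[OF R f(1)]] f(2) by simp
    fix y assume "y \<in> adjoin L s"
    then obtain g where g: "g \<in> polys_over L" "y = poly g s"
      unfolding adjoin_def by blast
    show "x + y \<in> adjoin L s" "x * y \<in> adjoin L s"
      using mem[OF subring_add[OF R f(1) g(1)]] mem[OF subring_mult[OF R f(1) g(1)]] f(2) g(2) by auto
  qed
qed

lemma adjoin_mono: "L \<subseteq> M \<Longrightarrow> adjoin L s \<subseteq> adjoin M s"
  unfolding adjoin_def using polys_over_mono by blast

lemma finite_over_refl:
  assumes "is_subfield F"
  shows "finite_over F F"
proof -
  have "x \<in> linear_span F {1}" if "x \<in> F" for x
    unfolding linear_span_def using that by (intro CollectI exI[of _ "\<lambda>_. x"]) auto
  then show ?thesis
    unfolding finite_over_def using is_subfield_imp_subring[OF assms] subring_1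
    by (intro conjI exI[of _ "{1}"]) auto
qed

lemma finite_over_adjoin:
  assumes F: "is_subfield F" and L: "finite_over F L" and s: "algebraic_element L s"
  shows "finite_over F (adjoin L s)"
proof -
  have Lf: "is_subfield L"
    using finite_over_subfield[OF F L] .
  note RL = is_subfield_imp_subring[OF Lf] and RF = is_subfield_imp_subring[OF F]
  obtain B where B: "finite B" "B \<subseteq> L" "L \<subseteq> linear_span F B" and FL: "F \<subseteq> L"
    using L unfolding finite_over_def by blast
  obtain m where m: "is_min_poly L s m"
    using min_poly_exists[OF Lf s] by blast
  have m': "lead_coeff m = 1" "m \<in> polys_over L" "poly m s = 0"
    using m unfolding is_min_poly_iff[OF Lf] by auto
  \<comment> \<open>Reduction modulo the minimal polynomial of \<open>s\<close> leaves powers of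
    \<open>s\<close> below its degree; their products with a spanning set of \<open>L\<close> over
    \<open>F\<close> span \<open>L[s]\<close>.\<close>
  define C where "C = (\<lambda>(b, j). b * s ^ j) ` (B \<times> {..<degree m})"
  have C: "finite C"
    unfolding C_def using B(1) by simp
  have "C \<subseteq> adjoin L s"
    using B(2) subset_adjoin[OF RL] in_adjoin[OF RL] subring_adjoin[OF RL, of s]
    unfolding C_def by (auto intro!: subring_mult subring_power)
  moreover have "adjoin L s \<subseteq> linear_span F C"
  proof
    fix y assume "y \<in> adjoin L s"
    then obtain g where g: "g \<in> polys_over L" "y = poly g s"
      unfolding adjoin_def by blast
    obtain h r where hr: "h \<in> polys_over L" "r \<in> polys_over L" "g = h * m + r"
      "r = 0 \<or> degree r < degree m"
      using monic_division[OF RL m'(1,2) g(1)] by blast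
    have "y = poly r s"
      using g hr m'(3) by simp
    also have "\<dots> = (\<Sum>j<degree m. coeff r j * s ^ j)"
      unfolding poly_altdef using hr(4)
      by (intro sum.mono_neutral_cong) (auto simp: coeff_eq_0)
    also have "\<dots> \<in> linear_span F C"
    proof (rule linear_span_sum[OF RF])
      fix j assume j: "j \<in> {..<degree m}"
      have "coeff r j \<in> linear_span F B"
        using hr(2) B(3) unfolding polys_over_def by auto
      then obtain c where c: "coeff r j = (\<Sum>b\<in>B. c b * b)" "\<forall>b\<in>B. c b \<in> F"
        unfolding linear_span_def by blast
      have "coeff r j * s ^ j = (\<Sum>b\<in>B. c b * (b * s ^ j))"
        unfolding c(1) sum_distrib_right by (simp add: mult.assoc)
      moreover have "b * s ^ j \<in> linear_span F C" if "b \<in> B" for b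
        using that j C by (intro linear_span_base[OF RF]) (auto simp: C_def)
      ultimately show "coeff r j * s ^ j \<in> linear_span F C"
        using c(2) by (simp add: linear_span_sum[OF RF] linear_span_scale[OF RF])
    qed
    finally show "y \<in> linear_span F C" .
  qed
  ultimately show ?thesis
    unfolding finite_over_def using subring_adjoin[OF RL] subset_adjoin[OF RL, of s] FL C by blast
qed

lemma subfield_adjoin:
  assumes "is_subfield L" "algebraic_element L s"
  shows "is_subfield (adjoin L s)"
  using finite_over_subfield[OF assms(1) finite_over_adjoin[OF assms(1) finite_over_refl[OF assms(1)] assms(2)]] .

subsection \<open>Derivations and separability\<close>

text \<open>Only the arguments are confined to \<open>L\<close>; the values may lie anywhere in the
  ambient field, so extending \<open>D\<close> never requires a check where its values land.\<close>

definition is_derivation :: "'a::field set \<Rightarrow> ('a \<Rightarrow> 'a) \<Rightarrow> bool" where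
  "is_derivation L D \<longleftrightarrow> (\<forall>x\<in>L. \<forall>y\<in>L. D (x + y) = D x + D y \<and> D (x * y) = x * D y + y * D x)"

context
  fixes L :: "'a::field set" and D :: "'a \<Rightarrow> 'a"
  assumes L: "is_subring L" and D: "is_derivation L D"
begin

lemma derivation_add: "x \<in> L \<Longrightarrow> y \<in> L \<Longrightarrow> D (x + y) = D x + D y"
  and derivation_mult: "x \<in> L \<Longrightarrow> y \<in> L \<Longrightarrow> D (x * y) = x * D y + y * D x"
  using D unfolding is_derivation_def by auto

lemma derivation_0: "D 0 = 0"
  using derivation_add[of 0 0] subring_0[OF L] by (metis add.right_neutral add_left_cancel)

lemma derivation_1: "D 1 = 0"
  using derivation_mult[of 1 1] subring_1[OF L] by (metis add.right_neutral add_left_cancel mult_1)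

lemma derivation_sum: "(\<And>i. i \<in> I \<Longrightarrow> f i \<in> L) \<Longrightarrow> D (sum f I) = (\<Sum>i\<in>I. D (f i))"
  by (induction I rule: infinite_finite_induct)
    (auto simp: derivation_0 derivation_add subring_sum[OF L])

lemma map_poly_derivation_add:
  assumes "f \<in> polys_over L" "g \<in> polys_over L"
  shows "map_poly D (f + g) = map_poly D f + map_poly D g"
  using assms unfolding polys_over_def
  by (intro poly_eqI) (simp add: coeff_map_poly derivation_0 derivation_add)

lemma map_poly_derivation_mult:
  assumes "f \<in> polys_over L" "g \<in> polys_over L"
  shows "map_poly D (f * g) = f * map_poly D g + g * map_poly D f"
proof (rule poly_eqI)
  fix n
  have fg: "coeff f i \<in> L" "coeff g i \<in> L" for i
    using assms unfolding polys_over_def by auto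
  have "coeff (map_poly D (f * g)) n = (\<Sum>i\<le>n. D (coeff f i * coeff g (n - i)))"
    by (simp add: coeff_map_poly derivation_0 coeff_mult derivation_sum subring_mult[OF L] fg)
  also have "\<dots> = (\<Sum>i\<le>n. coeff f i * D (coeff g (n - i))) + (\<Sum>i\<le>n. D (coeff f i) * coeff g (n - i))"
    by (simp add: derivation_mult fg sum.distrib mult.commute)
  also have "\<dots> = coeff (f * map_poly D g + map_poly D f * g) n"
    by (simp add: coeff_mult coeff_map_poly derivation_0)
  finally show "coeff (map_poly D (f * g)) n = coeff (f * map_poly D g + g * map_poly D f) n"
    by (simp add: mult.commute)
qed

text \<open>An extension with \<open>D' s = e\<close> has to send \<open>g(s)\<close> to
  \<open>d g\<close>, the sum of the value at \<open>s\<close> of \<open>g\<close> with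
  \<open>D\<close> applied to its coefficients and of \<open>g'(s) e\<close>. The condition on
  \<open>e\<close> says that \<open>d m = 0\<close>; by the product rule \<open>d\<close> then kills
  all multiples of \<open>m\<close>, so the chosen representative \<open>g\<close> does not
  matter.\<close>

lemma derivation_extend:
  assumes Lf: "is_subfield L" and m: "is_min_poly L s m"
    and e: "poly (map_poly D m) s + poly (pderiv m) s * e = 0"
  obtains D' where "is_derivation (adjoin L s) D'" "\<And>x. x \<in> L \<Longrightarrow> D' x = D x" "D' s = e"
proof -
  define d where "d = (\<lambda>g. poly (map_poly D g) s + poly (pderiv g) s * e)"
  have d_add: "d (f + g) = d f + d g" if "f \<in> polys_over L" "g \<in> polys_over L" for f g
    unfolding d_def by (simp add: map_poly_derivation_add[OF that] pderiv_add algebra_simps)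
  have d_mult: "d (f * g) = poly f s * d g + poly g s * d f"
    if "f \<in> polys_over L" "g \<in> polys_over L" for f g
    unfolding d_def by (simp add: map_poly_derivation_mult[OF that] pderiv_mult algebra_simps)
  have m': "m \<in> polys_over L" "poly m s = 0"
    using m unfolding is_min_poly_iff[OF Lf] by auto
  note R = subring_polys_over[OF L]
  have d_zero: "d g = 0" if g: "g \<in> polys_over L" "poly g s = 0" for g
  proof -
    obtain h where h: "h \<in> polys_over L" "g = h * m"
      using min_poly_dvd[OF Lf m g] by blast
    then show ?thesis
      using d_mult[OF h(1) m'(1)] e m'(2) unfolding d_def by simp
  qed
  have d_eq: "d f = d g" if "f \<in> polys_over L" "g \<in> polys_over L" "poly f s = poly g s" for f g
  proof -
    have "f - g \<in> polys_over L"
      using that subring_diff[OF R] by blast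
    then have "d f = d (f - g) + d g"
      using d_add[of "f - g" g] that by simp
    then show ?thesis
      using d_zero[OF \<open>f - g \<in> polys_over L\<close>] that by simp
  qed
  define D' where "D' = (\<lambda>y. d (SOME g. g \<in> polys_over L \<and> poly g s = y))"
  have D': "D' (poly g s) = d g" if "g \<in> polys_over L" for g
  proof -
    have "\<exists>h. h \<in> polys_over L \<and> poly h s = poly g s"
      using that by blast
    from someI_ex[OF this] show ?thesis
      unfolding D'_def using d_eq that by blast
  qed
  have "is_derivation (adjoin L s) D'"
  proof -
    have "D' (poly f s + poly g s) = D' (poly f s) + D' (poly g s)"
      "D' (poly f s * poly g s) = poly f s * D' (poly g s) + poly g s * D' (poly f s)"
      if "f \<in> polys_over L" "g \<in> polys_over L" for f g
      using D'[OF subring_add[OF R that]] D'[OF subring_mult[OF R that]] D' that d_add d_mult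
      by auto
    then show ?thesis
      unfolding is_derivation_def adjoin_def by auto
  qed
  moreover have "D' x = D x" if "x \<in> L" for x
  proof -
    have "map_poly D [:x:] = [:D x:]"
      by (intro poly_eqI) (simp add: coeff_map_poly derivation_0 coeff_pCons split: nat.split)
    then show ?thesis
      using D'[OF const_in_polys_over[OF L that]] by (simp add: d_def pderiv_pCons)
  qed
  moreover have "D' s = e"
  proof -
    have "[:0, 1:] \<in> polys_over L"
      using pCons_in_polys_over[OF L subring_0[OF L] const_in_polys_over[OF L subring_1[OF L]]] .
    moreover have "map_poly D [:0, 1:] = 0"
      by (intro poly_eqI)
        (simp add: coeff_map_poly derivation_0 derivation_1 coeff_pCons split: nat.split)
    ultimately show ?thesis
      using D'[of "[:0, 1:]"] by (simp add: d_def pderiv_pCons)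
  qed
  ultimately show thesis
    using that by blast
qed

lemma derivation_poly:
  assumes "K \<subseteq> L" "\<And>x. x \<in> K \<Longrightarrow> D x = 0" "f \<in> polys_over K" "s \<in> L"
  shows "D (poly f s) = poly (pderiv f) s * D s"
proof -
  have "poly f s \<in> L \<and> D (poly f s) = poly (pderiv f) s * D s"
    using assms(3)
  proof (induction f)
    case 0
    then show ?case
      by (simp add: derivation_0 subring_0[OF L])
  next
    case (pCons a f)
    have af: "a \<in> K" "f \<in> polys_over K"
    proof -
      have *: "coeff (pCons a f) i \<in> K" for i
        using pCons.prems unfolding polys_over_def by blast
      show "a \<in> K" "f \<in> polys_over K"
        using *[of 0] *[of "Suc _"] unfolding polys_over_def by auto
    qed
    have f: "poly f s \<in> L" "D (poly f s) = poly (pderiv f) s * D s"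
      using pCons.IH[OF af(2)] by auto
    have a: "a \<in> L" "D a = 0"
      using af(1) assms(1,2) by auto
    show ?case
      using a f assms(4) subring_add[OF L] subring_mult[OF L]
      by (simp add: derivation_add derivation_mult pderiv_pCons algebra_simps)
  qed
  then show ?thesis ..
qed

end

text \<open>Every element of such a tower turns out to be separable over \<open>F\<close>, and
  finitely many separable elements lie in a common tower. Closure of separability under field
  operations and its transitivity both follow from these two facts.\<close>

inductive separable_tower :: "'a::alg_closed_field set \<Rightarrow> 'a set \<Rightarrow> bool" for F where
  base: "separable_tower F F"
| step: "separable_tower F L \<Longrightarrow> separable_element L s \<Longrightarrow> separable_tower F (adjoin L s)"

lemma separable_tower_finite:
  assumes "separable_tower F L" "is_subfield F"
  shows "finite_over F L"
  using assms
  by (induction) (auto intro: finite_over_refl finite_over_adjoin separable_imp_algebraic)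

lemma separable_tower_subfield:
  assumes "separable_tower F L" "is_subfield F"
  shows "is_subfield L" "F \<subseteq> L"
  using separable_tower_finite[OF assms] finite_over_subfield[OF assms(2)]
  unfolding finite_over_def by auto

text \<open>If the minimal polynomial of \<open>x\<close> over \<open>F\<close> has zero derivative, then \<open>F(x)\<close> has a derivation over
  \<open>F\<close> that does not kill \<open>x\<close>; it extends along separable elements but vanishes on them.\<close>

lemma separable_tower_separable:
  assumes tower: "separable_tower F L" and F: "is_subfield F" and x: "x \<in> L"
  shows "separable_element F x"
proof (rule ccontr)
  assume insep: "\<not> separable_element F x"
  note RF = is_subfield_imp_subring[OF F]
  have algx: "algebraic_element F x"
    using finite_over_algebraic[OF F separable_tower_finite[OF tower F] x] .
  then obtain m where m: "is_min_poly F x m"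
    using min_poly_exists[OF F] by blast
  then have "poly (pderiv m) x = 0"
    using insep unfolding separable_element_iff[OF F] is_min_poly_iff[OF F] by blast
  moreover have D0: "is_derivation F (\<lambda>_. 0)"
    unfolding is_derivation_def by simp
  moreover have "map_poly (\<lambda>_. 0) m = 0"
    by (intro poly_eqI) (simp add: coeff_map_poly)
  \<comment> \<open>Both \<open>m\<close> with the zero derivation applied to its coefficients and
    \<open>pderiv m\<close> at \<open>x\<close> are zero, so every value of \<open>D x\<close> is
    admissible; 1 is chosen.\<close>
  ultimately obtain D where D: "is_derivation (adjoin F x) D" "\<And>y. y \<in> F \<Longrightarrow> D y = 0" "D x = 1"
    using derivation_extend[OF RF D0 F m, of 1] by (metis add_0 mult_zero_left poly_0)
  \<comment> \<open>The field \<open>M\<close> grows along with \<open>L\<close>, while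
    \<open>D\<close> stays zero on \<open>L\<close> and 1 at \<open>x\<close>. This is contradictory
    as soon as \<open>x\<close> belongs to \<open>L\<close>.\<close>
  have "\<exists>M D. is_subfield M \<and> L \<subseteq> M \<and> x \<in> M \<and> is_derivation M D \<and> D x = 1 \<and> (\<forall>y\<in>L. D y = 0)"
    using tower
  proof (induction)
    case base
    then show ?case
      using D subfield_adjoin[OF F algx] subset_adjoin[OF RF] in_adjoin[OF RF]
      by (intro exI[of _ "adjoin F x"] exI[of _ D]) auto
  next
    case (step L s)
    then obtain M D where M: "is_subfield M" "L \<subseteq> M" "x \<in> M" "is_derivation M D" "D x = 1"
      "\<forall>y\<in>L. D y = 0"
      by blast
    note RM = is_subfield_imp_subring[OF M(1)]
    have L: "is_subfield L"
      using separable_tower_subfield step.hyps F by blast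
    then have sM: "separable_element M s"
      using separable_element_mono M step.hyps by blast
    then obtain k where k: "is_min_poly M s k" "rsquarefree k"
      unfolding separable_element_def by blast
    then have "poly (pderiv k) s \<noteq> 0"
      using rsquarefree_iff_pderiv[of k] unfolding is_min_poly_def rsquarefree_def by auto
    then obtain D' where D': "is_derivation (adjoin M s) D'" "\<And>y. y \<in> M \<Longrightarrow> D' y = D y"
      using derivation_extend[OF RM M(4,1) k(1), of "- poly (map_poly D k) s / poly (pderiv k) s"]
      by auto
    note RMs = subring_adjoin[OF RM, of s]
    have D'L: "D' y = 0" if "y \<in> L" for y
      using D'(2) M that by auto
    have LMs: "L \<subseteq> adjoin M s"
      using M(2) subset_adjoin[OF RM] by blast
    obtain f where f: "f \<in> polys_over L" "poly f s = 0" "poly (pderiv f) s \<noteq> 0"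
      using step.hyps(2) unfolding separable_element_iff[OF L] by blast
    \<comment> \<open>The polynomial \<open>f\<close> has coefficients in \<open>L\<close>, where
      \<open>D'\<close> vanishes. Applying \<open>D'\<close> to \<open>f(s) = 0\<close> gives
      \<open>f'(s) D'(s) = 0\<close>, and \<open>f'(s)\<close> is nonzero.\<close>
    have "D' s = 0"
      using derivation_poly[OF RMs D'(1) LMs D'L f(1) in_adjoin[OF RM]] f
        derivation_0[OF RMs D'(1)] by auto
    then have "D' y = 0" if "y \<in> adjoin L s" for y
      using that derivation_poly[OF RMs D'(1) LMs D'L _ in_adjoin[OF RM]]
      unfolding adjoin_def[of L] by auto
    moreover have "x \<in> adjoin M s"
      using M(3) subset_adjoin[OF RM] by blast
    ultimately show ?case
      using subfield_adjoin[OF M(1) separable_imp_algebraic[OF sM]] adjoin_mono[OF M(2)] D' M(3,5)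
      by (intro exI[of _ "adjoin M s"] exI[of _ D']) auto
  qed
  then show False
    using x by force
qed

section \<open>The separable closure\<close>

lemma separable_tower_exists:
  assumes F: "is_subfield F" and "finite S" and "S \<subseteq> separable_closure F"
  shows "\<exists>L. separable_tower F L \<and> S \<subseteq> L"
  using assms(2,3)
proof (induction)
  case empty
  then show ?case
    using separable_tower.base by blast
next
  case (insert s S)
  then obtain L where L: "separable_tower F L" "S \<subseteq> L"
    by auto
  have Lf: "is_subfield L" "F \<subseteq> L"
    using separable_tower_subfield[OF L(1) F] by auto
  note RL = is_subfield_imp_subring[OF Lf(1)]
  have "separable_element L s"
    using separable_element_mono[OF F Lf] insert.prems unfolding separable_closure_def by auto
  then show ?case
    using separable_tower.step[OF L(1)] L(2) subset_adjoin[OF RL] in_adjoin[OF RL]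
    by (intro exI[of _ "adjoin L s"]) auto
qed

lemma subfield_separable_closure:
  assumes F: "is_subfield F"
  shows "is_subfield (separable_closure F)"
proof -
  have tower: "\<exists>L. is_subfield L \<and> L \<subseteq> separable_closure F \<and> x \<in> L \<and> y \<in> L"
    if xy: "x \<in> separable_closure F" "y \<in> separable_closure F" for x y
  proof -
    obtain L where "separable_tower F L" "{x, y} \<subseteq> L"
      using separable_tower_exists[OF F, of "{x, y}"] xy by auto
    then show ?thesis
      using separable_tower_subfield[OF _ F] separable_tower_separable[OF _ F]
      by (intro exI[of _ L]) (auto simp: separable_closure_def)
  qed
  have "F \<subseteq> separable_closure F"
    using separable_element_self[OF F] by (auto simp: separable_closure_def)
  moreover have "x + y \<in> separable_closure F \<and> x * y \<in> separable_closure F"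
    if "x \<in> separable_closure F" "y \<in> separable_closure F" for x y
    using tower[OF that] unfolding is_subfield_def by blast
  moreover have "- x \<in> separable_closure F \<and> inverse x \<in> separable_closure F"
    if "x \<in> separable_closure F" for x
    using tower[OF that that] unfolding is_subfield_def by blast
  ultimately show ?thesis
    using F unfolding is_subfield_def by blast
qed

lemma subset_separable_closure: "is_subfield F \<Longrightarrow> F \<subseteq> separable_closure F"
  using separable_element_self by (auto simp: separable_closure_def)

text \<open>The finitely many coefficients of a polynomial with simple root \<open>x\<close> lie in
  one tower, and adjoining \<open>x\<close> is one more step of that tower.\<close>

lemma separable_closure_idem:
  assumes F: "is_subfield F"
  shows "separable_closure (separable_closure F) = separable_closure F"
proof
  show "separable_closure (separable_closure F) \<subseteq> separable_closure F"
  proof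
    fix x assume "x \<in> separable_closure (separable_closure F)"
    then obtain f where f: "f \<in> polys_over (separable_closure F)" "poly f x = 0"
      "poly (pderiv f) x \<noteq> 0"
      using separable_element_iff[OF subfield_separable_closure[OF F]]
      unfolding separable_closure_def[of "separable_closure F"] by auto
    have "coeff f ` {..degree f} \<subseteq> separable_closure F"
      using f(1) unfolding polys_over_def by auto
    then obtain L where L: "separable_tower F L" "coeff f ` {..degree f} \<subseteq> L"
      using separable_tower_exists[OF F, of "coeff f ` {..degree f}"] by auto
    have Lf: "is_subfield L"
      using separable_tower_subfield[OF L(1) F] by auto
    have "coeff f i \<in> L" for i
      using L(2) Lf by (cases "i \<le> degree f") (auto simp: coeff_eq_0 is_subfield_def)
    then have "separable_element L x"
      using f unfolding separable_element_iff[OF Lf] polys_over_def by blast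
    then show "x \<in> separable_closure F"
      using separable_tower_separable[OF separable_tower.step[OF L(1)] F]
        in_adjoin[OF is_subfield_imp_subring[OF Lf]]
      unfolding separable_closure_def by blast
  qed
qed (rule subset_separable_closure[OF subfield_separable_closure[OF F]])

lemma separable_root_in_closure:
  assumes F: "is_subfield F" and "f \<in> polys_over (separable_closure F)" "poly f x = 0"
    "poly (pderiv f) x \<noteq> 0"
  shows "x \<in> separable_closure F"
proof -
  have "separable_element (separable_closure F) x"
    using assms(2-) unfolding separable_element_iff[OF subfield_separable_closure[OF F]] by blast
  then show ?thesis
    using separable_closure_idem[OF F] unfolding separable_closure_def[of "separable_closure F"] by blast
qed

subsection \<open>Evaluation of multivariate polynomials\<close>

definition eval_monom :: "(nat \<Rightarrow> 'b::comm_ring_1) \<Rightarrow> (nat \<Rightarrow>\<^sub>0 nat) \<Rightarrow> 'b" where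
  "eval_monom x m = (\<Prod>i\<in>Poly_Mapping.keys m. x i ^ Poly_Mapping.lookup m i)"

text \<open>Common form of three evaluations: \<open>insertion\<close> for the identity,
  \<open>universal_insertion\<close> for \<open>to_universal\<close>, and substitution of
  polynomials for \<open>mpoly_const\<close>.\<close>

definition eval_mpoly :: "('a \<Rightarrow> 'b) \<Rightarrow> (nat \<Rightarrow> 'b) \<Rightarrow> 'a::comm_ring_1 mpoly \<Rightarrow> 'b::comm_ring_1" where
  "eval_mpoly h x p = (\<Sum>m\<in>Poly_Mapping.keys p. h (Poly_Mapping.lookup p m) * eval_monom x m)"

definition mpoly_const :: "'a::comm_ring_1 \<Rightarrow> 'a mpoly" where
  "mpoly_const c = Poly_Mapping.single 0 c"

definition mpoly_var :: "nat \<Rightarrow> 'a::comm_ring_1 mpoly" where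
  "mpoly_var i = Poly_Mapping.single (Poly_Mapping.single i 1) 1"

lemma eval_monom_superset:
  assumes "finite A" "Poly_Mapping.keys m \<subseteq> A"
  shows "eval_monom x m = (\<Prod>i\<in>A. x i ^ Poly_Mapping.lookup m i)"
  unfolding eval_monom_def using assms
  by (intro prod.mono_neutral_left) (auto simp: in_keys_iff)

lemma eval_monom_add: "eval_monom x (m + m') = eval_monom x m * eval_monom x m'"
proof -
  define A where "A = Poly_Mapping.keys m \<union> Poly_Mapping.keys m'"
  have "finite A" "Poly_Mapping.keys m \<subseteq> A" "Poly_Mapping.keys m' \<subseteq> A" "Poly_Mapping.keys (m + m') \<subseteq> A"
    unfolding A_def using Poly_Mapping.keys_add[of m m'] by auto
  then show ?thesis
    by (simp add: eval_monom_superset[of A] lookup_add power_add prod.distrib)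
qed

lemma mpoly_sum_single:
  "p = (\<Sum>m\<in>Poly_Mapping.keys p. Poly_Mapping.single m (Poly_Mapping.lookup p m))"
proof (rule poly_mapping_eqI)
  fix k
  have "(\<Sum>m\<in>Poly_Mapping.keys p. Poly_Mapping.lookup (Poly_Mapping.single m (Poly_Mapping.lookup p m)) k)
    = (\<Sum>m\<in>Poly_Mapping.keys p. if m = k then Poly_Mapping.lookup p m else 0)"
    by (intro sum.cong) (auto simp: lookup_single when_def)
  also have "\<dots> = Poly_Mapping.lookup p k"
    by (simp add: sum.delta in_keys_iff)
  finally show "Poly_Mapping.lookup p k = Poly_Mapping.lookup
      (\<Sum>m\<in>Poly_Mapping.keys p. Poly_Mapping.single m (Poly_Mapping.lookup p m)) k"
    by (simp add: lookup_sum)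
qed

lemma mpoly_single_eq:
  "Poly_Mapping.single m c = mpoly_const c * (\<Prod>i\<in>Poly_Mapping.keys m. mpoly_var i ^ Poly_Mapping.lookup m i)"
proof -
  have pow: "mpoly_var i ^ k = (Poly_Mapping.single (Poly_Mapping.single i k) 1 :: 'a mpoly)" for i k
    by (induction k) (auto simp: mpoly_var_def mult_single single_add[symmetric] add.commute)
  have "(\<Prod>i\<in>A. Poly_Mapping.single (Poly_Mapping.single i (Poly_Mapping.lookup m i)) 1)
    = (Poly_Mapping.single (\<Sum>i\<in>A. Poly_Mapping.single i (Poly_Mapping.lookup m i)) 1 :: 'a mpoly)" for A
    by (induction A rule: infinite_finite_induct) (auto simp: mult_single)
  then show ?thesis
    unfolding mpoly_const_def pow by (simp add: mult_single mpoly_sum_single[symmetric])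
qed

context
  fixes h :: "'a::comm_ring_1 \<Rightarrow> 'b::comm_ring_1" and x :: "nat \<Rightarrow> 'b"
  assumes h: "comm_ring_hom h"
begin

interpretation comm_ring_hom h by (rule h)

lemma eval_mpoly_superset:
  assumes "finite A" "Poly_Mapping.keys p \<subseteq> A"
  shows "eval_mpoly h x p = (\<Sum>m\<in>A. h (Poly_Mapping.lookup p m) * eval_monom x m)"
  unfolding eval_mpoly_def using assms
  by (intro sum.mono_neutral_left) (auto simp: in_keys_iff hom_zero)

lemma eval_mpoly_add: "eval_mpoly h x (p + q) = eval_mpoly h x p + eval_mpoly h x q"
proof -
  define A where "A = Poly_Mapping.keys p \<union> Poly_Mapping.keys q"
  have "finite A" "Poly_Mapping.keys p \<subseteq> A" "Poly_Mapping.keys q \<subseteq> A" "Poly_Mapping.keys (p + q) \<subseteq> A"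
    unfolding A_def using Poly_Mapping.keys_add[of p q] by auto
  then show ?thesis
    by (simp add: eval_mpoly_superset[of A] lookup_add hom_add sum.distrib algebra_simps)
qed

lemma eval_mpoly_0 [simp]: "eval_mpoly h x 0 = 0"
  by (simp add: eval_mpoly_def)

lemma eval_mpoly_sum: "eval_mpoly h x (sum f I) = (\<Sum>i\<in>I. eval_mpoly h x (f i))"
  by (induction I rule: infinite_finite_induct) (auto simp: eval_mpoly_add)

lemma eval_mpoly_single: "eval_mpoly h x (Poly_Mapping.single m c) = h c * eval_monom x m"
  using eval_mpoly_superset[of "{m}" "Poly_Mapping.single m c"] by simp

lemma eval_mpoly_mult: "eval_mpoly h x (p * q) = eval_mpoly h x p * eval_mpoly h x q"
proof -
  define s where "s = (\<lambda>p m. Poly_Mapping.single m (Poly_Mapping.lookup p m) :: 'a mpoly)"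
  have "p * q = (\<Sum>m\<in>Poly_Mapping.keys p. s p m) * (\<Sum>m\<in>Poly_Mapping.keys q. s q m)"
    unfolding s_def by (simp add: mpoly_sum_single[symmetric])
  also have "\<dots> = (\<Sum>m\<in>Poly_Mapping.keys p. \<Sum>m'\<in>Poly_Mapping.keys q. s p m * s q m')"
    by (rule sum_product)
  finally have "eval_mpoly h x (p * q) =
      (\<Sum>m\<in>Poly_Mapping.keys p. \<Sum>m'\<in>Poly_Mapping.keys q. eval_mpoly h x (s p m * s q m'))"
    by (simp add: eval_mpoly_sum)
  also have "\<dots> = (\<Sum>m\<in>Poly_Mapping.keys p. \<Sum>m'\<in>Poly_Mapping.keys q.
      (h (Poly_Mapping.lookup p m) * eval_monom x m) * (h (Poly_Mapping.lookup q m') * eval_monom x m'))"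
    unfolding s_def
    by (simp add: mult_single eval_mpoly_single eval_monom_add hom_mult algebra_simps)
  also have "\<dots> = eval_mpoly h x p * eval_mpoly h x q"
    unfolding eval_mpoly_def by (rule sum_product[symmetric])
  finally show ?thesis .
qed

lemma eval_mpoly_const [simp]: "eval_mpoly h x (mpoly_const c) = h c"
  unfolding mpoly_const_def eval_mpoly_single by (simp add: eval_monom_def)

lemma eval_mpoly_var [simp]: "eval_mpoly h x (mpoly_var i) = x i"
  unfolding mpoly_var_def eval_mpoly_single by (simp add: eval_monom_def hom_one)

lemma comm_ring_hom_eval_mpoly: "comm_ring_hom (eval_mpoly h x)"
proof
  show "eval_mpoly h x 1 = 1"
    using eval_mpoly_const[of 1] by (simp add: mpoly_const_def hom_one)
qed (auto simp: eval_mpoly_add eval_mpoly_mult)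

end

lemma comm_ring_hom_mpoly_const: "comm_ring_hom (mpoly_const :: 'a::comm_ring_1 \<Rightarrow> _)"
  by unfold_locales (auto simp: mpoly_const_def single_add mult_single)

lemma mpoly_const_eq_0_iff: "mpoly_const c = 0 \<longleftrightarrow> c = 0"
  unfolding mpoly_const_def by (metis lookup_single_eq lookup_zero single_zero)

lemma insertion_eq_eval: "insertion x p = eval_mpoly (\<lambda>c. c) x p" for p :: "'a::comm_ring_1 mpoly"
  unfolding insertion_def eval_mpoly_def eval_monom_def ..

lemma comm_ring_hom_id: "comm_ring_hom (\<lambda>c::'a::comm_ring_1. c)"
  by unfold_locales auto

lemma comm_ring_hom_insertion: "comm_ring_hom (insertion x :: 'a::comm_ring_1 mpoly \<Rightarrow> 'a)"
  using comm_ring_hom_eval_mpoly[OF comm_ring_hom_id, of x] by (simp add: insertion_eq_eval[abs_def])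

lemma insertion_const [simp]: "insertion x (mpoly_const c) = c"
  by (simp add: insertion_eq_eval comm_ring_hom_id)

lemma insertion_var [simp]: "insertion x (mpoly_var i) = x i"
  by (simp add: insertion_eq_eval comm_ring_hom_id)

section \<open>Polynomials with coefficients in a subring, and their nonvanishing\<close>

lemma mpolys_single:
  assumes "c \<in> F" "Poly_Mapping.keys m \<subseteq> {..<n}"
  shows "Poly_Mapping.single m c \<in> mpolys n F"
  using assms unfolding mpolys_def by (auto split: if_splits)

lemma mpolys_0 [simp]: "0 \<in> mpolys n F"
  unfolding mpolys_def by simp

lemma mpolys_const: "c \<in> F \<Longrightarrow> mpoly_const c \<in> mpolys n F"
  unfolding mpoly_const_def by (intro mpolys_single) auto

lemma mpolys_var: "1 \<in> F \<Longrightarrow> i < n \<Longrightarrow> mpoly_var i \<in> mpolys n F"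
  unfolding mpoly_var_def by (intro mpolys_single) auto

lemma mpolys_mono: "F \<subseteq> L \<Longrightarrow> mpolys n F \<subseteq> mpolys n L"
  unfolding mpolys_def by auto

lemma mpolys_Suc: "mpolys m F \<subseteq> mpolys (Suc m) F"
  unfolding mpolys_def by (force simp: subset_iff)

lemma subring_mpolys:
  fixes F :: "'a::comm_ring_1 set"
  assumes F: "is_subring F"
  shows "is_subring (mpolys n F)"
proof -
  have F': "0 \<in> F" "1 \<in> F" "\<And>x y. x \<in> F \<Longrightarrow> y \<in> F \<Longrightarrow> x + y \<in> F"
    "\<And>x y. x \<in> F \<Longrightarrow> y \<in> F \<Longrightarrow> x * y \<in> F" "\<And>x. x \<in> F \<Longrightarrow> - x \<in> F"
    using F unfolding is_subring_def by auto
  have lookup: "Poly_Mapping.lookup p m \<in> F" if "p \<in> mpolys n F" for p m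
    using that F'(1) unfolding mpolys_def by (cases "m \<in> Poly_Mapping.keys p") (auto simp: in_keys_iff)
  have add: "p + q \<in> mpolys n F" if "p \<in> mpolys n F" "q \<in> mpolys n F" for p q
    using that lookup[OF that(1)] lookup[OF that(2)] F'(3) Poly_Mapping.keys_add[of p q]
    unfolding mpolys_def by (auto simp: lookup_add subset_iff)
  have sum: "sum f I \<in> mpolys n F" if "\<And>i. i \<in> I \<Longrightarrow> f i \<in> mpolys n F"
    for f :: "(nat \<Rightarrow>\<^sub>0 nat) \<Rightarrow> _" and I
    using that by (induction I rule: infinite_finite_induct) (auto intro: add)
  have mult: "p * q \<in> mpolys n F" if "p \<in> mpolys n F" "q \<in> mpolys n F" for p q
  proof -
    define s where "s = (\<lambda>p m. Poly_Mapping.single m (Poly_Mapping.lookup p m) :: 'a mpoly)"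
    have "p * q = (\<Sum>m\<in>Poly_Mapping.keys p. s p m) * (\<Sum>m\<in>Poly_Mapping.keys q. s q m)"
      unfolding s_def by (simp add: mpoly_sum_single[symmetric])
    also have "\<dots> = (\<Sum>m\<in>Poly_Mapping.keys p. \<Sum>m'\<in>Poly_Mapping.keys q. s p m * s q m')"
      by (rule sum_product)
    also have "\<dots> \<in> mpolys n F"
    proof (intro sum)
      fix m m' assume m: "m \<in> Poly_Mapping.keys p" "m' \<in> Poly_Mapping.keys q"
      have "Poly_Mapping.keys (m + m') \<subseteq> {..<n}"
        using Poly_Mapping.keys_add[of m m'] m that unfolding mpolys_def by blast
      then show "s p m * s q m' \<in> mpolys n F"
        unfolding s_def mult_single using F'(4) lookup that by (intro mpolys_single) auto
    qed
    finally show ?thesis .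
  qed
  have "1 \<in> mpolys n F"
    using mpolys_const[OF F'(2)] unfolding mpoly_const_def by simp
  moreover have "- p \<in> mpolys n F" if "p \<in> mpolys n F" for p
    using that F'(5) unfolding mpolys_def by auto
  ultimately show ?thesis
    unfolding is_subring_def using add mult by simp
qed

lemma subring_UNIV: "is_subring UNIV"
  by (simp add: is_subring_def)

text \<open>A root \<open>t\<close> of \<open>1 + X f(X)\<close> satisfies
  \<open>t f(t) = - 1\<close>.\<close>

lemma alg_closed_nonroot:
  fixes f :: "'a::alg_closed_field poly"
  assumes "f \<noteq> 0"
  obtains t where "poly f t \<noteq> 0"
proof -
  have "degree (pCons 1 f) > 0"
    using assms by simp
  then obtain t where "poly (pCons 1 f) t = 0"
    using alg_closed_imp_poly_has_root by blast
  then show thesis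
    using that by fastforce
qed

lemma digits_unique:
  fixes B :: nat
  assumes "(\<Sum>i<n. a i * B ^ i) = (\<Sum>i<n. b i * B ^ i)" "\<And>i. a i < B" "\<And>i. b i < B" "j < n"
  shows "a j = b j"
  using assms
proof (induction n arbitrary: a b j)
  case (Suc n)
  have split: "(\<Sum>i<Suc n. c i * B ^ i) = c 0 + B * (\<Sum>i<n. c (Suc i) * B ^ i)" for c
    unfolding sum.lessThan_Suc_shift by (simp add: sum_distrib_left algebra_simps)
  have eq: "a 0 + B * (\<Sum>i<n. a (Suc i) * B ^ i) = b 0 + B * (\<Sum>i<n. b (Suc i) * B ^ i)"
    using Suc.prems(1) unfolding split .
  have "B > 0"
    using Suc.prems(2)[of 0] by simp
  have 0: "a 0 = b 0"
    using arg_cong[OF eq, of "\<lambda>k. k mod B"] Suc.prems(2,3)[of 0] by simp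
  then have "(\<Sum>i<n. a (Suc i) * B ^ i) = (\<Sum>i<n. b (Suc i) * B ^ i)"
    using eq \<open>B > 0\<close> by simp
  then have "a (Suc i) = b (Suc i)" if "i < n" for i
    using Suc.IH[of "\<lambda>i. a (Suc i)" "\<lambda>i. b (Suc i)" i] Suc.prems(2,3) that by simp
  then show ?case
    using 0 Suc.prems(4) by (cases j) auto
qed simp

text \<open>Kronecker substitution: the point \<open>(t, t\<^bsup>B\<^esup>, t\<^bsup>B\<^sup>2\<^esup>, \<dots>)\<close> separates monomials with exponents below \<open>B\<close>.\<close>

lemma mpoly_nonvanishing:
  fixes p :: "'a::alg_closed_field mpoly"
  assumes p: "p \<in> mpolys n UNIV" "p \<noteq> 0"
  obtains a where "a \<in> affine_space n" "insertion a p \<noteq> 0"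
proof -
  let ?K = "Poly_Mapping.keys p"
  define E where "E = (\<Union>m\<in>?K. Poly_Mapping.lookup m ` {..<n})"
  \<comment> \<open>\<open>B\<close> exceeds every exponent, so exponents are digits in base
    \<open>B\<close>. Inserting 0 keeps the maximum meaningful when \<open>n = 0\<close>.\<close>
  define B where "B = Suc (Max (insert 0 E))"
  have B: "Poly_Mapping.lookup m i < B" if "m \<in> ?K" for m i
  proof (cases "i < n")
    case True
    then have "Poly_Mapping.lookup m i \<in> insert 0 E" "finite (insert 0 E)"
      using that unfolding E_def by auto
    then show ?thesis
      unfolding B_def by (simp add: less_Suc_eq_le)
  next
    case False
    then have "i \<notin> Poly_Mapping.keys m"
      using that p(1) unfolding mpolys_def by auto
    then show ?thesis
      unfolding B_def by (simp add: in_keys_iff)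
  qed
  define e where "e = (\<lambda>m. \<Sum>i<n. Poly_Mapping.lookup m i * B ^ i)"
  have inj: "inj_on e ?K"
  proof (rule inj_onI)
    fix m m' assume mm: "m \<in> ?K" "m' \<in> ?K" "e m = e m'"
    have "Poly_Mapping.lookup m i = Poly_Mapping.lookup m' i" for i
    proof (cases "i < n")
      case True
      then show ?thesis
        using digits_unique[of "Poly_Mapping.lookup m" B n "Poly_Mapping.lookup m'" i] mm B
        unfolding e_def by auto
    next
      case False
      then have "i \<notin> Poly_Mapping.keys m" "i \<notin> Poly_Mapping.keys m'"
        using mm p(1) unfolding mpolys_def by auto
      then show ?thesis
        by (simp add: in_keys_iff)
    qed
    then show "m = m'"
      by (intro poly_mapping_eqI)
  qed
  define f where "f = (\<Sum>m\<in>?K. Polynomial.monom (Poly_Mapping.lookup p m) (e m))"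
  obtain m0 where m0: "m0 \<in> ?K"
    using p(2) by (metis all_not_in_conv keys_eq_empty)
  have "coeff f (e m0) = (\<Sum>m\<in>?K. if m = m0 then Poly_Mapping.lookup p m else 0)"
    unfolding f_def coeff_sum coeff_monom using inj m0
    by (intro sum.cong) (auto simp: inj_on_def)
  then have "coeff f (e m0) \<noteq> 0"
    using m0 by (simp add: sum.delta in_keys_iff)
  then have "f \<noteq> 0"
    by auto
  then obtain t where t: "poly f t \<noteq> 0"
    using alg_closed_nonroot by blast
  define a where "a = (\<lambda>i. if i < n then t ^ (B ^ i) else 0)"
  have "insertion a p = (\<Sum>m\<in>?K. Poly_Mapping.lookup p m * t ^ e m)"
    unfolding insertion_eq_eval eval_mpoly_def
  proof (intro sum.cong refl arg_cong2[where f = "(*)"])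
    fix m assume "m \<in> ?K"
    then have "Poly_Mapping.keys m \<subseteq> {..<n}"
      using p(1) unfolding mpolys_def by auto
    then have "eval_monom a m = (\<Prod>i<n. a i ^ Poly_Mapping.lookup m i)"
      by (intro eval_monom_superset) auto
    also have "\<dots> = (\<Prod>i<n. t ^ (Poly_Mapping.lookup m i * B ^ i))"
      by (intro prod.cong) (auto simp: a_def power_mult[symmetric] mult.commute)
    also have "\<dots> = t ^ e m"
      unfolding e_def by (rule power_sum[symmetric])
    finally show "eval_monom a m = t ^ e m" .
  qed
  also have "\<dots> = poly f t"
    unfolding f_def by (simp add: poly_sum poly_monom)
  finally show thesis
    using t by (intro that[of a]) (auto simp: a_def affine_space_def)
qed

subsection \<open>Affine space as a variety\<close>

lemma vanishing_ideal_affine_space: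
  "vanishing_ideal n (affine_space n :: (nat \<Rightarrow> 'a::alg_closed_field) set) = {0}"
proof
  show "vanishing_ideal n (affine_space n :: (nat \<Rightarrow> 'a) set) \<subseteq> {0}"
    using mpoly_nonvanishing unfolding vanishing_ideal_def by blast
  show "{0} \<subseteq> vanishing_ideal n (affine_space n :: (nat \<Rightarrow> 'a) set)"
    unfolding vanishing_ideal_def by (auto simp: insertion_def)
qed

lemma has_value_at_affine_space:
  fixes \<phi> :: "'a::alg_closed_field mpoly \<times> 'a mpoly"
  shows "has_value_at m (affine_space m) \<phi> a b \<longleftrightarrow> (\<exists>g\<in>mpolys m UNIV. \<exists>h\<in>mpolys m UNIV.
     fst \<phi> * h = g * snd \<phi> \<and> insertion a h \<noteq> 0 \<and> b = insertion a g / insertion a h)"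
  unfolding has_value_at_def vanishing_ideal_affine_space by simp

text \<open>If two proper closed subsets covered the space, a product of two nonzero polynomials
  would vanish everywhere and hence be zero. The vanishing ideal is zero, generated by the empty
  set, and so defined over any \<open>K\<close>.\<close>

lemma abs_irreducible_affine_space:
  fixes K :: "'a::alg_closed_field set"
  shows "abs_irreducible_variety K n (affine_space n)"
proof -
  have alg: "algebraic_set n (affine_space n :: (nat \<Rightarrow> 'a) set)"
    unfolding algebraic_set_def zero_locus_def by (intro exI[of _ "{}"]) auto
  have "(\<lambda>_. 0 :: 'a) \<in> affine_space n"
    unfolding affine_space_def by simp
  then have ne: "(affine_space n :: (nat \<Rightarrow> 'a) set) \<noteq> {}"
    by blast
  have irred: "affine_space n = V1 \<or> affine_space n = V2"
    if V: "algebraic_set n V1" "algebraic_set n V2" "affine_space n = V1 \<union> V2"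
    for V1 V2 :: "(nat \<Rightarrow> 'a) set"
  proof (rule ccontr)
    assume neq: "\<not> ?thesis"
    obtain S1 S2 where S: "S1 \<subseteq> mpolys n UNIV" "V1 = zero_locus n S1"
      "S2 \<subseteq> mpolys n UNIV" "V2 = zero_locus n S2"
      using V(1,2) unfolding algebraic_set_def by metis
    obtain a1 a2 where a: "a1 \<in> affine_space n" "a1 \<notin> V1" "a2 \<in> affine_space n" "a2 \<notin> V2"
      using V(3) neq by blast
    obtain p1 p2 where p: "p1 \<in> S1" "insertion a1 p1 \<noteq> 0" "p2 \<in> S2" "insertion a2 p2 \<noteq> 0"
      using a S unfolding zero_locus_def by blast
    have "insertion a (p1 * p2) = 0" if "a \<in> affine_space n" for a
    proof -
      interpret comm_ring_hom "insertion a" by (rule comm_ring_hom_insertion)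
      have "a \<in> V1 \<or> a \<in> V2"
        using that V(3) by blast
      then show ?thesis
        using p S unfolding zero_locus_def hom_mult by auto
    qed
    moreover have "p1 * p2 \<in> mpolys n UNIV"
      using p S subring_mpolys[OF subring_UNIV, of n] unfolding is_subring_def by blast
    ultimately have "p1 * p2 = 0"
      using mpoly_nonvanishing by metis
    then have "p1 = 0 \<or> p2 = 0"
      by simp
    then show False
      using p by (auto simp: insertion_def)
  qed
  have "generated_ideal n {} = {0 :: 'a mpoly}"
    unfolding generated_ideal_def by auto
  then show ?thesis
    unfolding abs_irreducible_variety_def irreducible_algebraic_set_def
      vanishing_ideal_affine_space using alg ne irred by (intro conjI exI[of _ "{}"]) auto
qed

section \<open>Generated fields and the generic point of affine space\<close>

lemma subfield_generated_field: "is_subfield (generated_field S)"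
  unfolding generated_field_def is_subfield_def by blast

lemma subset_generated_field: "S \<subseteq> generated_field S"
  unfolding generated_field_def by blast

lemma generated_field_minimal: "is_subfield F \<Longrightarrow> S \<subseteq> F \<Longrightarrow> generated_field S \<subseteq> F"
  unfolding generated_field_def by blast

text \<open>The variables themselves, viewed in the universal domain. One sequence is generic for
  the affine spaces of all dimensions.\<close>

definition generic_coords :: "nat \<Rightarrow> 'a::field universal_domain" where
  "generic_coords i = to_ac (Fract (mpoly_var i) 1)"

lemma comm_ring_hom_to_ac_Fract:
  "comm_ring_hom (\<lambda>p. to_ac (Fract p 1) :: 'a::field universal_domain)"
proof
  show "to_ac (Fract 1 1) = (1 :: 'a universal_domain)"
    by (simp add: One_fract_def[symmetric])
  show "to_ac (Fract 0 1) = (0 :: 'a universal_domain)"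
    by (simp add: Zero_fract_def[symmetric])
qed (simp_all flip: to_ac_add to_ac_mult)

lemma comm_ring_hom_to_universal: "comm_ring_hom (to_universal :: 'a::field \<Rightarrow> _)"
proof -
  interpret a: comm_ring_hom "\<lambda>p. to_ac (Fract p 1) :: 'a universal_domain"
    by (rule comm_ring_hom_to_ac_Fract)
  interpret b: comm_ring_hom "mpoly_const :: 'a \<Rightarrow> _"
    by (rule comm_ring_hom_mpoly_const)
  have "to_universal c = to_ac (Fract (mpoly_const c) 1)" for c :: 'a
    unfolding to_universal_def mpoly_const_def ..
  then show ?thesis
    by unfold_locales
      (simp_all only: a.hom_add a.hom_mult b.hom_add b.hom_mult a.hom_zero b.hom_zero a.hom_one b.hom_one)
qed

lemma to_ac_Fract_eq_0_iff: "to_ac (Fract p 1) = (0 :: 'a::field universal_domain) \<longleftrightarrow> p = 0"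
  by (simp add: Zero_fract_def eq_fract)

lemma to_universal_eq_0_iff: "to_universal c = 0 \<longleftrightarrow> c = 0"
  using to_ac_Fract_eq_0_iff mpoly_const_eq_0_iff unfolding to_universal_def mpoly_const_def by blast

lemma inj_to_universal: "inj (to_universal :: 'a::field \<Rightarrow> _)"
proof -
  interpret comm_ring_hom "to_universal :: 'a \<Rightarrow> _" by (rule comm_ring_hom_to_universal)
  show ?thesis
    by (rule injI) (metis eq_iff_diff_eq_0 hom_minus to_universal_eq_0_iff)
qed

lemma universal_insertion_eq_eval:
  fixes p :: "'a::field mpoly"
  shows "universal_insertion x p = eval_mpoly to_universal x p"
proof -
  have "Poly_Mapping.lookup (Poly_Mapping.map to_universal p) m = to_universal (Poly_Mapping.lookup p m)" for m
    using to_universal_eq_0_iff[of "0 :: 'a"] by (simp add: map.rep_eq when_def)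
  moreover from this have "Poly_Mapping.keys (Poly_Mapping.map to_universal p) = Poly_Mapping.keys p"
    by (auto simp: in_keys_iff to_universal_eq_0_iff)
  ultimately show ?thesis
    unfolding universal_insertion_def insertion_eq_eval eval_mpoly_def by simp
qed

lemma comm_ring_hom_universal_insertion: "comm_ring_hom (universal_insertion x)"
  using comm_ring_hom_eval_mpoly[OF comm_ring_hom_to_universal, of x]
  by (simp add: universal_insertion_eq_eval[abs_def])

lemma universal_insertion_const [simp]: "universal_insertion x (mpoly_const c) = to_universal c"
  by (simp add: universal_insertion_eq_eval comm_ring_hom_to_universal)

lemma universal_insertion_var [simp]: "universal_insertion x (mpoly_var i) = x i"
  by (simp add: universal_insertion_eq_eval comm_ring_hom_to_universal)

lemma universal_insertion_generic: "universal_insertion generic_coords p = to_ac (Fract p 1)"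
proof -
  interpret a: comm_ring_hom "\<lambda>p. to_ac (Fract p 1) :: 'a universal_domain"
    by (rule comm_ring_hom_to_ac_Fract)
  interpret u: comm_ring_hom "universal_insertion (generic_coords :: nat \<Rightarrow> 'a universal_domain)"
    by (rule comm_ring_hom_universal_insertion)
  have "universal_insertion generic_coords (Poly_Mapping.single m c)
    = to_ac (Fract (Poly_Mapping.single m c) 1)" for m and c :: 'a
    unfolding mpoly_single_eq[of m c] u.hom_mult a.hom_mult u.hom_prod a.hom_prod u.hom_power a.hom_power
      universal_insertion_const universal_insertion_var
    by (simp only: generic_coords_def to_universal_def mpoly_const_def)
  then have "universal_insertion generic_coords (\<Sum>m\<in>Poly_Mapping.keys p. Poly_Mapping.single m (Poly_Mapping.lookup p m))
    = to_ac (Fract (\<Sum>m\<in>Poly_Mapping.keys p. Poly_Mapping.single m (Poly_Mapping.lookup p m)) 1)"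
    unfolding u.hom_sum a.hom_sum by simp
  then show ?thesis
    unfolding mpoly_sum_single[symmetric] .
qed

lemma universal_insertion_generic_eq_0_iff: "universal_insertion generic_coords p = 0 \<longleftrightarrow> p = 0"
  unfolding universal_insertion_generic by (rule to_ac_Fract_eq_0_iff)

lemma generic_point_affine_space:
  "generic_point n (affine_space n) (generic_coords :: nat \<Rightarrow> 'a::alg_closed_field universal_domain)"
  unfolding generic_point_def
  using universal_insertion_generic_eq_0_iff by (auto simp: vanishing_ideal_affine_space)

lemma has_dimension_affine_space:
  fixes K :: "'a::alg_closed_field set"
  shows "has_dimension K n (affine_space n) n"
proof -
  let ?x = "generic_coords :: nat \<Rightarrow> 'a universal_domain"
  have "algebraically_independent (to_universal ` K) n ?x"
    unfolding algebraically_independent_def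
  proof (intro ballI impI)
    fix p :: "'a universal_domain mpoly"
    assume p: "p \<in> mpolys n (to_universal ` K)" "insertion ?x p = 0"
    \<comment> \<open>A relation over the image of \<open>K\<close> is pulled back along the
      injective \<open>to_universal\<close>; genericity of the coordinates then makes it
      trivial.\<close>
    define p' where "p' = Poly_Mapping.map (inv_into UNIV to_universal) p"
    have zero: "to_universal (0 :: 'a) = 0"
      by (simp add: to_universal_eq_0_iff)
    have img: "Poly_Mapping.lookup p m \<in> range to_universal" for m
    proof (cases "m \<in> Poly_Mapping.keys p")
      case True
      then show ?thesis
        using p(1) unfolding mpolys_def by blast
    next
      case False
      then have "Poly_Mapping.lookup p m = to_universal 0"
        unfolding zero by (simp add: in_keys_iff)
      then show ?thesis
        by blast
    qed
    have inv0: "inv_into UNIV to_universal 0 = (0 :: 'a)"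
      using inv_f_f[OF inj_to_universal, of "0 :: 'a"] unfolding zero .
    have lookup_map: "Poly_Mapping.lookup (Poly_Mapping.map f q) m = f (Poly_Mapping.lookup q m)"
      if "f 0 = 0" for f :: "'b::zero \<Rightarrow> 'c::zero" and q :: "(nat \<Rightarrow>\<^sub>0 nat) \<Rightarrow>\<^sub>0 'b" and m
      using that by (simp add: map.rep_eq when_def)
    have "Poly_Mapping.lookup (Poly_Mapping.map to_universal p') m = Poly_Mapping.lookup p m" for m
      unfolding lookup_map[of to_universal, OF zero] p'_def lookup_map[of "inv_into UNIV to_universal", OF inv0]
      by (rule f_inv_into_f[OF img])
    then have p_eq: "Poly_Mapping.map to_universal p' = p"
      by (intro poly_mapping_eqI)
    have "universal_insertion ?x p' = 0"
      unfolding universal_insertion_def p_eq by (rule p(2))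
    then have "p' = 0"
      unfolding universal_insertion_generic_eq_0_iff .
    then have "Poly_Mapping.map to_universal p' = 0"
      by (simp add: map_eq_zero_iff)
    then show "p = 0"
      unfolding p_eq .
  qed
  moreover have refl: "algebraic_extension L L" if "is_subfield L" for L :: "'a universal_domain set"
    unfolding algebraic_extension_def field_extension_def
    by (intro conjI ballI that order_refl separable_imp_algebraic separable_element_self)
  moreover have "?x ` {..<n} \<subseteq> function_field K n ?x"
    unfolding function_field_def by (rule order_trans[OF Un_upper2 subset_generated_field])
  ultimately have "has_transcendence_degree (to_universal ` K) (function_field K n ?x) n"
    unfolding has_transcendence_degree_def function_field_def
    by (intro exI[of _ ?x] conjI refl subfield_generated_field)
  then show ?thesis
    unfolding has_dimension_def by (intro exI[of _ ?x] conjI generic_point_affine_space)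
qed

subsection \<open>Norms and interpolation\<close>

lemma poly_eqI_on_points:
  fixes f g :: "'a::idom poly"
  assumes "\<And>i. i \<ge> n \<Longrightarrow> coeff f i = 0" "\<And>i. i \<ge> n \<Longrightarrow> coeff g i = 0"
    and inj: "inj_on \<alpha> {..<n}" and eq: "\<And>k. k < n \<Longrightarrow> poly f (\<alpha> k) = poly g (\<alpha> k)"
  shows "f = g"
proof (rule ccontr)
  assume "f \<noteq> g"
  then have ne: "f - g \<noteq> 0"
    by simp
  have "degree (f - g) < n"
  proof (rule ccontr)
    assume "\<not> degree (f - g) < n"
    then have "coeff (f - g) (degree (f - g)) = 0"
      using assms(1,2) by simp
    then show False
      using ne leading_coeff_0_iff by blast
  qed
  moreover have "\<alpha> ` {..<n} \<subseteq> {x. poly (f - g) x = 0}"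
    using eq by auto
  then have "card (\<alpha> ` {..<n}) \<le> card {x. poly (f - g) x = 0}"
    by (intro card_mono poly_roots_finite ne)
  then have "n \<le> degree (f - g)"
    using card_image[OF inj] card_poly_roots_bound[OF ne] by simp
  ultimately show False
    by simp
qed

lemma coeff_sum_monom: "coeff (\<Sum>i<n. Polynomial.monom (f i) i) j = (if j < n then f j else 0)"
  by (simp add: coeff_sum coeff_monom sum.delta)

lemma poly_sum_monom: "poly (\<Sum>i<n. Polynomial.monom (f i) i) x = (\<Sum>i<n. f i * x ^ i)"
  for x :: "'a::comm_ring_1"
  by (simp add: poly_sum poly_monom)

lemma power_sums_eqD:
  fixes \<alpha> :: "nat \<Rightarrow> 'a::idom"
  assumes "inj_on \<alpha> {..<n}" "\<And>k. k < n \<Longrightarrow> (\<Sum>i<n. f i * \<alpha> k ^ i) = (\<Sum>i<n. g i * \<alpha> k ^ i)" "i < n"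
  shows "f i = g i"
proof -
  have "(\<Sum>i<n. Polynomial.monom (f i) i) = (\<Sum>i<n. Polynomial.monom (g i) i)"
    by (rule poly_eqI_on_points[OF _ _ assms(1)]) (auto simp: coeff_sum_monom poly_sum_monom assms(2))
  from arg_cong[OF this, of "\<lambda>p. coeff p i"] show ?thesis
    using assms(3) by (simp add: coeff_sum_monom)
qed

lemma interpolation:
  fixes T :: "'a::field set"
  assumes T: "is_subfield T" and inj: "inj_on \<alpha> {..<n}"
    and \<alpha>: "\<And>k. k < n \<Longrightarrow> \<alpha> k \<in> T" and t: "\<And>k. k < n \<Longrightarrow> t k \<in> T"
  obtains f where "\<And>i. f i \<in> T" "\<And>k. k < n \<Longrightarrow> (\<Sum>i<n. f i * \<alpha> k ^ i) = t k"
proof -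
  note RT = is_subfield_imp_subring[OF T] and RP = subring_polys_over[OF is_subfield_imp_subring[OF T]]
  have "\<exists>p\<in>polys_over T. (\<forall>i\<ge>n. coeff p i = 0) \<and> (\<forall>k<n. poly p (\<alpha> k) = t k)"
    using inj \<alpha> t
  proof (induction n)
    case 0
    then show ?case
      using subring_0[OF RP] by (intro bexI[of _ 0]) auto
  next
    case (Suc n)
    have "inj_on \<alpha> {..<n}"
      using Suc.prems(1) by (rule inj_on_subset) auto
    then obtain p where p: "p \<in> polys_over T" "\<forall>i\<ge>n. coeff p i = 0" "\<forall>k<n. poly p (\<alpha> k) = t k"
      using Suc.IH Suc.prems(2,3) by auto
    define P where "P = (\<Prod>k<n. [:- \<alpha> k, 1:])"
    have P: "P \<in> polys_over T"
      unfolding P_def using Suc.prems(2) by (intro subring_prod[OF RP] linear_in_polys_over[OF RT]) auto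
    have degP: "degree P \<le> n"
      unfolding P_def using degree_prod_sum_le[of "{..<n}" "\<lambda>k. [:- \<alpha> k, 1:]"] by simp
    have Pn: "poly P (\<alpha> n) \<noteq> 0"
      unfolding P_def poly_prod using Suc.prems(1) by (force simp: inj_on_def)
    have P0: "poly P (\<alpha> k) = 0" if "k < n" for k
      unfolding P_def poly_prod using that by auto
    define c where "c = (t n - poly p (\<alpha> n)) / poly P (\<alpha> n)"
    have c: "c \<in> T"
      unfolding c_def using Suc.prems(2,3) p(1) P
      by (intro subfield_divide[OF T] subring_diff[OF RT] poly_in_subring[OF RT]) auto
    have "p + [:c:] * P \<in> polys_over T"
      by (intro subring_add[OF RP] subring_mult[OF RP] p(1) P const_in_polys_over[OF RT] c)
    moreover have "coeff (p + [:c:] * P) i = 0" if "i \<ge> Suc n" for i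
      using p(2) degP that by (simp add: coeff_eq_0)
    moreover have "poly (p + [:c:] * P) (\<alpha> k) = t k" if "k < Suc n" for k
      using that p(3) P0 Pn unfolding c_def by (cases "k = n") auto
    ultimately show ?case
      by blast
  qed
  then obtain p where p: "p \<in> polys_over T" "\<forall>i\<ge>n. coeff p i = 0" "\<forall>k<n. poly p (\<alpha> k) = t k"
    by blast
  have "poly p x = (\<Sum>i<n. coeff p i * x ^ i)" for x
  proof -
    have "p = (\<Sum>i<n. Polynomial.monom (coeff p i) i)"
      using p(2) by (intro poly_eqI) (simp add: coeff_sum_monom)
    then show ?thesis
      using poly_sum_monom by metis
  qed
  then show thesis
    using that[of "coeff p"] p unfolding polys_over_def by auto
qed

text \<open>Interpolation at the \<open>\<alpha> k\<close> for each fixed \<open>l\<close>, followed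
  by interpolation at the \<open>\<gamma> l\<close> of each coefficient obtained. The solution lies
  in \<open>T\<close>; this yields points with prescribed values and, together with uniqueness,
  membership of given solutions in \<open>T\<close>.\<close>

lemma grid_interpolation:
  fixes T :: "'a::field set"
  assumes T: "is_subfield T" and inj: "inj_on \<alpha> {..<n}" "inj_on \<gamma> {..<e}"
    and mem: "\<And>k. k < n \<Longrightarrow> \<alpha> k \<in> T" "\<And>l. l < e \<Longrightarrow> \<gamma> l \<in> T"
    and t: "\<And>k l. k < n \<Longrightarrow> l < e \<Longrightarrow> t k l \<in> T"
  obtains y where "\<And>i j. i < n \<Longrightarrow> y i j \<in> T"
    "\<And>k l. k < n \<Longrightarrow> l < e \<Longrightarrow> (\<Sum>i<n. (\<Sum>j<e. y i j * \<gamma> l ^ j) * \<alpha> k ^ i) = t k l"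
proof -
  have "\<exists>f. (\<forall>i. f i \<in> T) \<and> (\<forall>k<n. (\<Sum>i<n. f i * \<alpha> k ^ i) = t k l)" if "l < e" for l
    using interpolation[OF T inj(1) mem(1), of "\<lambda>k. t k l"] t that by metis
  then obtain f where f: "\<And>l i. l < e \<Longrightarrow> f l i \<in> T"
    "\<And>l k. l < e \<Longrightarrow> k < n \<Longrightarrow> (\<Sum>i<n. f l i * \<alpha> k ^ i) = t k l"
    by metis
  have "\<exists>y. (\<forall>j. y j \<in> T) \<and> (\<forall>l<e. (\<Sum>j<e. y j * \<gamma> l ^ j) = f l i)" for i
    using interpolation[OF T inj(2) mem(2), of "\<lambda>l. f l i"] f(1) by metis
  then obtain y where y: "\<And>i j. y i j \<in> T" "\<And>i l. l < e \<Longrightarrow> (\<Sum>j<e. y i j * \<gamma> l ^ j) = f l i"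
    by metis
  show thesis
    by (rule that[of y]) (simp_all add: y f(2))
qed

lemma grid_sums_eqD:
  fixes \<alpha> :: "nat \<Rightarrow> 'a::idom"
  assumes inj: "inj_on \<alpha> {..<n}" "inj_on \<gamma> {..<e}"
    and eq: "\<And>k l. k < n \<Longrightarrow> l < e \<Longrightarrow> (\<Sum>i<n. (\<Sum>j<e. y i j * \<gamma> l ^ j) * \<alpha> k ^ i)
      = (\<Sum>i<n. (\<Sum>j<e. z i j * \<gamma> l ^ j) * \<alpha> k ^ i)"
    and "i < n" "j < e"
  shows "y i j = z i j"
proof -
  have "(\<Sum>j<e. y i j * \<gamma> l ^ j) = (\<Sum>j<e. z i j * \<gamma> l ^ j)" if "l < e" for l
    using power_sums_eqD[OF inj(1), of "\<lambda>i. \<Sum>j<e. y i j * \<gamma> l ^ j" "\<lambda>i. \<Sum>j<e. z i j * \<gamma> l ^ j" i]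
      eq[OF _ that] assms(4) by blast
  then show ?thesis
    using power_sums_eqD[OF inj(2), of "y i" "z i" j] assms(5) by blast
qed

text \<open>The norm is the determinant of multiplication by \<open>G\<close> on \<open>S[Z]/(p)\<close>, which the Vandermonde matrix
  of the roots of \<open>p\<close> diagonalises.\<close>

lemma norm_in_subring:
  fixes S :: "'r::idom set"
  assumes S: "is_subring S" and p: "p \<in> polys_over S" "lead_coeff p = 1" "degree p = n"
    and inj: "inj_on \<alpha> {..<n}" and root: "\<And>k. k < n \<Longrightarrow> poly p (\<alpha> k) = 0"
    and G: "G \<in> polys_over S"
  shows "(\<Prod>k<n. poly G (\<alpha> k)) \<in> S"
proof -
  note RP = subring_polys_over[OF S]
  have "\<exists>r\<in>polys_over S. (\<forall>j\<ge>n. coeff r j = 0) \<and> (\<forall>k<n. poly r (\<alpha> k) = poly G (\<alpha> k) * \<alpha> k ^ i)" for i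
  proof -
    have "G * Polynomial.monom 1 i \<in> polys_over S"
      by (intro subring_mult[OF RP] G monom_in_polys_over[OF S] subring_1[OF S])
    then obtain h r where hr: "h \<in> polys_over S" "r \<in> polys_over S"
      "G * Polynomial.monom 1 i = h * p + r" "r = 0 \<or> degree r < degree p"
      using monic_division[OF S p(2,1)] by blast
    have "coeff r j = 0" if "j \<ge> n" for j
      using hr(4) p(3) that by (auto simp: coeff_eq_0)
    moreover have "poly r (\<alpha> k) = poly G (\<alpha> k) * \<alpha> k ^ i" if "k < n" for k
      using arg_cong[OF hr(3), of "\<lambda>f. poly f (\<alpha> k)"] root[OF that] by (simp add: poly_monom)
    ultimately show ?thesis
      using hr(2) by blast
  qed
  then obtain r where r: "\<And>i. r i \<in> polys_over S" "\<And>i j. j \<ge> n \<Longrightarrow> coeff (r i) j = 0"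
    "\<And>i k. k < n \<Longrightarrow> poly (r i) (\<alpha> k) = poly G (\<alpha> k) * \<alpha> k ^ i"
    by metis
  \<comment> \<open>Column \<open>i\<close> of \<open>M\<close> holds the coefficients of
    \<open>G Z^i\<close> reduced modulo \<open>p\<close>. These lie in \<open>S\<close>, whereas
    \<open>W\<close> and \<open>E\<close> are written with the roots, which may lie outside
    \<open>S\<close>.\<close>
  define M where "M = mat n n (\<lambda>(j, i). coeff (r i) j)"
  define W where "W = mat n n (\<lambda>(k, i). \<alpha> k ^ i)"
  define E where "E = mat n n (\<lambda>(k, l). if k = l then poly G (\<alpha> k) else 0)"
  have carr: "M \<in> carrier_mat n n" "W \<in> carrier_mat n n" "E \<in> carrier_mat n n"
    unfolding M_def W_def E_def by auto
  have "W * M = E * W"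
  proof (rule eq_matI)
    fix k i assume ki: "k < dim_row (E * W)" "i < dim_col (E * W)"
    then have ki: "k < n" "i < n"
      using carr by auto
    have "r i = (\<Sum>j<n. Polynomial.monom (coeff (r i) j) j)"
      using r(2) by (intro poly_eqI) (simp add: coeff_sum_monom)
    then have "poly (r i) (\<alpha> k) = (\<Sum>j<n. coeff (r i) j * \<alpha> k ^ j)"
      using poly_sum_monom by metis
    then have "(W * M) $$ (k, i) = poly (r i) (\<alpha> k)"
      using ki unfolding W_def M_def
      by (simp add: scalar_prod_def lessThan_atLeast0 mult.commute)
    moreover have "(E * W) $$ (k, i) = (\<Sum>l<n. (if k = l then poly G (\<alpha> k) else 0) * \<alpha> l ^ i)"
      using ki unfolding W_def E_def
      by (simp add: scalar_prod_def lessThan_atLeast0)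
    moreover have "\<dots> = (\<Sum>l<n. if k = l then poly G (\<alpha> k) * \<alpha> l ^ i else 0)"
      by (intro sum.cong) auto
    ultimately show "(W * M) $$ (k, i) = (E * W) $$ (k, i)"
      using ki r(3) by simp
  qed (use carr in auto)
  then have "det W * det M = det E * det W"
    using det_mult carr by metis
  moreover have "det W \<noteq> 0"
  proof
    assume "det W = 0"
    then obtain v where v: "v \<in> carrier_vec n" "v \<noteq> 0\<^sub>v n" "W *\<^sub>v v = 0\<^sub>v n"
      using det_0_iff_vec_prod_zero[OF carr(2)] by blast
    have "(\<Sum>i<n. v $ i * \<alpha> k ^ i) = (\<Sum>i<n. 0 * \<alpha> k ^ i)" if "k < n" for k
    proof -
      have "(W *\<^sub>v v) $ k = (\<Sum>i<n. \<alpha> k ^ i * v $ i)"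
        using that v(1) unfolding W_def by (simp add: scalar_prod_def lessThan_atLeast0)
      then show ?thesis
        using v(3) that by (simp add: mult.commute)
    qed
    then have "v $ i = 0" if "i < n" for i
      using power_sums_eqD[OF inj, of "\<lambda>i. v $ i" "\<lambda>_. 0" i] that by blast
    then have "v = 0\<^sub>v n"
      using v(1) by (intro eq_vecI) auto
    then show False
      using v(2) by blast
  qed
  ultimately have "det M = det E"
    by (simp add: mult.commute)
  also have "det E = (\<Prod>k<n. poly G (\<alpha> k))"
  proof -
    have "det E = prod_list (diag_mat E)"
      by (rule det_upper_triangular[OF _ carr(3)]) (auto simp: E_def upper_triangular_def)
    also have "diag_mat E = map (\<lambda>k. poly G (\<alpha> k)) [0..<n]"
      unfolding diag_mat_def E_def by (intro nth_equalityI) auto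
    finally show ?thesis
      by (simp add: prod.distinct_set_conv_list[symmetric] lessThan_atLeast0)
  qed
  finally have "(\<Prod>k<n. poly G (\<alpha> k)) = det M"
    by simp
  also have "\<dots> \<in> S"
    using r(1) by (intro det_in_subring[OF S carr(1)]) (auto simp: M_def polys_over_def)
  finally show ?thesis .
qed

subsection \<open>The twisted family\<close>

lemma degree_prod_linear: "degree (\<Prod>k<n. [:- f k, 1:]) = n" for f :: "nat \<Rightarrow> 'a::idom"
  by (simp add: degree_prod_eq_sum_degree)

lemma monic_prod_linear: "coeff (\<Prod>k<n. [:- f k, 1:]) n = 1" for f :: "nat \<Rightarrow> 'a::idom"
  using lead_coeff_prod[of "\<lambda>k. [:- f k, 1:]" "{..<n}"] by (simp add: degree_prod_linear)

lemma monic_eq_prod_linear: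
  fixes p :: "'a::idom poly"
  assumes "lead_coeff p = 1" "degree p = n" "inj_on \<alpha> {..<n}" "\<And>k. k < n \<Longrightarrow> poly p (\<alpha> k) = 0"
  shows "p = (\<Prod>k<n. [:- \<alpha> k, 1:])"
proof -
  let ?P = "\<Prod>k<n. [:- \<alpha> k, 1:]"
  have "p - ?P = 0"
  proof (rule poly_eqI_on_points[OF _ _ assms(3)])
    show "coeff (p - ?P) i = 0" if "i \<ge> n" for i
    proof (cases "i = n")
      case True
      then show ?thesis
        using assms(1,2) monic_prod_linear[of \<alpha> n] by simp
    next
      case False
      then show ?thesis
        using assms(2) that degree_prod_linear[of \<alpha> n] by (simp add: coeff_eq_0)
    qed
    show "poly (p - ?P) (\<alpha> k) = poly 0 (\<alpha> k)" if "k < n" for k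
      using that assms(4) by (auto simp: poly_prod)
  qed simp
  then show ?thesis
    by simp
qed

lemma poly_pderiv_prod_linear:
  fixes f :: "nat \<Rightarrow> 'a::idom"
  assumes "k < n"
  shows "poly (pderiv (\<Prod>k<n. [:- f k, 1:])) (f k) = (\<Prod>l\<in>{..<n} - {k}. f k - f l)"
proof -
  have "(\<Prod>k<n. [:- f k, 1:]) = [:- f k, 1:] * (\<Prod>l\<in>{..<n} - {k}. [:- f l, 1:])"
    using assms by (intro prod.remove) auto
  then show ?thesis
    by (simp only: pderiv_mult) (simp add: pderiv_pCons poly_prod)
qed

lemma pderiv_prod_linear_nonzero:
  fixes f :: "nat \<Rightarrow> 'a::idom"
  assumes "inj_on f {..<n}" "k < n"
  shows "poly (pderiv (\<Prod>k<n. [:- f k, 1:])) (f k) \<noteq> 0"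
  unfolding poly_pderiv_prod_linear[OF assms(2)] using assms by (auto simp: inj_on_def)

lemma alg_closed_monic_split:
  fixes p :: "'a::alg_closed_field poly"
  assumes "lead_coeff p = 1" "degree p = n"
  obtains f where "p = (\<Prod>k<n. [:- f k, 1:])"
proof -
  have "p \<noteq> 0"
    using assms by auto
  then obtain A where A: "size A = n" "p = (\<Prod>x\<in>#A. [:- x, 1:])"
    using alg_closed_imp_factorization[of p] assms by auto
  obtain xs where xs: "mset xs = A"
    using ex_mset by blast
  have "p = prod_list (map (\<lambda>x. [:- x, 1:]) xs)"
    unfolding A(2) xs[symmetric] mset_map[symmetric] prod_mset_prod_list ..
  also have "\<dots> = (\<Prod>k<length xs. [:- xs ! k, 1:])"
    by (simp add: prod.list_conv_set_nth lessThan_atLeast0)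
  finally show thesis
    using that[of "\<lambda>k. xs ! k"] A(1) xs by auto
qed

lemma map_poly_prod_linear:
  assumes "comm_ring_hom h"
  shows "map_poly h (\<Prod>k<n. [:- f k, 1:]) = (\<Prod>k<n. [:- h (f k), 1:])"
proof -
  interpret comm_ring_hom h by (rule assms)
  interpret mp: map_poly_comm_ring_hom h ..
  have "map_poly h [:- a, 1:] = [:- h a, 1:]" for a
    by (intro poly_eqI) (simp add: coeff_pCons hom_uminus split: nat.split)
  then show ?thesis
    by (simp add: mp.hom_prod)
qed

text \<open>The value \<open>U(t, X)\<close> of a family. In the application \<open>c\<close> has
  \<open>Suc e\<close> conjugates, one more than the degree bound \<open>e\<close> in
  \<open>t\<close>, so the values there determine the \<open>b i j\<close>.\<close>

definition family_poly :: "nat \<Rightarrow> nat \<Rightarrow> (nat \<Rightarrow> nat \<Rightarrow> 'b::comm_ring_1) \<Rightarrow> 'b \<Rightarrow> 'b poly" where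
  "family_poly n e b t = Polynomial.monom 1 n + (\<Sum>i<n. Polynomial.monom (\<Sum>j<Suc e. b i j * t ^ j) i)"

lemma coeff_family_poly:
  "coeff (family_poly n e b t) i = (if i < n then \<Sum>j<Suc e. b i j * t ^ j else if i = n then 1 else 0)"
  unfolding family_poly_def by (simp add: coeff_sum_monom del: sum.lessThan_Suc)

lemma monic_family_poly: "degree (family_poly n e b t) = n" "lead_coeff (family_poly n e b t) = 1"
proof -
  have "degree (family_poly n e b t) \<le> n"
    by (rule degree_le) (simp add: coeff_family_poly)
  moreover have "n \<le> degree (family_poly n e b t)"
    by (rule le_degree) (simp add: coeff_family_poly)
  ultimately show "degree (family_poly n e b t) = n"
    by simp
  then show "lead_coeff (family_poly n e b t) = 1"
    by (simp add: coeff_family_poly)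
qed

lemma family_poly_in_polys_over:
  fixes S :: "'b::idom set"
  assumes S: "is_subring S" and "\<And>i j. i < n \<Longrightarrow> j \<le> e \<Longrightarrow> b i j \<in> S" "t \<in> S"
  shows "family_poly n e b t \<in> polys_over S"
  unfolding polys_over_def mem_Collect_eq coeff_family_poly
  using assms(2,3)
  by (auto intro!: subring_sum[OF S] subring_mult[OF S] subring_power[OF S] subring_0[OF S] subring_1[OF S]
      simp del: sum.lessThan_Suc)

text \<open>\<open>c\<close> is an element of \<open>K\<close>, the \<open>\<gamma> l\<close> are its other conjugates, and the \<open>\<alpha> k\<close> are the roots of the
  separable polynomial \<open>p\<close> that is to be split. The variables number \<open>k < n\<close> stand for elements
  \<open>x\<^sub>k\<close> of \<open>K\<close>, those numbered \<open>n + i * e + j\<close> for the coordinates of an element of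
  \<open>K[T, Z]/(q1(T), p(Z))\<close>. The family is a monic polynomial of degree \<open>n\<close> over \<open>K[T]\<close> that has roots \<open>x\<^sub>k\<close> at
  \<open>T = c\<close> but generates the algebra \<open>K[Z]/(p)\<close> at the conjugates of \<open>c\<close>.\<close>

locale twisted_family =
  fixes K :: "'a::alg_closed_field set" and c :: 'a and q1 p :: "'a poly"
    and \<gamma> \<alpha> :: "nat \<Rightarrow> 'a" and e n :: nat
  assumes K: "is_subfield K" and cK: "c \<in> K"
    and q1: "q1 \<in> polys_over K" "lead_coeff q1 = 1" "degree q1 = e"
    and inj_\<gamma>: "inj_on \<gamma> {..<e}" and root_\<gamma>: "\<And>l. l < e \<Longrightarrow> poly q1 (\<gamma> l) = 0"
    and q1c: "poly q1 c \<noteq> 0"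
    and p: "p \<in> polys_over K" "lead_coeff p = 1" "degree p = n"
    and inj_\<alpha>: "inj_on \<alpha> {..<n}" and root_\<alpha>: "\<And>k. k < n \<Longrightarrow> poly p (\<alpha> k) = 0"
begin

text \<open>The \<open>x\<close> and \<open>y\<close> variables have the indices below
  \<open>N\<close>; the index \<open>N\<close> itself belongs to \<open>w\<close>. The same number
  \<open>n * Suc e\<close> counts the coefficients of the family.\<close>

definition N :: nat where
  "N = n + n * e"

definition yvar :: "nat \<Rightarrow> nat \<Rightarrow> 'a mpoly" where
  "yvar i j = mpoly_var (n + i * e + j)"

text \<open>Value at \<open>Z = \<alpha> k\<close>, \<open>T = g\<close> of the generic algebra
  element. For fixed \<open>g\<close> these are the roots of its characteristic polynomial.\<close>

definition theta :: "nat \<Rightarrow> 'a \<Rightarrow> 'a mpoly" where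
  "theta k g = (\<Sum>i<n. (\<Sum>j<e. yvar i j * mpoly_const g ^ j) * mpoly_const (\<alpha> k) ^ i)"

lemma index_less_N: "i < n \<Longrightarrow> j < e \<Longrightarrow> n + i * e + j < N"
proof -
  assume "i < n" "j < e"
  then have "i * e + j < Suc i * e" "Suc i * e \<le> n * e"
    by (simp, intro mult_le_mono1) simp_all
  then show ?thesis
    unfolding N_def by linarith
qed

lemma subring_mpolys_K: "is_subring (mpolys m K)"
  by (rule subring_mpolys[OF is_subfield_imp_subring[OF K]])

lemma xvar_in: "k < n \<Longrightarrow> mpoly_var k \<in> mpolys N K"
  using K by (intro mpolys_var) (auto simp: N_def is_subfield_def)

lemma yvar_in: "i < n \<Longrightarrow> j < e \<Longrightarrow> yvar i j \<in> mpolys N K"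
  unfolding yvar_def using K index_less_N by (intro mpolys_var) (auto simp: is_subfield_def)

text \<open>\<open>NP\<close> is the norm of \<open>X\<close> minus the generic element: the outer
  variable of \<open>NP\<close> is \<open>X\<close>, the inner one \<open>T\<close>. Being a norm,
  it has coefficients over \<open>K\<close>, although each \<open>theta k g\<close> involves the
  root \<open>\<alpha> k\<close>.\<close>

lemma norm_poly_exists:
  obtains NP :: "'a mpoly poly poly" where "NP \<in> polys_over (polys_over (mpolys N K))"
    "\<And>g. map_poly (\<lambda>f. poly f (mpoly_const g)) NP = (\<Prod>k<n. [:- theta k g, 1:])"
proof -
  define S where "S = polys_over (polys_over (mpolys N K))"
  note R0 = subring_mpolys_K[of N]
  note R1 = subring_polys_over[OF R0]
  have S: "is_subring S"
    unfolding S_def by (rule subring_polys_over[OF R1])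
  interpret C: comm_ring_hom "mpoly_const :: 'a \<Rightarrow> 'a mpoly"
    by (rule comm_ring_hom_mpoly_const)
  interpret L: comm_ring_hom "\<lambda>x :: 'a mpoly poly. [:x:]"
    by unfold_locales (auto simp: one_pCons)
  define \<kappa> where "\<kappa> = (\<lambda>a::'a. [:[:mpoly_const a:]:])"
  interpret k: inj_comm_ring_hom \<kappa>
    by unfold_locales (auto simp: \<kappa>_def one_pCons C.hom_add C.hom_mult C.hom_zero C.hom_one mpoly_const_eq_0_iff)
  define pc where "pc = map_poly \<kappa> p"
  have pc: "pc \<in> polys_over S" "lead_coeff pc = 1" "degree pc = n"
  proof -
    have "\<kappa> a \<in> S" if "a \<in> K" for a
      unfolding \<kappa>_def S_def
      by (intro const_in_polys_over[OF R1] const_in_polys_over[OF R0] mpolys_const that)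
    then show "pc \<in> polys_over S"
      using p(1) unfolding pc_def polys_over_def by simp
    show "degree pc = n" "lead_coeff pc = 1"
      unfolding pc_def using p(2,3) k.hom_one by simp_all
  qed
  have root: "poly pc (\<kappa> (\<alpha> k)) = 0" if "k < n" for k
    unfolding pc_def using root_\<alpha>[OF that] by (simp add: k.hom_zero)
  have inj: "inj_on (\<lambda>k. \<kappa> (\<alpha> k)) {..<n}"
    using inj_\<alpha> unfolding inj_on_def by simp
  define Y where "Y = (\<lambda>i. \<Sum>j<e. Polynomial.monom (yvar i j) j)"
  have Y: "Y i \<in> polys_over (mpolys N K)" if "i < n" for i
    unfolding Y_def using that by (intro subring_sum[OF R1] monom_in_polys_over[OF R0] yvar_in) auto
  \<comment> \<open>The outermost variable of \<open>G\<close> is \<open>Z\<close>, followed by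
    \<open>X\<close> and \<open>T\<close>; \<open>[:[:0, 1:]:]\<close> is \<open>X\<close> as a
    constant in \<open>Z\<close>.\<close>
  define G where "G = [:[:0, 1:]:] - (\<Sum>i<n. Polynomial.monom [:Y i:] i)"
  have SP: "is_subring (polys_over S)"
    by (rule subring_polys_over[OF S])
  have "[:0, 1:] \<in> S"
    unfolding S_def
    by (intro pCons_in_polys_over[OF R1] const_in_polys_over[OF R1] subring_0[OF R1] subring_1[OF R1])
  moreover have "[:Y i:] \<in> S" if "i < n" for i
    unfolding S_def using Y[OF that] by (intro const_in_polys_over[OF R1])
  ultimately have G: "G \<in> polys_over S"
    unfolding G_def
    by (intro subring_diff[OF SP] subring_sum[OF SP] const_in_polys_over[OF S] monom_in_polys_over[OF S]) auto
  define TH where "TH = (\<lambda>k. \<Sum>i<n. Y i * [:mpoly_const (\<alpha> k ^ i):])"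
  have "poly G (\<kappa> (\<alpha> k)) = [:- TH k, 1:]" for k
  proof -
    have "poly G (\<kappa> (\<alpha> k)) = [:0, 1:] - (\<Sum>i<n. [:Y i:] * \<kappa> (\<alpha> k ^ i))"
      unfolding G_def by (simp add: poly_sum poly_monom k.hom_power)
    also have "(\<Sum>i<n. [:Y i:] * \<kappa> (\<alpha> k ^ i)) = (\<Sum>i<n. [:Y i * [:mpoly_const (\<alpha> k ^ i):]:])"
      unfolding \<kappa>_def L.hom_mult ..
    also have "\<dots> = [:TH k:]"
      unfolding TH_def L.hom_sum ..
    finally show ?thesis
      by simp
  qed
  then have NP: "(\<Prod>k<n. [:- TH k, 1:]) \<in> S"
    using norm_in_subring[OF S pc inj root G] by simp
  have "map_poly (\<lambda>f. poly f (mpoly_const g)) (\<Prod>k<n. [:- TH k, 1:]) = (\<Prod>k<n. [:- theta k g, 1:])" for g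
  proof -
    have hom: "comm_ring_hom (\<lambda>f. poly f (mpoly_const g))"
      by unfold_locales auto
    have "poly (TH k) (mpoly_const g) = theta k g" for k
      unfolding TH_def Y_def theta_def by (simp add: poly_sum poly_monom C.hom_power mult.commute)
    then show ?thesis
      unfolding map_poly_prod_linear[OF hom] by simp
  qed
  then show thesis
    using that NP unfolding S_def by blast
qed

text \<open>Chinese remaindering for \<open>q1\<close> and \<open>T - c\<close>. The coefficient of
  \<open>NP\<close> reduced modulo \<open>q1\<close> keeps its values at the
  \<open>\<gamma> l\<close> and has degree below \<open>e\<close>; a multiple \<open>v\<close> of
  \<open>q1\<close> corrects the value at \<open>c\<close> without disturbing the others. Here
  \<open>v\<close> has coefficients in \<open>K\<close> because \<open>q1(c)\<close> is a nonzero
  element of \<open>K\<close>.\<close>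

lemma family_exists:
  "\<exists>A. \<forall>i<n. A i \<in> polys_over (mpolys N K) \<and> (\<forall>j>e. coeff (A i) j = 0) \<and>
     poly (A i) (mpoly_const c) = coeff (\<Prod>k<n. [:- mpoly_var k, 1:]) i \<and>
     (\<forall>l<e. poly (A i) (mpoly_const (\<gamma> l)) = coeff (\<Prod>k<n. [:- theta k (\<gamma> l), 1:]) i)"
proof -
  note R0 = subring_mpolys_K[of N]
  note R1 = subring_polys_over[OF R0]
  interpret C: inj_comm_ring_hom "mpoly_const :: 'a \<Rightarrow> 'a mpoly"
  proof -
    interpret comm_ring_hom "mpoly_const :: 'a \<Rightarrow> 'a mpoly"
      by (rule comm_ring_hom_mpoly_const)
    show "inj_comm_ring_hom (mpoly_const :: 'a \<Rightarrow> 'a mpoly)"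
      by unfold_locales (simp add: mpoly_const_eq_0_iff)
  qed
  obtain NP where NP: "NP \<in> polys_over (polys_over (mpolys N K))"
    "\<And>g. map_poly (\<lambda>f. poly f (mpoly_const g)) NP = (\<Prod>k<n. [:- theta k g, 1:])"
    using norm_poly_exists by blast
  have NPc: "poly (coeff NP i) (mpoly_const g) = coeff (\<Prod>k<n. [:- theta k g, 1:]) i" for i g
    unfolding NP(2)[symmetric] by (simp add: coeff_map_poly)
  define Q where "Q = map_poly mpoly_const q1"
  have Q: "Q \<in> polys_over (mpolys N K)" "lead_coeff Q = 1" "degree Q = e"
    unfolding Q_def using q1 by (auto simp: polys_over_def C.hom_one intro!: mpolys_const)
  have Qg: "poly Q (mpoly_const g) = mpoly_const (poly q1 g)" for g
    unfolding Q_def by simp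
  have "\<exists>A. A \<in> polys_over (mpolys N K) \<and> (\<forall>j>e. coeff A j = 0) \<and>
     poly A (mpoly_const c) = coeff (\<Prod>k<n. [:- mpoly_var k, 1:]) i \<and>
     (\<forall>l<e. poly A (mpoly_const (\<gamma> l)) = coeff (\<Prod>k<n. [:- theta k (\<gamma> l), 1:]) i)" for i
  proof -
    have "coeff NP i \<in> polys_over (mpolys N K)"
      using NP(1) unfolding polys_over_def by blast
    then obtain h r where hr: "h \<in> polys_over (mpolys N K)" "r \<in> polys_over (mpolys N K)"
      "coeff NP i = h * Q + r" "r = 0 \<or> degree r < degree Q"
      using monic_division[OF R0 Q(2,1)] by blast
    have r0: "coeff r j = 0" if "j \<ge> e" for j
      using hr(4) Q(3) that by (auto simp: coeff_eq_0)
    define s :: "'a mpoly" where "s = coeff (\<Prod>k<n. [:- mpoly_var k, 1:]) i"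
    define v where "v = mpoly_const (inverse (poly q1 c)) * (s - poly r (mpoly_const c))"
    define A where "A = r + [:v:] * Q"
    have "(\<Prod>k<n. [:- mpoly_var k, 1:]) \<in> polys_over (mpolys N K)"
      by (intro subring_prod[OF R1] linear_in_polys_over[OF R0] xvar_in) auto
    then have s: "s \<in> mpolys N K"
      unfolding s_def polys_over_def by blast
    have "inverse (poly q1 c) \<in> K"
      using poly_in_subring[OF is_subfield_imp_subring[OF K] q1(1) cK] subfield_inverse[OF K] by blast
    then have "v \<in> mpolys N K"
      unfolding v_def using s cK
      by (intro subring_mult[OF R0] subring_diff[OF R0] poly_in_subring[OF R0] hr(2) mpolys_const)
    then have "A \<in> polys_over (mpolys N K)"
      unfolding A_def by (intro subring_add[OF R1] subring_mult[OF R1] hr(2) Q(1) const_in_polys_over[OF R0])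
    moreover have "coeff A j = 0" if "j > e" for j
      using r0[of j] Q(3) that unfolding A_def by (simp add: coeff_eq_0)
    moreover have "poly A (mpoly_const c) = s"
    proof -
      have "v * mpoly_const (poly q1 c) = (s - poly r (mpoly_const c)) * mpoly_const (inverse (poly q1 c) * poly q1 c)"
        unfolding v_def C.hom_mult by (simp only: ac_simps)
      then show ?thesis
        using q1c unfolding A_def by (simp add: Qg C.hom_one)
    qed
    moreover have "poly A (mpoly_const (\<gamma> l)) = coeff (\<Prod>k<n. [:- theta k (\<gamma> l), 1:]) i" if "l < e" for l
      using arg_cong[OF hr(3), of "\<lambda>f. poly f (mpoly_const (\<gamma> l))"] root_\<gamma>[OF that]
      unfolding A_def by (simp add: NPc Qg C.hom_zero)
    ultimately show ?thesis
      unfolding s_def by blast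
  qed
  then show ?thesis
    by metis
qed

text \<open>For \<open>i < n\<close>, the coefficient of \<open>X^i T^j\<close> in the family, as a
  polynomial in the \<open>x\<close> and \<open>y\<close> variables.\<close>

definition family_coeff :: "nat \<Rightarrow> nat \<Rightarrow> 'a mpoly" where
  "family_coeff = (\<lambda>i. coeff ((SOME A. \<forall>i<n. A i \<in> polys_over (mpolys N K) \<and> (\<forall>j>e. coeff (A i) j = 0) \<and>
     poly (A i) (mpoly_const c) = coeff (\<Prod>k<n. [:- mpoly_var k, 1:]) i \<and>
     (\<forall>l<e. poly (A i) (mpoly_const (\<gamma> l)) = coeff (\<Prod>k<n. [:- theta k (\<gamma> l), 1:]) i)) i))"

lemma family_coeff_in: "i < n \<Longrightarrow> family_coeff i j \<in> mpolys N K"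
  using someI_ex[OF family_exists] unfolding family_coeff_def polys_over_def by blast

lemma family_coeff_sum:
  assumes "i < n"
  shows "(\<Sum>j<Suc e. family_coeff i j * mpoly_const c ^ j) = coeff (\<Prod>k<n. [:- mpoly_var k, 1:]) i"
    and "l < e \<Longrightarrow> (\<Sum>j<Suc e. family_coeff i j * mpoly_const (\<gamma> l) ^ j)
      = coeff (\<Prod>k<n. [:- theta k (\<gamma> l), 1:]) i"
proof -
  obtain A where A: "family_coeff = (\<lambda>i. coeff (A i))"
    "\<And>j. j > e \<Longrightarrow> coeff (A i) j = 0"
    "poly (A i) (mpoly_const c) = coeff (\<Prod>k<n. [:- mpoly_var k, 1:]) i"
    "\<And>l. l < e \<Longrightarrow> poly (A i) (mpoly_const (\<gamma> l)) = coeff (\<Prod>k<n. [:- theta k (\<gamma> l), 1:]) i"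
    using someI_ex[OF family_exists] assms unfolding family_coeff_def by blast
  have *: "(\<Sum>j<Suc e. family_coeff i j * t ^ j) = poly (A i) t" for t
  proof -
    have "A i = (\<Sum>j<Suc e. Polynomial.monom (coeff (A i) j) j)"
      using A(2) by (intro poly_eqI) (simp add: coeff_sum_monom del: sum.lessThan_Suc)
    then have "poly (A i) t = poly (\<Sum>j<Suc e. Polynomial.monom (coeff (A i) j) j) t"
      by simp
    then show ?thesis
      unfolding A(1) poly_sum_monom by simp
  qed
  show "(\<Sum>j<Suc e. family_coeff i j * mpoly_const c ^ j) = coeff (\<Prod>k<n. [:- mpoly_var k, 1:]) i"
    unfolding * by (rule A(3))
  show "(\<Sum>j<Suc e. family_coeff i j * mpoly_const (\<gamma> l) ^ j)
      = coeff (\<Prod>k<n. [:- theta k (\<gamma> l), 1:]) i" if "l < e"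
    unfolding * by (rule A(4)[OF that])
qed

context
  fixes \<phi> :: "'a mpoly \<Rightarrow> 'b::idom"
  assumes \<phi>: "comm_ring_hom \<phi>"
begin

interpretation comm_ring_hom \<phi> by (rule \<phi>)

lemma family_poly_hom:
  assumes "\<And>i. i < n \<Longrightarrow> (\<Sum>j<Suc e. family_coeff i j * t ^ j) = coeff (\<Prod>k<n. [:- f k, 1:]) i"
  shows "family_poly n e (\<lambda>i j. \<phi> (family_coeff i j)) (\<phi> t) = (\<Prod>k<n. [:- \<phi> (f k), 1:])"
proof (rule poly_eqI)
  fix i
  let ?P = "\<Prod>k<n. [:- \<phi> (f k), 1:]"
  show "coeff (family_poly n e (\<lambda>i j. \<phi> (family_coeff i j)) (\<phi> t)) i = coeff ?P i"
  proof (cases "i < n")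
    case True
    then have "coeff (family_poly n e (\<lambda>i j. \<phi> (family_coeff i j)) (\<phi> t)) i
      = \<phi> (\<Sum>j<Suc e. family_coeff i j * t ^ j)"
      by (simp add: coeff_family_poly hom_sum hom_mult hom_power hom_add)
    also have "\<dots> = coeff (map_poly \<phi> (\<Prod>k<n. [:- f k, 1:])) i"
      unfolding assms[OF True] by simp
    finally show ?thesis
      unfolding map_poly_prod_linear[OF \<phi>] .
  next
    case False
    then show ?thesis
      using degree_prod_linear[of "\<lambda>k. \<phi> (f k)" n] monic_prod_linear[of "\<lambda>k. \<phi> (f k)" n]
      by (simp add: coeff_family_poly coeff_eq_0)
  qed
qed

lemma family_poly_at_c:
  "family_poly n e (\<lambda>i j. \<phi> (family_coeff i j)) (\<phi> (mpoly_const c)) = (\<Prod>k<n. [:- \<phi> (mpoly_var k), 1:])"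
  by (rule family_poly_hom) (rule family_coeff_sum(1))

lemma family_poly_at_\<gamma>:
  "l < e \<Longrightarrow> family_poly n e (\<lambda>i j. \<phi> (family_coeff i j)) (\<phi> (mpoly_const (\<gamma> l)))
     = (\<Prod>k<n. [:- \<phi> (theta k (\<gamma> l)), 1:])"
  by (rule family_poly_hom) (rule family_coeff_sum(2))

lemma hom_theta:
  "\<phi> (theta k g) = (\<Sum>i<n. (\<Sum>j<e. \<phi> (yvar i j) * \<phi> (mpoly_const g) ^ j) * \<phi> (mpoly_const (\<alpha> k)) ^ i)"
  unfolding theta_def by (simp add: hom_sum hom_mult hom_power)

end

text \<open>By interpolation on the grid the values \<open>theta k (\<gamma> l)\<close> can replace
  the \<open>y\<close> variables as free coordinates, next to the \<open>x\<close> variables and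
  \<open>w\<close>.\<close>

lemma point_exists:
  obtains a where "a \<in> affine_space (Suc N)" "\<And>k. k < n \<Longrightarrow> a k = x k" "a N = w"
    "\<And>k l. k < n \<Longrightarrow> l < e \<Longrightarrow> insertion a (theta k (\<gamma> l)) = t k l"
proof -
  have "is_subfield (UNIV :: 'a set)"
    by (simp add: is_subfield_def)
  then obtain y where y: "\<And>k l. k < n \<Longrightarrow> l < e \<Longrightarrow> (\<Sum>i<n. (\<Sum>j<e. y i j * \<gamma> l ^ j) * \<alpha> k ^ i) = t k l"
    using grid_interpolation[OF _ inj_\<alpha> inj_\<gamma>, of UNIV t] by auto
  define a where "a = (\<lambda>m. if m < n then x m else if m < N then y ((m - n) div e) ((m - n) mod e)
    else if m = N then w else 0)"
  have ay: "insertion a (yvar i j) = y i j" if "i < n" "j < e" for i j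
    using that index_less_N[OF that] unfolding yvar_def a_def by simp
  show thesis
  proof (rule that[of a])
    show "a \<in> affine_space (Suc N)"
      unfolding affine_space_def a_def N_def by auto
    show "a k = x k" if "k < n" for k
      using that unfolding a_def by simp
    show "a N = w"
      unfolding a_def N_def by auto
    show "insertion a (theta k (\<gamma> l)) = t k l" if "k < n" "l < e" for k l
      using y[OF that] unfolding hom_theta[OF comm_ring_hom_insertion] by (simp add: ay)
  qed
qed

text \<open>Split the prescribed family at \<open>c\<close> and at each \<open>\<gamma> l\<close>
  into linear factors, and take the roots as values of the \<open>x\<close> variables and of the
  \<open>theta k (\<gamma> l)\<close>. The two families then agree at \<open>Suc e\<close> points,
  which forces equal coefficients.\<close>

lemma family_surjective:
  obtains a where "a \<in> affine_space (Suc N)" "\<And>i j. i < n \<Longrightarrow> j \<le> e \<Longrightarrow> insertion a (family_coeff i j) = b i j"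
    "a N = w"
proof -
  have "\<exists>f. family_poly n e b g = (\<Prod>k<n. [:- f k, 1:])" for g
    using alg_closed_monic_split[OF monic_family_poly(2,1), of n e b g] by metis
  then obtain f where f: "\<And>g. family_poly n e b g = (\<Prod>k<n. [:- f g k, 1:])"
    by metis
  obtain a where a: "a \<in> affine_space (Suc N)" "\<And>k. k < n \<Longrightarrow> a k = f c k" "a N = w"
    "\<And>k l. k < n \<Longrightarrow> l < e \<Longrightarrow> insertion a (theta k (\<gamma> l)) = f (\<gamma> l) k"
    using point_exists[of "f c" w "\<lambda>k l. f (\<gamma> l) k"] by blast
  note hom = comm_ring_hom_insertion[of a]
  have c: "family_poly n e (\<lambda>i j. insertion a (family_coeff i j)) c = family_poly n e b c"
    using family_poly_at_c[OF hom] a(2) unfolding f by simp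
  have g: "family_poly n e (\<lambda>i j. insertion a (family_coeff i j)) (\<gamma> l) = family_poly n e b (\<gamma> l)" if "l < e" for l
    using family_poly_at_\<gamma>[OF hom that] a(4)[OF _ that] unfolding f by simp
  \<comment> \<open>All conjugates of \<open>c\<close> in one list; they are distinct because
    \<open>q1\<close> vanishes at the \<open>\<gamma> l\<close> and not at \<open>c\<close>.\<close>
  define \<delta> where "\<delta> = (\<lambda>l. if l < e then \<gamma> l else c)"
  have inj: "inj_on \<delta> {..<Suc e}"
    using inj_\<gamma> root_\<gamma> q1c unfolding \<delta>_def inj_on_def by (auto simp: less_Suc_eq)
  have "family_poly n e (\<lambda>i j. insertion a (family_coeff i j)) (\<delta> l) = family_poly n e b (\<delta> l)" for l
    using c g unfolding \<delta>_def by simp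
  from arg_cong[OF this, of "\<lambda>f. coeff f _"]
  have "(\<Sum>j<Suc e. insertion a (family_coeff i j) * \<delta> l ^ j) = (\<Sum>j<Suc e. b i j * \<delta> l ^ j)" if "i < n" for i l
    using that unfolding coeff_family_poly by meson
  then have "insertion a (family_coeff i j) = b i j" if "i < n" "j \<le> e" for i j
    using power_sums_eqD[OF inj, of "\<lambda>j. insertion a (family_coeff i j)" "b i" j] that by (simp del: sum.lessThan_Suc)
  then show thesis
    using that a(1,3) by blast
qed

text \<open>The Vandermonde product \<open>\<Delta>\<close>, a square root of the discriminant of
  \<open>U(c, X)\<close>.\<close>

definition discr :: "'a mpoly" where
  "discr = (\<Prod>k<n. \<Prod>l<k. mpoly_var k - mpoly_var l)"

lemma discr_in: "discr \<in> mpolys N K"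
  unfolding discr_def
  by (intro subring_prod[OF subring_mpolys_K] subring_diff[OF subring_mpolys_K] xvar_in) auto

lemma hom_discr:
  assumes "comm_ring_hom \<phi>"
  shows "\<phi> discr = (\<Prod>k<n. \<Prod>l<k. \<phi> (mpoly_var k) - \<phi> (mpoly_var l))"
proof -
  interpret comm_ring_hom \<phi> by (rule assms)
  show ?thesis
    unfolding discr_def by (simp add: hom_prod hom_minus)
qed

lemma discr_nonzero_iff: "insertion a discr \<noteq> 0 \<longleftrightarrow> inj_on a {..<n}"
proof -
  have "insertion a discr \<noteq> 0 \<longleftrightarrow> (\<forall>k<n. \<forall>l<k. a k \<noteq> a l)"
    unfolding hom_discr[OF comm_ring_hom_insertion] by auto
  also have "\<dots> \<longleftrightarrow> inj_on a {..<n}"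
  proof
    assume *: "\<forall>k<n. \<forall>l<k. a k \<noteq> a l"
    show "inj_on a {..<n}"
    proof (rule inj_onI)
      fix k l assume "k \<in> {..<n}" "l \<in> {..<n}" "a k = a l"
      then show "k = l"
        using *[rule_format, of k l] *[rule_format, of l k] by (cases k l rule: linorder_cases) auto
    qed
  next
    assume "inj_on a {..<n}"
    then show "\<forall>k<n. \<forall>l<k. a k \<noteq> a l"
      unfolding inj_on_def by fastforce
  qed
  finally show ?thesis .
qed

lemma discr_nonzero: "discr \<noteq> 0"
proof -
  obtain a where "\<And>k. k < n \<Longrightarrow> a k = \<alpha> k"
    using point_exists[of \<alpha> 0 "\<lambda>_ _. 0"] by metis
  then have "insertion a discr \<noteq> 0"
    using inj_\<alpha> unfolding discr_nonzero_iff inj_on_def by auto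
  then show ?thesis
    by (auto simp: insertion_def)
qed

text \<open>At a suitable point each \<open>theta k (\<gamma> l)\<close> takes the value
  \<open>\<alpha> k\<close>, and these values are distinct.\<close>

lemma theta_inj: "l < e \<Longrightarrow> inj_on (\<lambda>k. theta k (\<gamma> l)) {..<n}"
proof -
  assume l: "l < e"
  obtain a where a: "\<And>k l. k < n \<Longrightarrow> l < e \<Longrightarrow> insertion a (theta k (\<gamma> l)) = \<alpha> k"
    using point_exists[of \<alpha> 0 "\<lambda>k _. \<alpha> k"] by metis
  show ?thesis
  proof (rule inj_onI)
    fix k k' assume k: "k \<in> {..<n}" "k' \<in> {..<n}" and "theta k (\<gamma> l) = theta k' (\<gamma> l)"
    then have "\<alpha> k = \<alpha> k'"
      using a[OF _ l, of k] a[OF _ l, of k'] by simp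
    then show "k = k'"
      using inj_\<alpha> k unfolding inj_on_def by blast
  qed
qed

end

subsection \<open>The covering of affine space by the family\<close>

lemma insertion_cong:
  assumes "p \<in> mpolys m F" "\<And>i. i < m \<Longrightarrow> a i = b i"
  shows "insertion a p = insertion b p"
  unfolding insertion_def
proof (intro sum.cong refl arg_cong2[where f = "(*)"] prod.cong arg_cong2[where f = "(^)"])
  fix k i assume "k \<in> Poly_Mapping.keys p" "i \<in> Poly_Mapping.keys k"
  then show "a i = b i"
    using assms unfolding mpolys_def by blast
qed

lemma insertion_eval_mpoly_const:
  "insertion a (eval_mpoly mpoly_const f p) = insertion (\<lambda>i. insertion a (f i)) p"
proof -
  interpret comm_ring_hom "insertion a" by (rule comm_ring_hom_insertion)
  show ?thesis
    unfolding eval_mpoly_def eval_monom_def insertion_def[of "\<lambda>i. insertion a (f i)"]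
    by (simp add: hom_sum hom_mult hom_prod hom_power)
qed

lemma eval_mpoly_const_in:
  fixes f :: "nat \<Rightarrow> 'a::field mpoly"
  assumes "\<And>i. f i \<in> mpolys m UNIV"
  shows "eval_mpoly mpoly_const f p \<in> mpolys m UNIV"
  unfolding eval_mpoly_def eval_monom_def
  using subring_mpolys[OF subring_UNIV, of m] assms
  by (intro subring_sum subring_mult subring_prod subring_power mpolys_const) auto

lemma universal_insertion_in:
  assumes L: "is_subfield L" "to_universal ` K \<subseteq> L" "\<And>i. i < m \<Longrightarrow> x i \<in> L" and p: "p \<in> mpolys m K"
  shows "universal_insertion x p \<in> L"
  unfolding universal_insertion_eq_eval eval_mpoly_def eval_monom_def
proof (intro subring_sum subring_mult subring_prod subring_power is_subfield_imp_subring[OF L(1)])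
  fix k assume k: "k \<in> Poly_Mapping.keys p"
  then show "to_universal (Poly_Mapping.lookup p k) \<in> L"
    using p L(2) unfolding mpolys_def by blast
  show "x i \<in> L" if "i \<in> Poly_Mapping.keys k" for i
    using that k p L(3) unfolding mpolys_def by blast
qed

context twisted_family
begin

text \<open>Each quantity is a simple root of a polynomial over the separable closure
  \<open>T\<close> of \<open>F\<close>: the \<open>\<alpha> k\<close> of \<open>p\<close>, the
  \<open>\<gamma> l\<close> of \<open>q1\<close>, the \<open>x\<close> variables of
  \<open>U(c, X)\<close>, the \<open>theta k (\<gamma> l)\<close> of
  \<open>U(\<gamma> l, X)\<close>. The \<open>y\<close> variables are recovered from the latter by
  linear algebra, and \<open>w\<close> by subtracting \<open>1/\<Delta>\<close>.\<close>

lemma generic_coords_separable: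
  assumes F: "is_subfield F" and KF: "to_universal ` K \<subseteq> F"
    and coeffs: "\<And>i j. i < n \<Longrightarrow> j \<le> e \<Longrightarrow> universal_insertion generic_coords (family_coeff i j) \<in> F"
    and w: "generic_coords N + 1 / universal_insertion generic_coords discr \<in> F"
    and m: "m < Suc N"
  shows "generic_coords m \<in> separable_closure F"
proof -
  let ?\<phi> = "universal_insertion (generic_coords :: nat \<Rightarrow> 'a universal_domain)"
  define T where "T = separable_closure F"
  have T: "is_subfield T"
    unfolding T_def by (rule subfield_separable_closure[OF F])
  note RT = is_subfield_imp_subring[OF T]
  have FT: "F \<subseteq> T"
    unfolding T_def by (rule subset_separable_closure[OF F])
  note \<phi> = comm_ring_hom_universal_insertion[of "generic_coords :: nat \<Rightarrow> 'a universal_domain"]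
  interpret phi: comm_ring_hom ?\<phi> by (rule \<phi>)
  have inj: "r = s" if "?\<phi> r = ?\<phi> s" for r s
    using that universal_insertion_generic_eq_0_iff[of "r - s"] by (simp add: phi.hom_minus)
  interpret tu: comm_ring_hom "to_universal :: 'a \<Rightarrow> _" by (rule comm_ring_hom_to_universal)
  have root: "f k \<in> T" if "(\<Prod>k<r. [:- f k, 1:]) \<in> polys_over T" "inj_on f {..<r}" "k < r"
    for f and r k :: nat
    unfolding T_def
  proof (rule separable_root_in_closure[OF F])
    show "(\<Prod>k<r. [:- f k, 1:]) \<in> polys_over (separable_closure F)"
      using that(1) unfolding T_def .
    show "poly (\<Prod>k<r. [:- f k, 1:]) (f k) = 0"
      using that(3) by (auto simp: poly_prod intro!: prod_zero bexI[of _ k])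
    show "poly (pderiv (\<Prod>k<r. [:- f k, 1:])) (f k) \<noteq> 0"
      by (rule pderiv_prod_linear_nonzero[OF that(2,3)])
  qed
  have const: "to_universal (f k) \<in> T"
    if "q \<in> polys_over K" "lead_coeff q = 1" "degree q = r" "inj_on f {..<r}"
      "\<And>k. k < r \<Longrightarrow> poly q (f k) = 0" "k < r" for q f r k
  proof (rule root[where f = "\<lambda>k. to_universal (f k)"])
    have "(\<Prod>k<r. [:- to_universal (f k), 1:]) = map_poly to_universal q"
      using map_poly_prod_linear[OF comm_ring_hom_to_universal, of f r]
        monic_eq_prod_linear[OF that(2-5)] by simp
    also have "\<dots> \<in> polys_over T"
      using that(1) KF FT unfolding polys_over_def by auto
    finally show "(\<Prod>k<r. [:- to_universal (f k), 1:]) \<in> polys_over T" .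
    show "inj_on (\<lambda>k. to_universal (f k)) {..<r}"
      using that(4) injD[OF inj_to_universal] unfolding inj_on_def by blast
  qed (rule that(6))
  have \<alpha>T: "to_universal (\<alpha> k) \<in> T" if "k < n" for k
    by (rule const[OF p inj_\<alpha> root_\<alpha> that])
  have \<gamma>T: "to_universal (\<gamma> l) \<in> T" if "l < e" for l
    by (rule const[OF q1 inj_\<gamma> root_\<gamma> that])
  have coeffsT: "?\<phi> (family_coeff i j) \<in> T" if "i < n" "j \<le> e" for i j
    using coeffs[OF that] FT by blast
  have xT: "generic_coords k \<in> T" if "k < n" for k
  proof (rule root[where f = generic_coords, OF _ _ that])
    have "to_universal c \<in> T"
      using cK KF FT by blast
    then have "family_poly n e (\<lambda>i j. ?\<phi> (family_coeff i j)) (?\<phi> (mpoly_const c)) \<in> polys_over T"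
      using coeffsT by (intro family_poly_in_polys_over[OF RT]) auto
    then show "(\<Prod>k<n. [:- generic_coords k, 1:]) \<in> polys_over T"
      unfolding family_poly_at_c[OF \<phi>] by simp
    show "inj_on (generic_coords :: nat \<Rightarrow> 'a universal_domain) {..<n}"
    proof (rule inj_onI)
      fix k l assume kl: "k \<in> {..<n}" "l \<in> {..<n}"
        and "generic_coords k = (generic_coords l :: 'a universal_domain)"
      then have var: "mpoly_var k = (mpoly_var l :: 'a mpoly)"
        by (intro inj) simp
      obtain a where a: "\<And>k. k < n \<Longrightarrow> a k = \<alpha> k"
        using point_exists[of \<alpha> 0 "\<lambda>_ _. 0"] by metis
      have "\<alpha> k = \<alpha> l"
        using arg_cong[OF var, of "insertion a"] a kl by simp
      then show "k = l"
        using inj_\<alpha> kl unfolding inj_on_def by blast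
    qed
  qed
  have \<theta>T: "?\<phi> (theta k (\<gamma> l)) \<in> T" if "k < n" "l < e" for k l
  proof (rule root[where f = "\<lambda>k. ?\<phi> (theta k (\<gamma> l))", OF _ _ that(1)])
    have "family_poly n e (\<lambda>i j. ?\<phi> (family_coeff i j)) (?\<phi> (mpoly_const (\<gamma> l))) \<in> polys_over T"
      using coeffsT \<gamma>T[OF that(2)] by (intro family_poly_in_polys_over[OF RT]) auto
    then show "(\<Prod>k<n. [:- ?\<phi> (theta k (\<gamma> l)), 1:]) \<in> polys_over T"
      unfolding family_poly_at_\<gamma>[OF \<phi> that(2)] .
    show "inj_on (\<lambda>k. ?\<phi> (theta k (\<gamma> l))) {..<n}"
      using theta_inj[OF that(2)] inj unfolding inj_on_def by blast
  qed
  have yT: "?\<phi> (yvar i j) \<in> T" if ij: "i < n" "j < e" for i j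
  proof -
    have inj': "inj_on (\<lambda>k. to_universal (\<alpha> k)) {..<n}" "inj_on (\<lambda>l. to_universal (\<gamma> l)) {..<e}"
      using inj_\<alpha> inj_\<gamma> injD[OF inj_to_universal] unfolding inj_on_def by blast+
    \<comment> \<open>The linear system linking the \<open>y\<close> variables to the
      \<open>theta k (\<gamma> l)\<close> has a solution in \<open>T\<close>; by uniqueness it is
      the given one.\<close>
    obtain y where y: "\<And>i j. i < n \<Longrightarrow> y i j \<in> T"
      "\<And>k l. k < n \<Longrightarrow> l < e \<Longrightarrow>
        (\<Sum>i<n. (\<Sum>j<e. y i j * to_universal (\<gamma> l) ^ j) * to_universal (\<alpha> k) ^ i) = ?\<phi> (theta k (\<gamma> l))"
      by (rule grid_interpolation[OF T inj' \<alpha>T \<gamma>T \<theta>T]) auto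
    have "?\<phi> (yvar i j) = y i j"
    proof (rule grid_sums_eqD[OF inj' _ ij])
      fix k l assume kl: "k < n" "l < e"
      show "(\<Sum>i<n. (\<Sum>j<e. ?\<phi> (yvar i j) * to_universal (\<gamma> l) ^ j) * to_universal (\<alpha> k) ^ i)
        = (\<Sum>i<n. (\<Sum>j<e. y i j * to_universal (\<gamma> l) ^ j) * to_universal (\<alpha> k) ^ i)"
        unfolding y(2)[OF kl] hom_theta[OF \<phi>] by simp
    qed
    then show ?thesis
      using y(1)[OF ij(1)] by simp
  qed
  consider "m < n" | i j where "i < n" "j < e" "m = n + i * e + j" | "m = N"
  proof -
    have "\<exists>i j. i < n \<and> j < e \<and> m = n + i * e + j" if "\<not> m < n" "m \<noteq> N"
    proof (intro exI conjI)
      have lt: "m - n < n * e"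
        using that m unfolding N_def by linarith
      then have "e > 0"
        by (cases e) auto
      then show "(m - n) div e < n" "(m - n) mod e < e"
        using lt by (auto simp: less_mult_imp_div_less)
      show "m = n + (m - n) div e * e + (m - n) mod e"
        using that(1) by simp
    qed
    then show thesis
      using that by blast
  qed
  then have "generic_coords m \<in> T"
  proof cases
    case 1
    then show ?thesis
      by (rule xT)
  next
    case (2 i j)
    then show ?thesis
      using yT[OF 2(1,2)] unfolding yvar_def by simp
  next
    case 3
    have "?\<phi> discr \<in> T"
      unfolding hom_discr[OF \<phi>] universal_insertion_var
      by (intro subring_prod[OF RT] subring_diff[OF RT] xT) auto
    then have "1 / ?\<phi> discr \<in> T"
      by (intro subfield_divide[OF T] subring_1[OF RT])
    then have "(generic_coords N + 1 / ?\<phi> discr) - 1 / ?\<phi> discr \<in> T"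
      using w FT by (intro subring_diff[OF RT]) auto
    then show ?thesis
      using 3 by simp
  qed
  then show ?thesis
    unfolding T_def .
qed

text \<open>The target coordinate \<open>i * Suc e + j\<close> is the coefficient of
  \<open>X^i T^j\<close>, and coordinate \<open>N\<close> is \<open>w + 1/\<Delta>\<close> as a
  single fraction. Indices above \<open>N\<close> lie outside the target space and get the constant
  0.\<close>

definition cover :: "'a rational_map" where
  "cover t = (if t < N then (family_coeff (t div Suc e) (t mod Suc e), 1)
     else if t = N then (mpoly_var N * discr + 1, discr) else (0, 1))"

lemma N_eq: "N = n * Suc e"
  unfolding N_def by simp

lemma index_div: "t < N \<Longrightarrow> t div Suc e < n"
  unfolding N_eq by (rule less_mult_imp_div_less)

lemma index_pair: "i < n \<Longrightarrow> j \<le> e \<Longrightarrow> i * Suc e + j < N"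
proof -
  assume "i < n" "j \<le> e"
  then have "i * Suc e + j < Suc i * Suc e" "Suc i * Suc e \<le> n * Suc e"
    by (simp, intro mult_le_mono1) simp_all
  then show ?thesis
    unfolding N_eq by linarith
qed

lemma cover_pair: "i < n \<Longrightarrow> j \<le> e \<Longrightarrow> cover (i * Suc e + j) = (family_coeff i j, 1)"
proof -
  assume ij: "i < n" "j \<le> e"
  then have "(i * Suc e + j) div Suc e = i" "(i * Suc e + j) mod Suc e = j"
    by (auto simp del: mult_Suc_right)
  then show ?thesis
    using index_pair[OF ij] unfolding cover_def by simp
qed

lemma cover_in: "fst (cover t) \<in> mpolys (Suc N) K" "snd (cover t) \<in> mpolys (Suc N) K"
proof -
  note R = subring_mpolys_K[of "Suc N"]
  have "1 \<in> K"
    using K by (simp add: is_subfield_def)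
  then have "mpoly_var N * discr + 1 \<in> mpolys (Suc N) K"
    using discr_in mpolys_Suc
    by (intro subring_add[OF R] subring_mult[OF R] subring_1[OF R] mpolys_var) auto
  then show "fst (cover t) \<in> mpolys (Suc N) K" "snd (cover t) \<in> mpolys (Suc N) K"
    unfolding cover_def
    using subsetD[OF mpolys_Suc family_coeff_in[OF index_div]] subsetD[OF mpolys_Suc discr_in] subring_1[OF R]
    by auto
qed

lemma is_rational_map_cover: "is_rational_map K (Suc N) (affine_space (Suc N)) (Suc N) cover"
proof -
  have "snd (cover t) \<noteq> 0" for t
    unfolding cover_def using discr_nonzero by auto
  then show ?thesis
    unfolding is_rational_map_def vanishing_ideal_affine_space using cover_in by auto
qed

lemma separable_map_cover: "separable_map K (Suc N) (affine_space (Suc N)) (Suc N) cover"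
proof -
  let ?x = "generic_coords :: nat \<Rightarrow> 'a universal_domain"
  let ?\<phi> = "universal_insertion ?x"
  interpret phi: comm_ring_hom ?\<phi> by (rule comm_ring_hom_universal_insertion)
  define v where "v = (\<lambda>i. ?\<phi> (fst (cover i)) / ?\<phi> (snd (cover i)))"
  define F where "F = generated_field (to_universal ` K \<union> v ` {..<Suc N})"
  define L where "L = function_field K (Suc N) ?x"
  have F: "is_subfield F"
    unfolding F_def by (rule subfield_generated_field)
  have L: "is_subfield L"
    unfolding L_def function_field_def by (rule subfield_generated_field)
  have vF: "v t \<in> F" if "t < Suc N" for t
    using subset_generated_field[of "to_universal ` K \<union> v ` {..<Suc N}"] that unfolding F_def by auto
  have KF: "to_universal ` K \<subseteq> F"
    using subset_generated_field[of "to_universal ` K \<union> v ` {..<Suc N}"] unfolding F_def by auto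
  have subL: "to_universal ` K \<subseteq> L" "\<And>i. i < Suc N \<Longrightarrow> ?x i \<in> L"
    using subset_generated_field[of "to_universal ` K \<union> ?x ` {..<Suc N}"]
    unfolding L_def function_field_def by auto
  have "v t \<in> L" for t
    unfolding v_def using universal_insertion_in[OF L subL] cover_in by (intro subfield_divide[OF L]) auto
  then have FL: "F \<subseteq> L"
    unfolding F_def using subL(1) by (intro generated_field_minimal[OF L]) auto
  have "?x m \<in> separable_closure F" if "m < Suc N" for m
  proof (rule generic_coords_separable[OF F KF _ _ that])
    show "?\<phi> (family_coeff i j) \<in> F" if "i < n" "j \<le> e" for i j
      using vF[of "i * Suc e + j"] index_pair[OF that] unfolding v_def cover_pair[OF that]
      by (simp add: phi.hom_one)
    have "?\<phi> discr \<noteq> 0"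
      using discr_nonzero universal_insertion_generic_eq_0_iff by blast
    then have "v N = ?x N + 1 / ?\<phi> discr"
      unfolding v_def cover_def by (simp add: phi.hom_add phi.hom_mult phi.hom_one add_divide_distrib)
    then show "?x N + 1 / ?\<phi> discr \<in> F"
      using vF[of N] by simp
  qed
  then have "L \<subseteq> separable_closure F"
    unfolding L_def function_field_def using KF subset_separable_closure[OF F]
    by (intro generated_field_minimal[OF subfield_separable_closure[OF F]]) auto
  then have "\<forall>y\<in>L. separable_element F y"
    unfolding separable_closure_def by auto
  then have "separable_algebraic_extension F L"
    unfolding separable_algebraic_extension_def algebraic_extension_def field_extension_def
    using F L FL separable_imp_algebraic by auto
  then show ?thesis
    unfolding separable_map_def F_def L_def v_def
    by (intro exI[of _ ?x] conjI generic_point_affine_space)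
qed

text \<open>A polynomial \<open>f\<close> vanishing on the image is pulled back along a polynomial
  map \<open>P\<close>. The pullback vanishes wherever \<open>\<Delta>\<close> does not, so its
  product with \<open>\<Delta>\<close> is zero and hence the pullback itself is. As \<open>P\<close>
  is surjective, \<open>f\<close> vanishes everywhere.\<close>

lemma dominating_cover: "dominating (Suc N) (affine_space (Suc N)) (Suc N) cover"
  unfolding dominating_def
proof (intro allI impI, elim conjE)
  let ?A = "affine_space (Suc N) :: (nat \<Rightarrow> 'a) set"
  fix W :: "(nat \<Rightarrow> 'a) set"
  assume W: "algebraic_set (Suc N) W"
    and image: "{b. \<exists>a\<in>?A. maps_to (Suc N) ?A (Suc N) cover a b} \<subseteq> W"
  obtain S where S: "S \<subseteq> mpolys (Suc N) UNIV" "W = zero_locus (Suc N) S"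
    using W unfolding algebraic_set_def by blast
  \<comment> \<open>\<open>P\<close> is \<open>cover\<close> with the pole removed: its last
    coordinate is \<open>w\<close> alone.\<close>
  define P where "P = (\<lambda>t. if t < N then family_coeff (t div Suc e) (t mod Suc e)
    else if t = N then mpoly_var N else 0)"
  note RU = subring_mpolys[OF subring_UNIV, of "Suc N"]
  have KU: "mpolys m K \<subseteq> mpolys m UNIV" for m
    by (rule mpolys_mono) simp
  have P_in: "P t \<in> mpolys (Suc N) UNIV" for t
    unfolding P_def using subsetD[OF KU subsetD[OF mpolys_Suc family_coeff_in[OF index_div]]]
    by (auto intro: mpolys_var)
  have discr_in': "discr \<in> mpolys (Suc N) UNIV"
    using discr_in mpolys_Suc KU by blast
  have in_W: "(\<lambda>t. insertion a (P t)) \<in> W" if a: "a \<in> ?A" and nz: "insertion a discr \<noteq> 0" for a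
  proof -
    \<comment> \<open>Shifting \<open>w\<close> cancels the summand \<open>1/\<Delta>\<close>, so
      \<open>cover\<close> at \<open>a'\<close> takes the value of \<open>P\<close> at
      \<open>a\<close>. The coefficients and \<open>discr\<close> do not involve \<open>w\<close>
      and keep their values.\<close>
    define a' where "a' = a(N := a N - 1 / insertion a discr)"
    have same: "insertion a' r = insertion a r" if "r \<in> mpolys N K" for r
      by (rule insertion_cong[OF that]) (simp add: a'_def)
    have "a' \<in> ?A"
      using a unfolding affine_space_def a'_def by auto
    moreover have "maps_to (Suc N) ?A (Suc N) cover a' (\<lambda>t. insertion a (P t))"
      unfolding maps_to_def
    proof (intro conjI allI impI)
      show "(\<lambda>t. insertion a (P t)) \<in> ?A"
        unfolding affine_space_def P_def by (auto simp: insertion_def)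
      fix t assume t: "t < Suc N"
      interpret a: comm_ring_hom "insertion a'" by (rule comm_ring_hom_insertion)
      have d: "insertion a' discr = insertion a discr"
        by (rule same[OF discr_in])
      have snd: "insertion a' (snd (cover t)) \<noteq> 0"
        unfolding cover_def using d nz by (auto simp: a.hom_one)
      have "insertion a (P t) = insertion a' (fst (cover t)) / insertion a' (snd (cover t))"
      proof (cases "t < N")
        case True
        then show ?thesis
          unfolding P_def cover_def using same[OF family_coeff_in[OF index_div]] by (simp add: a.hom_one)
      next
        case False
        then have "t = N"
          using t by simp
        moreover have "insertion a (mpoly_var N) = insertion a' (mpoly_var N * discr + 1) / insertion a' discr"
        proof -
          have "insertion a' (mpoly_var N) = a N - 1 / insertion a discr"
            by (simp add: a'_def)
          then show ?thesis
            unfolding a.hom_add a.hom_mult a.hom_one d using nz by (simp add: field_simps)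
        qed
        ultimately show ?thesis
          unfolding P_def cover_def by simp
      qed
      then show "has_value_at (Suc N) ?A (cover t) a' (insertion a (P t))"
        unfolding has_value_at_affine_space using cover_in KU snd
        by (intro bexI[of _ "fst (cover t)"] bexI[of _ "snd (cover t)"]) auto
    qed
    ultimately show ?thesis
      using image by blast
  qed
  have "insertion b f = 0" if f: "f \<in> S" and b: "b \<in> ?A" for f b
  proof -
    define g where "g = eval_mpoly mpoly_const P f"
    have g_in: "g \<in> mpolys (Suc N) UNIV"
      unfolding g_def by (rule eval_mpoly_const_in[OF P_in])
    have "insertion a (g * discr) = 0" if "a \<in> ?A" for a
    proof (cases "insertion a discr = 0")
      case True
      then show ?thesis
        by (simp add: eval_mpoly_mult[OF comm_ring_hom_id] insertion_eq_eval)
    next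
      case False
      then have "insertion a g = 0"
        using in_W[OF that False] f unfolding S(2) zero_locus_def g_def insertion_eval_mpoly_const by blast
      then show ?thesis
        by (simp add: eval_mpoly_mult[OF comm_ring_hom_id] insertion_eq_eval)
    qed
    moreover have "g * discr \<in> mpolys (Suc N) UNIV"
      by (intro subring_mult[OF RU] g_in discr_in')
    ultimately have "g * discr = 0"
      using mpoly_nonvanishing by metis
    then have "g = 0"
      using discr_nonzero by simp
    obtain a where a: "a \<in> ?A" "\<And>i j. i < n \<Longrightarrow> j \<le> e \<Longrightarrow> insertion a (family_coeff i j) = b (i * Suc e + j)"
      "a N = b N"
      using family_surjective[of "\<lambda>i j. b (i * Suc e + j)" "b N"] by blast
    have "insertion a (P t) = b t" for t
    proof (cases "t < N")
      case True
      then show ?thesis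
        using a(2)[OF index_div[OF True], of "t mod Suc e"] mod_less_divisor[of "Suc e" t]
          div_mult_mod_eq[of t "Suc e"]
        unfolding P_def by (simp add: less_Suc_eq_le del: mult_Suc_right)
    next
      case False
      then show ?thesis
        using a(3) b unfolding P_def affine_space_def by (auto simp: insertion_def[of _ 0])
    qed
    then have "insertion a g = insertion b f"
      unfolding g_def insertion_eval_mpoly_const by simp
    then show ?thesis
      using \<open>g = 0\<close> by (simp add: insertion_def)
  qed
  then show "W = ?A"
    unfolding S(2) zero_locus_def by auto
qed

lemma PAC_point:
  assumes "PAC_extension K0 K"
  obtains a where "\<And>m. m < Suc N \<Longrightarrow> a m \<in> K" "\<And>i j. i < n \<Longrightarrow> j \<le> e \<Longrightarrow> insertion a (family_coeff i j) \<in> K0"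
    "inj_on a {..<n}"
proof -
  let ?A = "affine_space (Suc N) :: (nat \<Rightarrow> 'a) set"
  have "\<exists>a\<in>?A. \<exists>b. (\<forall>i<Suc N. a i \<in> K) \<and> maps_to (Suc N) ?A (Suc N) cover a b \<and> (\<forall>i<Suc N. b i \<in> K0)"
    using assms abs_irreducible_affine_space[of K "Suc N"] has_dimension_affine_space[of K "Suc N"]
      is_rational_map_cover dominating_cover separable_map_cover
    unfolding PAC_extension_def by (metis One_nat_def Suc_le_mono zero_le)
  then obtain a b where a: "\<And>i. i < Suc N \<Longrightarrow> a i \<in> K" and ab: "maps_to (Suc N) ?A (Suc N) cover a b"
    and b: "\<And>i. i < Suc N \<Longrightarrow> b i \<in> K0"
    by blast
  interpret ia: comm_ring_hom "insertion a" by (rule comm_ring_hom_insertion)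
  have val: "\<exists>g h. fst (cover t) * h = g * snd (cover t) \<and> insertion a h \<noteq> 0 \<and> b t = insertion a g / insertion a h"
    if "t < Suc N" for t
    using ab that unfolding maps_to_def has_value_at_affine_space by blast
  have "insertion a (family_coeff i j) \<in> K0" if ij: "i < n" "j \<le> e" for i j
  proof -
    have t: "i * Suc e + j < Suc N"
      using index_pair[OF ij] by linarith
    obtain g h where gh: "family_coeff i j * h = g" "insertion a h \<noteq> 0"
      "b (i * Suc e + j) = insertion a g / insertion a h"
      using val[OF t] unfolding cover_pair[OF ij] by auto
    have "b (i * Suc e + j) = insertion a (family_coeff i j)"
      using gh(2) unfolding gh(3) gh(1)[symmetric] ia.hom_mult by simp
    then show ?thesis
      using b[OF t] by simp
  qed
  \<comment> \<open>Whatever fraction \<open>g / h\<close> represents the last coordinate,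
    \<open>(w \<Delta> + 1) h = g \<Delta>\<close>. At a zero of \<open>\<Delta>\<close> this makes
    \<open>h\<close> vanish, so the map has no value there.\<close>
  moreover have "insertion a discr \<noteq> 0"
  proof
    assume zero: "insertion a discr = 0"
    obtain g h where gh: "(mpoly_var N * discr + 1) * h = g * discr" "insertion a h \<noteq> 0"
      using val[of N] unfolding cover_def by auto
    show False
      using arg_cong[OF gh(1), of "insertion a"] gh(2) zero by (simp add: ia.hom_mult ia.hom_add ia.hom_one)
  qed
  ultimately show thesis
    using that a unfolding discr_nonzero_iff by blast
qed

end

subsection \<open>Specialisation at conjugates\<close>

lemma rsquarefree_prod_linear_inj:
  fixes f :: "nat \<Rightarrow> 'a::field"
  assumes "rsquarefree (\<Prod>k<n. [:- f k, 1:])"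
  shows "inj_on f {..<n}"
proof (rule inj_onI, rule ccontr)
  fix k l assume kl: "k \<in> {..<n}" "l \<in> {..<n}" "f k = f l" "k \<noteq> l"
  let ?P = "\<Prod>k<n. [:- f k, 1:]"
  have "poly ?P (f k) = 0"
    using kl(1) by (auto simp: poly_prod intro!: prod_zero bexI[of _ k])
  then have "poly (pderiv ?P) (f k) \<noteq> 0"
    using assms rsquarefree_iff_pderiv[of ?P] unfolding rsquarefree_def by blast
  moreover have "(\<Prod>l\<in>{..<n} - {k}. f k - f l) = 0"
    using kl by (intro prod_zero) auto
  ultimately show False
    using kl(1) poly_pderiv_prod_linear[of k n f] by simp
qed

lemma rsquarefree_monic_split:
  fixes p :: "'a::alg_closed_field poly"
  assumes "rsquarefree p" "lead_coeff p = 1" "degree p = n"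
  obtains f where "p = (\<Prod>k<n. [:- f k, 1:])" "inj_on f {..<n}"
  using alg_closed_monic_split[OF assms(2,3)] assms(1) rsquarefree_prod_linear_inj by metis

text \<open>\<open>M\<close> is the product of the distinct minimal polynomials of the elements of
  \<open>B\<close>. Taking them as a set counts conjugate elements once; different minimal
  polynomials share no root, so the product of these separable polynomials is squarefree. Normality
  puts its roots into \<open>N\<close>.\<close>

lemma separable_common_multiple:
  assumes F: "is_subfield F" and N: "galois_extension F N" and B: "finite B" "B \<subseteq> N"
  obtains M where "M \<in> polys_over F" "rsquarefree M" "\<And>x. x \<in> B \<Longrightarrow> poly M x = 0"
    "\<And>y. poly M y = 0 \<Longrightarrow> y \<in> N"
proof -
  have sep: "separable_element F x" "algebraic_element F x" if "x \<in> N" for x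
    using N that unfolding galois_extension_def separable_algebraic_extension_def algebraic_extension_def
    by auto
  define D where "D = {m. \<exists>x\<in>B. is_min_poly F x m}"
  have "\<exists>m. is_min_poly F x m" if "x \<in> B" for x
    using min_poly_exists[OF F sep(2)] B(2) that by blast
  then obtain \<mu> where \<mu>: "\<And>x. x \<in> B \<Longrightarrow> is_min_poly F x (\<mu> x)"
    by metis
  have "D \<subseteq> \<mu> ` B"
    using \<mu> min_poly_unique[OF F] unfolding D_def by blast
  then have fin: "finite D"
    using B(1) finite_subset by blast
  have D: "is_min_poly F x m" "m \<in> polys_over F" "rsquarefree m" if m: "m \<in> D" "poly m x = 0" for m x
  proof -
    obtain y where y: "y \<in> B" "is_min_poly F y m"
      using m unfolding D_def by blast
    show "is_min_poly F x m"
      by (rule min_poly_conjugate[OF F y(2) m(2)])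
    show "m \<in> polys_over F"
      using y(2) unfolding is_min_poly_iff[OF F] by blast
    show "rsquarefree m"
      using separable_min_poly_rsquarefree[OF F sep(1) y(2)] y(1) B(2) by blast
  qed
  have rootD: "\<exists>x\<in>B. poly m x = 0" if "m \<in> D" for m
    using that unfolding D_def is_min_poly_def by blast
  define M where "M = \<Prod>D"
  note R = subring_polys_over[OF is_subfield_imp_subring[OF F]]
  have MF: "M \<in> polys_over F"
    unfolding M_def using D(2) rootD by (intro subring_prod[OF R]) blast
  have nz: "M \<noteq> 0"
  proof -
    have "0 \<notin> D"
      using D(3)[of 0] rootD[of 0] by (auto simp: rsquarefree_def)
    then show ?thesis
      unfolding M_def using fin by simp
  qed
  have root: "\<exists>m\<in>D. poly m y = 0" if "poly M y = 0" for y
    using that fin unfolding M_def poly_prod by auto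
  have "poly (pderiv M) y \<noteq> 0" if y: "poly M y = 0" for y
  proof -
    obtain m where m: "m \<in> D" "poly m y = 0"
      using root[OF y] by blast
    have "M = m * \<Prod>(D - {m})"
      unfolding M_def using fin m(1) by (rule prod.remove)
    then have "poly (pderiv M) y = poly (\<Prod>(D - {m})) y * poly (pderiv m) y"
      using m(2) by (simp add: pderiv_mult)
    moreover have "poly (pderiv m) y \<noteq> 0"
      using D(3)[OF m] m(2) rsquarefree_iff_pderiv[of m] unfolding rsquarefree_def by blast
    moreover have "poly (\<Prod>(D - {m})) y \<noteq> 0"
    proof
      assume "poly (\<Prod>(D - {m})) y = 0"
      then obtain m' where "m' \<in> D" "m' \<noteq> m" "poly m' y = 0"
        using fin unfolding poly_prod by auto
      then show False
        using min_poly_unique[OF F D(1)[OF m] D(1)[of m' y]] by blast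
    qed
    ultimately show ?thesis
      by simp
  qed
  then have "rsquarefree M"
    using rsquarefree_iff_pderiv[OF nz] by blast
  moreover have "poly M x = 0" if "x \<in> B" for x
  proof -
    have "\<mu> x \<in> D" "poly (\<mu> x) x = 0"
      using \<mu>[OF that] that unfolding D_def is_min_poly_def by auto
    then show ?thesis
      unfolding M_def poly_prod using fin by auto
  qed
  moreover have "y \<in> N" if y: "poly M y = 0" for y
  proof -
    obtain m where m: "m \<in> D" "poly m y = 0"
      using root[OF y] by blast
    then obtain x where "x \<in> B" "is_min_poly F x m"
      unfolding D_def by blast
    then show ?thesis
      using N B(2) m(2) unfolding galois_extension_def normal_extension_def by blast
  qed
  ultimately show thesis
    using that MF by blast
qed

text \<open>Divisibility by the monic \<open>family_poly n e b t\<close> is a polynomial condition on \<open>t\<close> over \<open>F\<close>.\<close>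

lemma family_poly_dvd_conjugate:
  fixes F :: "'a::field set"
  assumes F: "is_subfield F" and q: "is_min_poly F c q" "poly q c' = 0"
    and b: "\<And>i j. i < n \<Longrightarrow> j \<le> e \<Longrightarrow> b i j \<in> F" and M: "M \<in> polys_over F"
    and x: "inj_on x {..<n}" "\<And>k. k < n \<Longrightarrow> poly (family_poly n e b c) (x k) = 0"
      "\<And>k. k < n \<Longrightarrow> poly M (x k) = 0"
  obtains h where "M = h * family_poly n e b c'"
proof -
  note RF = is_subfield_imp_subring[OF F]
  note R1 = subring_polys_over[OF RF]
  define U where "U = family_poly n e (\<lambda>i j. [:b i j:]) [:0, 1:]"
  define M' where "M' = map_poly (\<lambda>a. [:a:]) M"
  have "U \<in> polys_over (polys_over F)"
    unfolding U_def using b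
    by (intro family_poly_in_polys_over[OF R1] const_in_polys_over[OF RF] pCons_in_polys_over[OF RF]
        subring_0[OF RF] subring_1[OF RF]) auto
  moreover have "lead_coeff U = 1"
    unfolding U_def by (rule monic_family_poly)
  moreover have "M' \<in> polys_over (polys_over F)"
    using M const_in_polys_over[OF RF] unfolding M'_def polys_over_def by (auto simp: coeff_map_poly)
  ultimately obtain H R where HR: "H \<in> polys_over (polys_over F)" "R \<in> polys_over (polys_over F)"
    "M' = H * U + R" "R = 0 \<or> degree R < degree U"
    using monic_division[OF R1] by metis
  have eval: "M = map_poly (\<lambda>f. poly f t) H * family_poly n e b t + map_poly (\<lambda>f. poly f t) R" for t
  proof -
    have hom: "comm_ring_hom (\<lambda>f::'a poly. poly f t)"
      by unfold_locales auto
    interpret comm_ring_hom "\<lambda>f::'a poly. poly f t" by (rule hom)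
    interpret mp: map_poly_comm_ring_hom "\<lambda>f::'a poly. poly f t" ..
    have "map_poly (\<lambda>f. poly f t) M' = M"
      unfolding M'_def by (intro poly_eqI) (simp add: coeff_map_poly)
    moreover have "map_poly (\<lambda>f. poly f t) U = family_poly n e b t"
      unfolding U_def by (intro poly_eqI) (simp add: coeff_map_poly coeff_family_poly poly_sum del: sum.lessThan_Suc)
    ultimately show ?thesis
      using arg_cong[OF HR(3), of "map_poly (\<lambda>f. poly f t)"] by (simp add: mp.hom_add mp.hom_mult)
  qed
  \<comment> \<open>At \<open>c\<close> the remainder has degree below \<open>n\<close> and the
    \<open>n\<close> distinct roots \<open>x k\<close>. Its coefficients are therefore polynomials
    over \<open>F\<close> vanishing at \<open>c\<close>, hence multiples of \<open>q\<close>, and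
    vanish at \<open>c'\<close> as well.\<close>
  have "map_poly (\<lambda>f. poly f c) R = 0"
  proof (rule poly_eqI_on_points[OF _ _ x(1)])
    show "coeff (map_poly (\<lambda>f. poly f c) R) i = 0" if "i \<ge> n" for i
      using HR(4) that monic_family_poly(1)[of n e "\<lambda>i j. [:b i j:]" "[:0, 1:]"] unfolding U_def
      by (auto simp: coeff_map_poly coeff_eq_0)
    show "poly (map_poly (\<lambda>f. poly f c) R) (x k) = poly 0 (x k)" if "k < n" for k
      using arg_cong[OF eval[of c], of "\<lambda>f. poly f (x k)"] x(2,3)[OF that] by simp
  qed simp
  then have Rc: "poly (coeff R i) c = 0" for i
    by (metis (no_types, lifting) coeff_0 coeff_map_poly poly_0)
  have "poly (coeff R i) c' = 0" for i
  proof -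
    have "coeff R i \<in> polys_over F"
      using HR(2) unfolding polys_over_def by blast
    then obtain h where "coeff R i = h * q"
      using min_poly_dvd[OF F q(1) _ Rc] by metis
    then show ?thesis
      using q(2) by simp
  qed
  then have "map_poly (\<lambda>f. poly f c') R = 0"
    by (intro poly_eqI) (simp add: coeff_map_poly)
  then show thesis
    using that[of "map_poly (\<lambda>f. poly f c') H"] eval[of c'] by simp
qed

text \<open>The root \<open>\<alpha> k\<close> is the only common root of \<open>p\<close> and \<open>g - g (\<alpha> k)\<close>, so its minimal polynomial over \<open>N\<close>
  is linear.\<close>

lemma root_in_subfield:
  fixes N :: "'a::alg_closed_field set" and \<alpha> :: "nat \<Rightarrow> 'a"
  assumes N: "is_subfield N" and p: "(\<Prod>k<n. [:- \<alpha> k, 1:]) \<in> polys_over N" and inj: "inj_on \<alpha> {..<n}"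
    and g: "g \<in> polys_over N" "\<And>k. k < n \<Longrightarrow> poly g (\<alpha> k) \<in> N" "inj_on (\<lambda>k. poly g (\<alpha> k)) {..<n}"
    and k: "k < n"
  shows "\<alpha> k \<in> N"
proof -
  note RN = is_subfield_imp_subring[OF N]
  let ?p = "\<Prod>k<n. [:- \<alpha> k, 1:]"
  have root: "poly ?p y = 0 \<longleftrightarrow> (\<exists>l<n. y = \<alpha> l)" for y
    by (auto simp: poly_prod)
  have "poly (pderiv ?p) (\<alpha> k) \<noteq> 0" "poly ?p (\<alpha> k) = 0"
    using pderiv_prod_linear_nonzero[OF inj k] root k by blast+
  then have "separable_element N (\<alpha> k)"
    unfolding separable_element_iff[OF N] using p by blast
  then obtain m where m: "is_min_poly N (\<alpha> k) m" "rsquarefree m"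
    unfolding separable_element_def by blast
  have m': "lead_coeff m = 1" "m \<in> polys_over N"
    using m(1) unfolding is_min_poly_iff[OF N] by auto
  obtain h where h: "?p = h * m"
    using min_poly_dvd[OF N m(1) p \<open>poly ?p (\<alpha> k) = 0\<close>] by metis
  have "g - [:poly g (\<alpha> k):] \<in> polys_over N"
    using g k by (intro subring_diff[OF subring_polys_over[OF RN]] const_in_polys_over[OF RN]) auto
  moreover have "poly (g - [:poly g (\<alpha> k):]) (\<alpha> k) = 0"
    by simp
  ultimately obtain h' where h': "g - [:poly g (\<alpha> k):] = h' * m"
    using min_poly_dvd[OF N m(1)] by metis
  have only: "y = \<alpha> k" if y: "poly m y = 0" for y
  proof -
    have "poly ?p y = 0"
      unfolding h using y by simp
    then obtain l where l: "l < n" "y = \<alpha> l"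
      using root by blast
    have "poly g y = poly g (\<alpha> k)"
      using arg_cong[OF h', of "\<lambda>f. poly f y"] y by simp
    then have "l = k"
      using g(3) l k unfolding inj_on_def by blast
    then show ?thesis
      using l by simp
  qed
  obtain f where f: "m = (\<Prod>l<degree m. [:- f l, 1:])" "inj_on f {..<degree m}"
    using rsquarefree_monic_split[OF m(2) m'(1) refl] by blast
  have fl: "f l = \<alpha> k" if "l < degree m" for l
  proof (rule only)
    show "poly m (f l) = 0"
      using that by (subst f(1)) (auto simp: poly_prod)
  qed
  have "degree m > 0"
    by (rule is_min_poly_degree_pos[OF N m(1)])
  moreover have "degree m \<le> 1"
  proof (rule ccontr)
    assume "\<not> degree m \<le> 1"
    then have "f 0 = f 1" "0 \<in> {..<degree m}" "1 \<in> {..<degree m}"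
      using fl[of 0] fl[of 1] by auto
    then show False
      using f(2) unfolding inj_on_def by fastforce
  qed
  ultimately have "degree m = 1"
    by simp
  then have "m = [:- \<alpha> k, 1:]"
    using f(1) fl[of 0] by simp
  then have "coeff m 0 = - \<alpha> k"
    by simp
  then have "- \<alpha> k \<in> N"
    using m'(2) unfolding polys_over_def by (metis mem_Collect_eq)
  then show ?thesis
    using subring_uminus[OF RN, of "- \<alpha> k"] by simp
qed

lemma PAC_splits_in_galois:
  fixes K0 K L :: "'a::alg_closed_field set"
  assumes ext: "separable_algebraic_extension K0 K" and PAC: "PAC_extension K0 K"
    and c: "c \<in> K" "c \<notin> K0" and L: "galois_extension K0 L" and KN: "K \<subseteq> L"
    and p: "p \<in> polys_over K" "lead_coeff p = 1" "rsquarefree p" and root: "poly p a = 0"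
  shows "a \<in> L"
proof -
  have K0: "is_subfield K0" and K: "is_subfield K" and K0K: "K0 \<subseteq> K"
    using ext unfolding separable_algebraic_extension_def algebraic_extension_def field_extension_def by auto
  have Nf: "is_subfield L"
    using L unfolding galois_extension_def separable_algebraic_extension_def algebraic_extension_def
      field_extension_def by auto
  note RK = is_subfield_imp_subring[OF K] and RN = is_subfield_imp_subring[OF Nf]
  have "separable_element K0 c"
    using ext c(1) unfolding separable_algebraic_extension_def by blast
  then obtain q where q: "is_min_poly K0 c q" "rsquarefree q"
    unfolding separable_element_def by blast
  have q': "lead_coeff q = 1" "q \<in> polys_over K0" "poly q c = 0"
    using q(1) unfolding is_min_poly_iff[OF K0] by auto
  obtain q1 r where q1: "q1 \<in> polys_over K" "q = q1 * [:- c, 1:] + r" "r = 0 \<or> degree r < degree [:- c, 1:]"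
    by (rule monic_division[OF RK _ linear_in_polys_over[OF RK c(1)] polys_over_mono[OF K0K q'(2)]]) simp
  have "poly r c = 0"
    using q'(3) q1(2) by simp
  then have "r = 0"
    using q1(3) by (auto elim: degree_eq_zeroE)
  then have qq1: "q = [:- c, 1:] * q1"
    using q1(2) by (simp add: mult.commute)
  have "q1 \<noteq> 0"
    using qq1 q'(1) by auto
  then have degq: "degree q = Suc (degree q1)"
    unfolding qq1 by (subst degree_mult_eq) auto
  have lq1: "lead_coeff q1 = 1"
    using q'(1) unfolding qq1 lead_coeff_mult by simp
  \<comment> \<open>Here \<open>c \<notin> K0\<close> enters: \<open>c\<close> has a conjugate other
    than itself.\<close>
  have "degree q1 > 0"
  proof (rule ccontr)
    assume "\<not> degree q1 > 0"
    then have "q1 = 1"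
      using lq1 monic_degree_zero by blast
    then have "coeff q 0 = - c"
      using qq1 by simp
    then have "- c \<in> K0"
      using q'(2) unfolding polys_over_def by (metis mem_Collect_eq)
    then show False
      using c(2) K0 unfolding is_subfield_def by (metis minus_minus)
  qed
  define e where "e = degree q1"
  define n where "n = degree p"
  have "rsquarefree q1"
    using rsquarefree_factor q(2) unfolding qq1 by blast
  then obtain \<gamma> where \<gamma>: "q1 = (\<Prod>l<e. [:- \<gamma> l, 1:])" "inj_on \<gamma> {..<e}"
    using rsquarefree_monic_split[OF _ lq1, of e] unfolding e_def by blast
  obtain \<alpha> where \<alpha>: "p = (\<Prod>k<n. [:- \<alpha> k, 1:])" "inj_on \<alpha> {..<n}"
    using rsquarefree_monic_split[OF p(3,2), of n] unfolding n_def by blast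
  have "poly (pderiv q) c \<noteq> 0"
    using q(2) q'(3) rsquarefree_iff_pderiv[of q] unfolding rsquarefree_def by blast
  then have q1c: "poly q1 c \<noteq> 0"
    unfolding qq1 pderiv_mult by (simp add: pderiv_pCons)
  interpret twisted_family K c q1 p \<gamma> \<alpha> e n
  proof
    show "poly q1 (\<gamma> l) = 0" if "l < e" for l
      using that by (subst \<gamma>(1)) (auto simp: poly_prod intro!: prod_zero bexI[of _ l])
    show "poly p (\<alpha> k) = 0" if "k < n" for k
      using that by (subst \<alpha>(1)) (auto simp: poly_prod intro!: prod_zero bexI[of _ k])
  qed (fact K c(1) q1(1) lq1 e_def[symmetric] \<gamma>(2) q1c p(1,2) n_def[symmetric] \<alpha>(2))+
  obtain z where z: "\<And>m. m < Suc N \<Longrightarrow> z m \<in> K"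
    "\<And>i j. i < n \<Longrightarrow> j \<le> e \<Longrightarrow> insertion z (family_coeff i j) \<in> K0" "inj_on z {..<n}"
    using PAC_point[OF PAC] by blast
  note hom = comm_ring_hom_insertion[of z]
  define b where "b = (\<lambda>i j. insertion z (family_coeff i j))"
  have l0: "0 < e"
    using \<open>degree q1 > 0\<close> unfolding e_def .
  define c' where "c' = \<gamma> 0"
  have c': "poly q c' = 0"
    unfolding qq1 c'_def using root_\<gamma>[OF l0] by simp
  have c'L: "c' \<in> L"
    using L q(1) c' c(1) KN unfolding galois_extension_def normal_extension_def by blast
  have zK: "z k \<in> K" if "k < n" for k
    using that by (intro z(1)) (simp add: N_def)
  \<comment> \<open>\<open>U(c, X)\<close> has the roots \<open>z k\<close> and so divides
    \<open>M\<close>. Since \<open>M\<close> and the coefficients \<open>b i j\<close> are over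
    \<open>K0\<close>, \<open>U(c', X)\<close> divides \<open>M\<close> too, which makes its roots
    distinct and places them in \<open>L\<close>.\<close>
  obtain M where M: "M \<in> polys_over K0" "rsquarefree M" "\<And>x. x \<in> z ` {..<n} \<Longrightarrow> poly M x = 0"
    "\<And>y. poly M y = 0 \<Longrightarrow> y \<in> L"
    using separable_common_multiple[OF K0 L, of "z ` {..<n}"] zK KN by blast
  have Uc: "family_poly n e b c = (\<Prod>k<n. [:- z k, 1:])"
    using family_poly_at_c[OF hom] unfolding b_def by simp
  define \<theta> where "\<theta> = (\<lambda>k. insertion z (theta k c'))"
  have Uc': "family_poly n e b c' = (\<Prod>k<n. [:- \<theta> k, 1:])"
    using family_poly_at_\<gamma>[OF hom l0] unfolding b_def \<theta>_def c'_def by simp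
  obtain h where h: "M = h * family_poly n e b c'"
  proof (rule family_poly_dvd_conjugate[OF K0 q(1) c' _ M(1) z(3)])
    show "b i j \<in> K0" if "i < n" "j \<le> e" for i j
      using z(2)[OF that] unfolding b_def .
    show "poly (family_poly n e b c) (z k) = 0" if "k < n" for k
      unfolding Uc using that by (auto simp: poly_prod intro!: prod_zero bexI[of _ k])
    show "poly M (z k) = 0" if "k < n" for k
      using M(3) that by blast
  qed auto
  have \<theta>N: "\<theta> k \<in> L" if "k < n" for k
  proof (rule M(4))
    have "poly (\<Prod>k<n. [:- \<theta> k, 1:]) (\<theta> k) = 0"
      using that by (auto simp: poly_prod intro!: prod_zero bexI[of _ k])
    then show "poly M (\<theta> k) = 0"
      unfolding h Uc' by simp
  qed
  have \<theta>inj: "inj_on \<theta> {..<n}"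
    using M(2) rsquarefree_factor rsquarefree_prod_linear_inj unfolding h Uc' by blast
  \<comment> \<open>The algebra element specialised at the PAC point and at \<open>T = c'\<close>.
    Its coefficients lie in \<open>L\<close> because the \<open>y\<close> values lie in
    \<open>K\<close> and \<open>c'\<close> is a conjugate of \<open>c\<close>; it maps the roots of
    \<open>p\<close> injectively to the roots of \<open>U(c', X)\<close>.\<close>
  define g where "g = (\<Sum>i<n. Polynomial.monom (\<Sum>j<e. insertion z (yvar i j) * c' ^ j) i)"
  have g: "poly g (\<alpha> k) = \<theta> k" for k
    unfolding g_def \<theta>_def poly_sum_monom hom_theta[OF hom] by simp
  have "insertion z (yvar i j) \<in> L" if "i < n" "j < e" for i j
    using z(1)[of "n + i * e + j"] index_less_N[OF that] KN unfolding yvar_def by auto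
  then have gN: "g \<in> polys_over L"
    unfolding g_def using c'L
    by (intro subring_sum[OF subring_polys_over[OF RN]] monom_in_polys_over[OF RN] subring_sum[OF RN]
        subring_mult[OF RN] subring_power[OF RN]) auto
  obtain k where k: "k < n" "a = \<alpha> k"
    using root unfolding \<alpha>(1) by (auto simp: poly_prod)
  have "\<alpha> k \<in> L"
    using root_in_subfield[OF Nf _ \<alpha>(2) gN _ _ k(1)] polys_over_mono[OF KN p(1)] \<theta>N \<theta>inj
    unfolding g \<alpha>(1) by blast
  then show ?thesis
    using k by simp
qed

lemma PAC_separable_in_galois:
  fixes K0 K N :: "'a::alg_closed_field set"
  assumes ext: "separable_algebraic_extension K0 K" and PAC: "PAC_extension K0 K" and ne: "K \<noteq> K0"
    and N: "galois_extension K0 N" "K \<subseteq> N" and a: "separable_element K a"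
  shows "a \<in> N"
proof -
  have K: "is_subfield K" and "K0 \<subseteq> K"
    using ext unfolding separable_algebraic_extension_def algebraic_extension_def field_extension_def by auto
  then obtain c where "c \<in> K" "c \<notin> K0"
    using ne by blast
  moreover obtain p where "is_min_poly K a p" "rsquarefree p"
    using a unfolding separable_element_def by blast
  ultimately show ?thesis
    using PAC_splits_in_galois[OF ext PAC _ _ N] unfolding is_min_poly_iff[OF K] by blast
qed

lemma galois_separable_closure:
  assumes F: "is_subfield F"
  shows "galois_extension F (separable_closure F)"
proof -
  have "algebraic_extension F (separable_closure F)"
    unfolding algebraic_extension_def field_extension_def
    using F subfield_separable_closure[OF F] subset_separable_closure[OF F] separable_imp_algebraic
    by (auto simp: separable_closure_def)
  moreover have "y \<in> separable_closure F"
    if "x \<in> separable_closure F" "is_min_poly F x p" "poly p y = 0" for x p y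
    using that min_poly_conjugate[OF F that(2,3)] separable_min_poly_rsquarefree[OF F _ that(2)]
    unfolding separable_closure_def mem_Collect_eq separable_element_def[of F y] by blast
  ultimately show ?thesis
    unfolding galois_extension_def separable_algebraic_extension_def normal_extension_def
    by (auto simp: separable_closure_def)
qed

theorem theorem1:
  fixes K\<^sub>0 K :: "'a::alg_closed_field set"
  shows "(separable_algebraic_extension K\<^sub>0 K \<and> K \<noteq> K\<^sub>0 \<and> PAC_extension K\<^sub>0 K \<longrightarrow>
            galois_closure K\<^sub>0 K = separable_closure K\<^sub>0) \<and>
         (galois_extension K\<^sub>0 K \<and> PAC_extension K\<^sub>0 K \<longrightarrow>
            K = K\<^sub>0 \<or> K = separable_closure K)"
proof (intro conjI impI; elim conjE)
  assume ext: "separable_algebraic_extension K\<^sub>0 K" and ne: "K \<noteq> K\<^sub>0" and PAC: "PAC_extension K\<^sub>0 K"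
  have K0: "is_subfield K\<^sub>0" and K: "is_subfield K" and K0K: "K\<^sub>0 \<subseteq> K"
    using ext unfolding separable_algebraic_extension_def algebraic_extension_def field_extension_def by auto
  have "K \<subseteq> separable_closure K\<^sub>0"
    using ext unfolding separable_algebraic_extension_def separable_closure_def by auto
  then have "galois_closure K\<^sub>0 K \<subseteq> separable_closure K\<^sub>0"
    unfolding galois_closure_def using galois_separable_closure[OF K0] by blast
  \<comment> \<open>An element separable over the small field is separable over \<open>K\<close>,
    hence lies in every Galois extension that contains \<open>K\<close>.\<close>
  moreover have "separable_closure K\<^sub>0 \<subseteq> N" if "galois_extension K\<^sub>0 N" "K \<subseteq> N" for N
    using PAC_separable_in_galois[OF ext PAC ne that] separable_element_mono[OF K0 K K0K]
    unfolding separable_closure_def by blast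
  then have "separable_closure K\<^sub>0 \<subseteq> galois_closure K\<^sub>0 K"
    unfolding galois_closure_def by blast
  ultimately show "galois_closure K\<^sub>0 K = separable_closure K\<^sub>0"
    by blast
next
  assume gal: "galois_extension K\<^sub>0 K" and PAC: "PAC_extension K\<^sub>0 K"
  then have ext: "separable_algebraic_extension K\<^sub>0 K"
    unfolding galois_extension_def by blast
  then have K: "is_subfield K"
    unfolding separable_algebraic_extension_def algebraic_extension_def field_extension_def by auto
  show "K = K\<^sub>0 \<or> K = separable_closure K"
  proof (cases "K = K\<^sub>0")
    case False
    \<comment> \<open>\<open>K\<close> itself serves as the Galois extension containing
      \<open>K\<close>.\<close>
    then have "separable_closure K \<subseteq> K"
      using PAC_separable_in_galois[OF ext PAC False gal order_refl] unfolding separable_closure_def by blast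
    then show ?thesis
      using subset_separable_closure[OF K] by blast
  qed simp
qed

end
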